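(* Let $G$ be a discrete group and $K$ a $G$-equivariant discrete monoid with unit. The elements of the group $$MS_G(K)=\{[\alpha\oplus\beta]\in H^3(\mathrm{Tot}^*(A^{*,*}/A^{*,*>2}))\ :\ [\delta_K\beta]=1\}$$ are in one to one correspondence with the set of isomorphism classes of ring structures on the twisted $G$-equivariant K-theory of the monoid $K$, i.e. of the ring structures $\mathbb{KU}_G(K;\alpha,\beta)$ determined by multiplicative structures $(\alpha,\beta)$ for $K$, where two multiplicative structures $(\alpha,\beta)$ and $(\alpha',\beta')$ are identified when $\alpha\oplus\beta$ and $\alpha'\oplus\beta'$ are cohomologous as 3-cocycles in $\mathrm{Tot}^*(A^{*,*}/A^{*,*>2})$.
   Context: $\mathbb T=S^1$, written multiplicatively. $C^{p,q}(K\rtimes G,\mathbb T)$ is the group of maps $F:G^p\times K^q\to\mathbb T$, values $F[g_1|\dots|g_p||k_1|\dots|k_q]$, equal to $1$ if some $g_i$ or $k_j$ is the identity, with differentials $(\delta_GF)[g_1|\dots|g_{p+1}||k_1|\dots|k_q]=F[g_2|\dots|g_{p+1}||k_1|\dots|k_q]\prod_{i=1}^pF[\dots|g_ig_{i+1}|\dots||k_1|\dots|k_q]^{(-1)^i}F[g_1|\dots|g_p||g_{p+1}(k_1)|\dots|g_{p+1}(k_q)]^{(-1)^{p+1}}$ and $(\delta_KF)[g_1|\dots|g_p||k_1|\dots|k_{q+1}]=F[\dots||k_2|\dots|k_{q+1}]\prod_{j=1}^qF[\dots||\dots|k_jk_{j+1}|\dots]^{(-1)^j}F[\dots||k_1|\dots|k_q]^{(-1)^{q+1}}$.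 $A^{*,*}=A^{*,*}(K\rtimes G,\mathbb T)$ consists of the $C^{p,q}$ with $q>0$, and $A^{*,*>r}$ of those with $q>r$; total complexes carry the differential $\delta_G\oplus\delta_K^{(-1)^p}$. So $A^{*,*}/A^{*,*>2}$ consists of the rows $q=1,2$. The condition $[\delta_K\beta]=1$ means that $\delta_K\beta=\delta_G\theta$ for some $\theta\in C^{0,3}(K\rtimes G,\mathbb T)$. A multiplicative structure for $K$ is a pair $(\alpha,\beta)$, $\alpha\in C^{2,1}$ with $\delta_G\alpha=1$, $\beta\in C^{1,2}$, with $\delta_G\beta\cdot\delta_K\alpha=1$ and $[\delta_K\beta]=1$. Then $\mathbb{KU}_G(K;\alpha)$ is the Grothendieck group, under direct sum, of isomorphism classes of $\alpha$-twisted $G$-vector bundles over $K$: finite dimensional $K$-graded complex vector spaces $E=\bigoplus_kE_k$ with operators $g\cdot:E_k\to E_{g(k)}$ complex linear and $g\cdot(h\cdot z)=\alpha[g|h||k](gh\cdot z)$ for $z\in E_k$. $\mathbb{KU}_G(K;\alpha,\beta)$ is this group with the product $\star_\beta$ in which $(E\star_\beta F)_k=\bigoplus_{xy=k}E_x\otimes F_y$ with action $g\cdot(u\otimes v)=\beta[g||x|y]\,(g\cdot u)\otimes(g\cdot v)$ for $u\in E_x,v\in F_y$. *)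

theory Defs
  imports
    Complex_Main
    "HOL-Library.Nat_Bijection"
    "HOL-Algebra.Group_Action"
    "HOL-Algebra.QuotRing"
begin

locale equivariant_monoid =
  group G + K: monoid K + group_action G "carrier K" act
  for G :: "('g, 'a) monoid_scheme" (structure)
    and K :: "('k, 'b) monoid_scheme"
    and act :: "'g \<Rightarrow> 'k \<Rightarrow> 'k" +
  assumes act_hom: "g \<in> carrier G \<Longrightarrow> act g \<in> hom K K"
    and act_one: "g \<in> carrier G \<Longrightarrow> act g \<one>\<^bsub>K\<^esub> = \<one>\<^bsub>K\<^esub>"


text \<open>
  The value \<open>F[g_1|...|g_p||k_1|...|k_q]\<close> is \<open>F [g_1,...,g_p] [k_1,...,k_q]\<close>. The circle is the
  set of complex numbers of norm 1. A cochain is a total function: it is extended by 1 to all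
  argument lists that do not belong to \<open>G^p \<times> K^q\<close>, so that equality of
  cochains is equality of functions.
\<close>

type_synonym ('g, 'k) cochain = "'g list \<Rightarrow> 'k list \<Rightarrow> complex"

definition trivial_cochain :: "('g, 'k) cochain" where
  "trivial_cochain = (\<lambda>gs ks. 1)"

definition cochains ::
  "('g, 'a) monoid_scheme \<Rightarrow> ('k, 'b) monoid_scheme \<Rightarrow> nat \<Rightarrow> nat \<Rightarrow> ('g, 'k) cochain set" where
  "cochains G K p q = {F.
     (\<forall>gs ks. norm (F gs ks) = 1) \<and>
     (\<forall>gs ks. \<one>\<^bsub>G\<^esub> \<in> set gs \<or> \<one>\<^bsub>K\<^esub> \<in> set ks \<longrightarrow> F gs ks = 1) \<and>
     (\<forall>gs ks. \<not> (gs \<in> lists (carrier G) \<and> length gs = p \<and> ks \<in> lists (carrier K) \<and> length ks = q)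
        \<longrightarrow> F gs ks = 1)}"

text \<open>\<open>merge M i [x_1,...,x_n] = [x_1,...,x_i x_{i+1},...,x_n]\<close>, for \<open>1 \<le> i < n\<close>.\<close>

definition merge :: "('x, 'c) monoid_scheme \<Rightarrow> nat \<Rightarrow> 'x list \<Rightarrow> 'x list" where
  "merge M i xs = take (i - 1) xs @ (xs ! (i - 1) \<otimes>\<^bsub>M\<^esub> xs ! i) # drop (i + 1) xs"

text \<open>
  In both differentials the bidegree \<open>(p, q)\<close> of \<open>F\<close> is read off from the argument lists:
  \<open>length gs = p + 1\<close> in \<open>\<delta>_G\<close>, and \<open>length ks = q + 1\<close> in \<open>\<delta>_K\<close>. On lists of any other
  lengths all factors are 1.
\<close>

definition delta_G ::
  "('g, 'a) monoid_scheme \<Rightarrow> ('k, 'b) monoid_scheme \<Rightarrow> ('g \<Rightarrow> 'k \<Rightarrow> 'k) \<Rightarrow>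
   ('g, 'k) cochain \<Rightarrow> ('g, 'k) cochain" where
  "delta_G G K act F = (\<lambda>gs ks.
     if gs \<noteq> [] \<and> gs \<in> lists (carrier G) \<and> ks \<in> lists (carrier K)
     then F (tl gs) ks
        * (\<Prod>i = 1..<length gs. F (merge G i gs) ks powi ((- 1) ^ i))
        * F (butlast gs) (map (act (last gs)) ks) powi ((- 1) ^ length gs)
     else 1)"

definition delta_K ::
  "('g, 'a) monoid_scheme \<Rightarrow> ('k, 'b) monoid_scheme \<Rightarrow> ('g, 'k) cochain \<Rightarrow> ('g, 'k) cochain" where
  "delta_K G K F = (\<lambda>gs ks.
     if ks \<noteq> [] \<and> gs \<in> lists (carrier G) \<and> ks \<in> lists (carrier K)
     then F gs (tl ks)
        * (\<Prod>j = 1..<length ks. F gs (merge K j ks) powi ((- 1) ^ j))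
        * F gs (butlast ks) powi ((- 1) ^ length ks)
     else 1)"


text \<open>
  The complex \<open>Tot^*(A^{*,*}/A^{*,*>r})\<close>, consisting of the rows \<open>1 \<le> q \<le> r\<close>. A total cochain of
  degree \<open>n\<close> is a family \<open>c\<close> with row-\<open>q\<close> component \<open>c q \<in> C^{n-q,q}\<close>; rows that do not occur
  are filled with the trivial cochain.
\<close>

type_synonym ('g, 'k) total_cochain = "nat \<Rightarrow> ('g, 'k) cochain"

definition tot_group ::
  "('g, 'a) monoid_scheme \<Rightarrow> ('k, 'b) monoid_scheme \<Rightarrow> nat \<Rightarrow> nat \<Rightarrow> ('g, 'k) total_cochain monoid"
  where
  "tot_group G K r n = \<lparr>
     carrier = {c. \<forall>q. if 1 \<le> q \<and> q \<le> r \<and> q \<le> n then c q \<in> cochains G K (n - q) q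
                       else c q = trivial_cochain},
     mult = (\<lambda>c d q gs ks. c q gs ks * d q gs ks),
     one = (\<lambda>q. trivial_cochain)\<rparr>"

text \<open>
  The exponent \<open>(-1)^p\<close> of \<open>\<delta>_K\<close> is \<open>(-1)^{length gs}\<close>. The component \<open>c 0\<close> is trivial, so
  row 1 of the differential is \<open>\<delta>_G (c 1)\<close>.
\<close>

definition tot_diff ::
  "('g, 'a) monoid_scheme \<Rightarrow> ('k, 'b) monoid_scheme \<Rightarrow> ('g \<Rightarrow> 'k \<Rightarrow> 'k) \<Rightarrow> nat \<Rightarrow>
   ('g, 'k) total_cochain \<Rightarrow> ('g, 'k) total_cochain" where
  "tot_diff G K act r c = (\<lambda>q.
     if 1 \<le> q \<and> q \<le> r
     then (\<lambda>gs ks. delta_G G K act (c q) gs ks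
                   * delta_K G K (c (q - 1)) gs ks powi ((- 1) ^ length gs))
     else trivial_cochain)"

definition tot_cocycles ::
  "('g, 'a) monoid_scheme \<Rightarrow> ('k, 'b) monoid_scheme \<Rightarrow> ('g \<Rightarrow> 'k \<Rightarrow> 'k) \<Rightarrow> nat \<Rightarrow> nat \<Rightarrow>
   ('g, 'k) total_cochain monoid" where
  "tot_cocycles G K act r n = (tot_group G K r n)\<lparr>carrier :=
     kernel (tot_group G K r n) (tot_group G K r (n + 1)) (tot_diff G K act r)\<rparr>"

text \<open>The degree \<open>n - 1\<close> is harmless at \<open>n = 0\<close>: the group in degree 0 is trivial.\<close>

definition tot_coboundaries ::
  "('g, 'a) monoid_scheme \<Rightarrow> ('k, 'b) monoid_scheme \<Rightarrow> ('g \<Rightarrow> 'k \<Rightarrow> 'k) \<Rightarrow> nat \<Rightarrow> nat \<Rightarrow>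
   ('g, 'k) total_cochain set" where
  "tot_coboundaries G K act r n = tot_diff G K act r ` carrier (tot_group G K r (n - 1))"

definition tot_cohomology ::
  "('g, 'a) monoid_scheme \<Rightarrow> ('k, 'b) monoid_scheme \<Rightarrow> ('g \<Rightarrow> 'k \<Rightarrow> 'k) \<Rightarrow> nat \<Rightarrow> nat \<Rightarrow>
   ('g, 'k) total_cochain set monoid" where
  "tot_cohomology G K act r n = tot_cocycles G K act r n Mod tot_coboundaries G K act r n"

definition cohomology_class ::
  "('g, 'a) monoid_scheme \<Rightarrow> ('k, 'b) monoid_scheme \<Rightarrow> ('g \<Rightarrow> 'k \<Rightarrow> 'k) \<Rightarrow> nat \<Rightarrow> nat \<Rightarrow>
   ('g, 'k) total_cochain \<Rightarrow> ('g, 'k) total_cochain set" where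
  "cohomology_class G K act r n c =
     tot_coboundaries G K act r n #>\<^bsub>tot_cocycles G K act r n\<^esub> c"

definition cohomologous ::
  "('g, 'a) monoid_scheme \<Rightarrow> ('k, 'b) monoid_scheme \<Rightarrow> ('g \<Rightarrow> 'k \<Rightarrow> 'k) \<Rightarrow> nat \<Rightarrow> nat \<Rightarrow>
   ('g, 'k) total_cochain \<Rightarrow> ('g, 'k) total_cochain \<Rightarrow> bool" where
  "cohomologous G K act r n c c' \<longleftrightarrow>
     (\<exists>b \<in> tot_coboundaries G K act r n. c = b \<otimes>\<^bsub>tot_group G K r n\<^esub> c')"

text \<open>The total cochain \<open>\<alpha> \<oplus> \<beta>\<close>, with \<open>\<alpha>\<close> in row 1 and \<open>\<beta>\<close> in row 2.\<close>

definition tot_pair :: "('g, 'k) cochain \<Rightarrow> ('g, 'k) cochain \<Rightarrow> ('g, 'k) total_cochain" where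
  "tot_pair \<alpha> \<beta> = (\<lambda>q. trivial_cochain)(1 := \<alpha>, 2 := \<beta>)"

definition delta_K_class_trivial ::
  "('g, 'a) monoid_scheme \<Rightarrow> ('k, 'b) monoid_scheme \<Rightarrow> ('g \<Rightarrow> 'k \<Rightarrow> 'k) \<Rightarrow>
   ('g, 'k) cochain \<Rightarrow> bool" where
  "delta_K_class_trivial G K act \<beta> \<longleftrightarrow>
     (\<exists>\<theta> \<in> cochains G K 0 3. delta_K G K \<beta> = delta_G G K act \<theta>)"

definition MS ::
  "('g, 'a) monoid_scheme \<Rightarrow> ('k, 'b) monoid_scheme \<Rightarrow> ('g \<Rightarrow> 'k \<Rightarrow> 'k) \<Rightarrow>
   ('g, 'k) total_cochain set set" where
  "MS G K act = {cohomology_class G K act 2 3 (tot_pair \<alpha> \<beta>) | \<alpha> \<beta>.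
     tot_pair \<alpha> \<beta> \<in> carrier (tot_cocycles G K act 2 3) \<and> delta_K_class_trivial G K act \<beta>}"

definition multiplicative_structures ::
  "('g, 'a) monoid_scheme \<Rightarrow> ('k, 'b) monoid_scheme \<Rightarrow> ('g \<Rightarrow> 'k \<Rightarrow> 'k) \<Rightarrow>
   (('g, 'k) cochain \<times> ('g, 'k) cochain) set" where
  "multiplicative_structures G K act = {(\<alpha>, \<beta>).
     \<alpha> \<in> cochains G K 2 1 \<and> delta_G G K act \<alpha> = trivial_cochain \<and>
     \<beta> \<in> cochains G K 1 2 \<and>
     (\<forall>gs ks. delta_G G K act \<beta> gs ks * delta_K G K \<alpha> gs ks = 1) \<and>
     delta_K_class_trivial G K act \<beta>}"


text \<open>
  A finite dimensional \<open>K\<close>-graded complex vector space has a homogeneous basis, so up to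
  isomorphism it is \<open>\<complex>^B\<close> for a finite set \<open>B\<close> of labels, each label with a degree in \<open>K\<close>.
  We use natural numbers as labels; since only isomorphism classes matter below, this loses no
  bundles. A vector is a function \<open>nat \<Rightarrow> complex\<close> supported on \<open>B\<close>, and its homogeneous
  components are its restrictions to the labels of a given degree. The operators \<open>oper E g\<close> are
  arbitrary linear maps and only their values on \<open>total E\<close> are relevant.
\<close>

record ('g, 'k) graded_rep =
  labels :: "nat set"
  degr :: "nat \<Rightarrow> 'k"
  oper :: "'g \<Rightarrow> (nat \<Rightarrow> complex) \<Rightarrow> (nat \<Rightarrow> complex)"

definition total :: "('g, 'k) graded_rep \<Rightarrow> (nat \<Rightarrow> complex) set" where
  "total E = {v. \<forall>i. i \<notin> labels E \<longrightarrow> v i = 0}"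

definition fibre :: "('g, 'k) graded_rep \<Rightarrow> 'k \<Rightarrow> (nat \<Rightarrow> complex) set" where
  "fibre E k = {v \<in> total E. \<forall>i. degr E i \<noteq> k \<longrightarrow> v i = 0}"

definition complex_linear_on ::
  "(nat \<Rightarrow> complex) set \<Rightarrow> ((nat \<Rightarrow> complex) \<Rightarrow> (nat \<Rightarrow> complex)) \<Rightarrow> bool" where
  "complex_linear_on V f \<longleftrightarrow> (\<forall>u\<in>V. \<forall>v\<in>V. \<forall>a b.
     f (\<lambda>i. a * u i + b * v i) = (\<lambda>i. a * f u i + b * f v i))"

text \<open>
  That the identity of \<open>G\<close> acts as the identity is part of the meaning of a \<open>G\<close>-vector bundle.
  It does not follow from the twisted composition law, which also holds for zero operators.
\<close>

definition twisted_bundle ::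
  "('g, 'a) monoid_scheme \<Rightarrow> ('k, 'b) monoid_scheme \<Rightarrow> ('g \<Rightarrow> 'k \<Rightarrow> 'k) \<Rightarrow>
   ('g, 'k) cochain \<Rightarrow> ('g, 'k) graded_rep \<Rightarrow> bool" where
  "twisted_bundle G K act \<alpha> E \<longleftrightarrow>
     finite (labels E) \<and> degr E ` labels E \<subseteq> carrier K \<and>
     (\<forall>g\<in>carrier G. complex_linear_on (total E) (oper E g)) \<and>
     (\<forall>g\<in>carrier G. \<forall>k\<in>carrier K. oper E g ` fibre E k \<subseteq> fibre E (act g k)) \<and>
     (\<forall>z\<in>total E. oper E \<one>\<^bsub>G\<^esub> z = z) \<and>
     (\<forall>g\<in>carrier G. \<forall>h\<in>carrier G. \<forall>k\<in>carrier K. \<forall>z\<in>fibre E k.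
        oper E g (oper E h z) = (\<lambda>i. \<alpha> [g, h] [k] * oper E (g \<otimes>\<^bsub>G\<^esub> h) z i))"

definition bundle_iso ::
  "('g, 'a) monoid_scheme \<Rightarrow> ('k, 'b) monoid_scheme \<Rightarrow>
   ('g, 'k) graded_rep \<Rightarrow> ('g, 'k) graded_rep \<Rightarrow> bool" where
  "bundle_iso G K E F \<longleftrightarrow> (\<exists>\<phi>.
     complex_linear_on (total E) \<phi> \<and> bij_betw \<phi> (total E) (total F) \<and>
     (\<forall>k\<in>carrier K. \<phi> ` fibre E k = fibre F k) \<and>
     (\<forall>g\<in>carrier G. \<forall>z\<in>total E. \<phi> (oper E g z) = oper F g (\<phi> z)))"

definition bundle_zero :: "('k, 'b) monoid_scheme \<Rightarrow> ('g, 'k) graded_rep" where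
  "bundle_zero K = \<lparr>labels = {}, degr = (\<lambda>i. \<one>\<^bsub>K\<^esub>), oper = (\<lambda>g z. z)\<rparr>"

text \<open>The unit for the product: the trivial representation \<open>\<complex>\<close> in degree \<open>\<one>\<close>.\<close>

definition bundle_unit :: "('k, 'b) monoid_scheme \<Rightarrow> ('g, 'k) graded_rep" where
  "bundle_unit K = \<lparr>labels = {0}, degr = (\<lambda>i. \<one>\<^bsub>K\<^esub>), oper = (\<lambda>g z. z)\<rparr>"

definition bundle_sum ::
  "('g, 'k) graded_rep \<Rightarrow> ('g, 'k) graded_rep \<Rightarrow> ('g, 'k) graded_rep" where
  "bundle_sum E F = \<lparr>
     labels = sum_encode ` (labels E <+> labels F),
     degr = (\<lambda>n. case sum_decode n of Inl i \<Rightarrow> degr E i | Inr j \<Rightarrow> degr F j),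
     oper = (\<lambda>g z n. case sum_decode n of
        Inl i \<Rightarrow> oper E g (\<lambda>i'. z (sum_encode (Inl i'))) i
      | Inr j \<Rightarrow> oper F g (\<lambda>j'. z (sum_encode (Inr j'))) j)\<rparr>"

definition basis_vector :: "nat \<Rightarrow> nat \<Rightarrow> complex" where
  "basis_vector i = (\<lambda>n. if n = i then 1 else 0)"

definition pure_tensor :: "(nat \<Rightarrow> complex) \<Rightarrow> (nat \<Rightarrow> complex) \<Rightarrow> nat \<Rightarrow> complex" where
  "pure_tensor u v = (\<lambda>n. u (fst (prod_decode n)) * v (snd (prod_decode n)))"

text \<open>
  The basis of \<open>E \<star>\<^sub>\<beta> F\<close> consists of the \<open>e_i \<otimes> f_j\<close>, placed in degree the product of the degrees,
  so that the component of degree \<open>k\<close> is the sum of the \<open>E_x \<otimes> F_y\<close> with \<open>xy = k\<close>. The operator of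
  \<open>g\<close> is the linear map with \<open>e_i \<otimes> f_j \<mapsto> \<beta>[g||deg e_i|deg f_j] (g e_i) \<otimes> (g f_j)\<close>, which is the
  linear map given by \<open>u \<otimes> v \<mapsto> \<beta>[g||x|y] (g u) \<otimes> (g v)\<close> for \<open>u \<in> E_x\<close>, \<open>v \<in> F_y\<close>.
\<close>

definition bundle_star ::
  "('k, 'b) monoid_scheme \<Rightarrow> ('g, 'k) cochain \<Rightarrow>
   ('g, 'k) graded_rep \<Rightarrow> ('g, 'k) graded_rep \<Rightarrow> ('g, 'k) graded_rep" where
  "bundle_star K \<beta> E F = \<lparr>
     labels = prod_encode ` (labels E \<times> labels F),
     degr = (\<lambda>n. degr E (fst (prod_decode n)) \<otimes>\<^bsub>K\<^esub> degr F (snd (prod_decode n))),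
     oper = (\<lambda>g z n. \<Sum>i\<in>labels E. \<Sum>j\<in>labels F.
        z (prod_encode (i, j)) * \<beta> [g] [degr E i, degr F j]
        * pure_tensor (oper E g (basis_vector i)) (oper F g (basis_vector j)) n)\<rparr>"


text \<open>
  The Grothendieck group: \<open>(E0, E1)\<close> stands for the formal difference \<open>[E0] - [E1]\<close>, and
  \<open>[E0] - [E1] = [F0] - [F1]\<close> iff \<open>E0 \<oplus> F1 \<oplus> H\<close> and \<open>F0 \<oplus> E1 \<oplus> H\<close> are isomorphic for some \<open>H\<close>.
\<close>

type_synonym ('g, 'k) virtual_bundle = "('g, 'k) graded_rep \<times> ('g, 'k) graded_rep"

definition virtual_bundles ::
  "('g, 'a) monoid_scheme \<Rightarrow> ('k, 'b) monoid_scheme \<Rightarrow> ('g \<Rightarrow> 'k \<Rightarrow> 'k) \<Rightarrow>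
   ('g, 'k) cochain \<Rightarrow> ('g, 'k) virtual_bundle set" where
  "virtual_bundles G K act \<alpha> = Collect (twisted_bundle G K act \<alpha>) \<times> Collect (twisted_bundle G K act \<alpha>)"

definition grothendieck_rel ::
  "('g, 'a) monoid_scheme \<Rightarrow> ('k, 'b) monoid_scheme \<Rightarrow> ('g \<Rightarrow> 'k \<Rightarrow> 'k) \<Rightarrow>
   ('g, 'k) cochain \<Rightarrow> ('g, 'k) virtual_bundle rel" where
  "grothendieck_rel G K act \<alpha> = {((E0, E1), (F0, F1)).
     (E0, E1) \<in> virtual_bundles G K act \<alpha> \<and> (F0, F1) \<in> virtual_bundles G K act \<alpha> \<and>
     (\<exists>H. twisted_bundle G K act \<alpha> H \<and>
        bundle_iso G K (bundle_sum (bundle_sum E0 F1) H) (bundle_sum (bundle_sum F0 E1) H))}"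

definition virtual_sum ::
  "('g, 'k) virtual_bundle \<Rightarrow> ('g, 'k) virtual_bundle \<Rightarrow> ('g, 'k) virtual_bundle" where
  "virtual_sum E F = (bundle_sum (fst E) (fst F), bundle_sum (snd E) (snd F))"

definition virtual_star ::
  "('k, 'b) monoid_scheme \<Rightarrow> ('g, 'k) cochain \<Rightarrow>
   ('g, 'k) virtual_bundle \<Rightarrow> ('g, 'k) virtual_bundle \<Rightarrow> ('g, 'k) virtual_bundle" where
  "virtual_star K \<beta> E F =
     (bundle_sum (bundle_star K \<beta> (fst E) (fst F)) (bundle_star K \<beta> (snd E) (snd F)),
      bundle_sum (bundle_star K \<beta> (fst E) (snd F)) (bundle_star K \<beta> (snd E) (fst F)))"

definition KU ::
  "('g, 'a) monoid_scheme \<Rightarrow> ('k, 'b) monoid_scheme \<Rightarrow> ('g \<Rightarrow> 'k \<Rightarrow> 'k) \<Rightarrow>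
   ('g, 'k) cochain \<Rightarrow> ('g, 'k) cochain \<Rightarrow> ('g, 'k) virtual_bundle set ring" where
  "KU G K act \<alpha> \<beta> = \<lparr>
     carrier = virtual_bundles G K act \<alpha> // grothendieck_rel G K act \<alpha>,
     mult = (\<lambda>X Y. \<Union>E\<in>X. \<Union>F\<in>Y. grothendieck_rel G K act \<alpha> `` {virtual_star K \<beta> E F}),
     one = grothendieck_rel G K act \<alpha> `` {(bundle_unit K, bundle_zero K)},
     zero = grothendieck_rel G K act \<alpha> `` {(bundle_zero K, bundle_zero K)},
     add = (\<lambda>X Y. \<Union>E\<in>X. \<Union>F\<in>Y. grothendieck_rel G K act \<alpha> `` {virtual_sum E F})\<rparr>"


text \<open>
  A ring structure on the twisted K-theory of \<open>K\<close> is a ring \<open>KU G K act \<alpha> \<beta>\<close> together with the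
  multiplicative structure that determines it. Ring structures are identified when their
  multiplicative structures are cohomologous; this is finer than abstract ring isomorphism.
\<close>

type_synonym ('g, 'k) ring_structure =
  "(('g, 'k) cochain \<times> ('g, 'k) cochain) \<times> ('g, 'k) virtual_bundle set ring"

definition ring_structure_of ::
  "('g, 'a) monoid_scheme \<Rightarrow> ('k, 'b) monoid_scheme \<Rightarrow> ('g \<Rightarrow> 'k \<Rightarrow> 'k) \<Rightarrow>
   ('g, 'k) cochain \<times> ('g, 'k) cochain \<Rightarrow> ('g, 'k) ring_structure" where
  "ring_structure_of G K act m = (m, KU G K act (fst m) (snd m))"

definition ring_structures ::
  "('g, 'a) monoid_scheme \<Rightarrow> ('k, 'b) monoid_scheme \<Rightarrow> ('g \<Rightarrow> 'k \<Rightarrow> 'k) \<Rightarrow>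
   ('g, 'k) ring_structure set" where
  "ring_structures G K act = ring_structure_of G K act ` multiplicative_structures G K act"

definition ring_structure_rel ::
  "('g, 'a) monoid_scheme \<Rightarrow> ('k, 'b) monoid_scheme \<Rightarrow> ('g \<Rightarrow> 'k \<Rightarrow> 'k) \<Rightarrow>
   ('g, 'k) ring_structure rel" where
  "ring_structure_rel G K act = {(((\<alpha>, \<beta>), R), ((\<alpha>', \<beta>'), R')).
     ((\<alpha>, \<beta>), R) \<in> ring_structures G K act \<and> ((\<alpha>', \<beta>'), R') \<in> ring_structures G K act \<and>
     cohomologous G K act 2 3 (tot_pair \<alpha> \<beta>) (tot_pair \<alpha>' \<beta>')}"

end

theory Submission
  imports Defs
begin

text \<open>
  A multiplicative structure \<open>(\<alpha>, \<beta>)\<close> is exactly a 3-cocycle \<open>\<alpha> \<oplus> \<beta>\<close> of the two-row complex with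
  \<open>[\<delta>_K \<beta>] = 1\<close>, so the bijection itself is formal. The content is that the objects exist.
  Choosing homogeneous bases turns twisted bundles into families of matrices and isomorphisms into
  intertwining matrices. The relation \<open>\<delta>_G \<beta> \<cdot> \<delta>_K \<alpha> = 1\<close> makes \<open>E \<star>\<^sub>\<beta> F\<close> an \<open>\<alpha>\<close>-twisted bundle, and a
  cochain \<open>\<theta>\<close> with \<open>\<delta>_K \<beta> = \<delta>_G \<theta>\<close> rescales the obvious associator to an isomorphism. Hence
  isomorphism classes form a semiring, and the Grothendieck construction gives a ring. If
  \<open>\<alpha>' \<oplus> \<beta>'\<close> differs from \<open>\<alpha> \<oplus> \<beta>\<close> by the coboundary of \<open>a \<oplus> b\<close>, multiplying the operator of \<open>g\<close> on
  \<open>E_k\<close> by \<open>a[g||k]\<close> carries \<open>\<alpha>\<close>-twisted to \<open>\<alpha>'\<close>-twisted bundles, and \<open>b\<close> provides the comparison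
  isomorphism between the two products.
\<close>

section \<open>The Grothendieck ring of a semiring given up to congruence\<close>

text \<open>\<open>KU\<close> consists of classes of pairs of concrete bundles, and for concrete
  bundles the semiring laws hold only up to isomorphism. The ring construction is therefore carried
  out for any set \<open>S\<close> with raw operations and a surjection \<open>q\<close> onto a
  semiring; for bundles \<open>q\<close> takes isomorphism classes. The semiring is not assumed
  cancellative, hence the stabilising summand in every relation.

  One observation carries all matrix computations. The scalars \<alpha>, \<beta>, \<open>a\<close>,
  \<open>b\<close> and the values of \<theta> depend only on degrees. A nonzero entry of the
  operator of \<open>g\<close> leads from degree \<open>x\<close> to degree \<open>act g x\<close>,
  and a nonzero entry of an isomorphism keeps the degree. So a scalar evaluated at a summation label
  can be rewritten at the fixed column label, after which it leaves the sum.

  Being a cocycle of the two-row complex says nothing about \<open>\<delta>_K \<beta>\<close>: it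
  would lie in row 3, which has been divided out. The separate condition on it is what associativity
  of the product requires. Isomorphism classes do not record which associator was chosen, so the
  choice of \<theta> leaves no trace in the ring.\<close>

locale semiring_presentation =
  semiring R for R :: "('r, 'c) ring_scheme" (structure) +
  fixes S :: "'s set" and q :: "'s \<Rightarrow> 'r"
    and plus times :: "'s \<Rightarrow> 's \<Rightarrow> 's" and zer uni :: 's
  assumes q_image: "q ` S = carrier R"
    and plus_closed: "x \<in> S \<Longrightarrow> y \<in> S \<Longrightarrow> plus x y \<in> S"
    and times_closed: "x \<in> S \<Longrightarrow> y \<in> S \<Longrightarrow> times x y \<in> S"
    and zer_closed: "zer \<in> S" and uni_closed: "uni \<in> S"
    and q_plus: "x \<in> S \<Longrightarrow> y \<in> S \<Longrightarrow> q (plus x y) = q x \<oplus> q y"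
    and q_times: "x \<in> S \<Longrightarrow> y \<in> S \<Longrightarrow> q (times x y) = q x \<otimes> q y"
    and q_zer: "q zer = \<zero>" and q_uni: "q uni = \<one>"
begin

text \<open>Has the literal shape of \<open>grothendieck_rel\<close>: the equation compares
  \<open>q\<close> of concrete sums, so that for bundles it reads as an isomorphism between those
  sums.\<close>

definition rel :: "('s \<times> 's) rel" where
  "rel = {((a, b), (c, d)). (a, b) \<in> S \<times> S \<and> (c, d) \<in> S \<times> S \<and>
     (\<exists>h\<in>S. q (plus (plus a d) h) = q (plus (plus c b) h))}"

definition vplus :: "'s \<times> 's \<Rightarrow> 's \<times> 's \<Rightarrow> 's \<times> 's" where
  "vplus x y = (plus (fst x) (fst y), plus (snd x) (snd y))"

definition vtimes :: "'s \<times> 's \<Rightarrow> 's \<times> 's \<Rightarrow> 's \<times> 's" where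
  "vtimes x y = (plus (times (fst x) (fst y)) (times (snd x) (snd y)),
                 plus (times (fst x) (snd y)) (times (snd x) (fst y)))"

definition grothendieck_ring :: "('s \<times> 's) set ring" where
  "grothendieck_ring = \<lparr>
     carrier = (S \<times> S) // rel,
     mult = (\<lambda>X Y. \<Union>x\<in>X. \<Union>y\<in>Y. rel `` {vtimes x y}),
     one = rel `` {(uni, zer)},
     zero = rel `` {(zer, zer)},
     add = (\<lambda>X Y. \<Union>x\<in>X. \<Union>y\<in>Y. rel `` {vplus x y})\<rparr>"

lemma q_closed [simp]: "x \<in> S \<Longrightarrow> q x \<in> carrier R"
  using q_image by auto

declare plus_closed [simp] times_closed [simp] zer_closed [simp] uni_closed [simp]
  q_plus [simp] q_times [simp] q_zer [simp] q_uni [simp]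

text \<open>As \<open>q\<close> maps onto the carrier, the stabilising summand may range over the
  semiring itself, where all later computations take place.\<close>

lemma rel_iff:
  "((a, b), (c, d)) \<in> rel \<longleftrightarrow> a \<in> S \<and> b \<in> S \<and> c \<in> S \<and> d \<in> S \<and>
     (\<exists>h\<in>carrier R. q a \<oplus> q d \<oplus> h = q c \<oplus> q b \<oplus> h)"
proof -
  have "(\<exists>h\<in>S. q (plus (plus a d) h) = q (plus (plus c b) h)) \<longleftrightarrow>
    (\<exists>h\<in>carrier R. q a \<oplus> q d \<oplus> h = q c \<oplus> q b \<oplus> h)"
    if "a \<in> S" "b \<in> S" "c \<in> S" "d \<in> S"
    unfolding q_image [symmetric] using that by simp
  then show ?thesis by (auto simp: rel_def)
qed

lemma relI:
  assumes "a \<in> S" "b \<in> S" "c \<in> S" "d \<in> S" "q a \<oplus> q d = q c \<oplus> q b"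
  shows "((a, b), (c, d)) \<in> rel"
  using assms unfolding rel_iff by (auto intro!: bexI [of _ \<zero>])

text \<open>Chaining the two equations leaves \<open>q d\<close> on both sides. It cannot be
  cancelled, so it joins \<open>h\<close> and \<open>k\<close> in the new stabilising
  summand.\<close>

lemma rel_trans:
  assumes "((a, b), (c, d)) \<in> rel" "((c, d), (e, f)) \<in> rel"
  shows "((a, b), (e, f)) \<in> rel"
proof -
  obtain h k where S: "a \<in> S" "b \<in> S" "c \<in> S" "d \<in> S" "e \<in> S" "f \<in> S"
    and hk: "h \<in> carrier R" "k \<in> carrier R"
    and h: "q a \<oplus> q d \<oplus> h = q c \<oplus> q b \<oplus> h" and k: "q c \<oplus> q f \<oplus> k = q e \<oplus> q d \<oplus> k"
    using assms unfolding rel_iff by blast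
  have "q a \<oplus> q f \<oplus> (q d \<oplus> h \<oplus> k) = (q a \<oplus> q d \<oplus> h) \<oplus> q f \<oplus> k"
    using S hk by (simp add: a_ac)
  also have "\<dots> = (q c \<oplus> q f \<oplus> k) \<oplus> q b \<oplus> h"
    unfolding h using S hk by (simp add: a_ac)
  also have "\<dots> = q e \<oplus> q b \<oplus> (q d \<oplus> h \<oplus> k)"
    unfolding k using S hk by (simp add: a_ac)
  finally show ?thesis
    unfolding rel_iff using S hk
    by (intro conjI bexI [of _ "q d \<oplus> h \<oplus> k"]) simp_all
qed

lemma rel_equiv: "equiv (S \<times> S) rel"
proof (rule equivI)
  show "rel \<subseteq> (S \<times> S) \<times> (S \<times> S)" by (auto simp: rel_def)
  show "refl_on (S \<times> S) rel" by (auto simp: refl_on_def intro: relI)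
  have "((c, d), (a, b)) \<in> rel" if "((a, b), (c, d)) \<in> rel" for a b c d
    using that unfolding rel_iff by metis
  then show "sym rel" by (auto simp: sym_def)
  show "trans rel" unfolding trans_def split_paired_All using rel_trans by blast
qed

lemma class_eqI:
  assumes "a \<in> S" "b \<in> S" "c \<in> S" "d \<in> S" "q a \<oplus> q d = q c \<oplus> q b"
  shows "rel `` {(a, b)} = rel `` {(c, d)}"
  by (rule equiv_class_eq [OF rel_equiv relI [OF assms]])

lemma class_eq_stableI:
  assumes "h \<in> carrier R" "a \<in> S" "b \<in> S" "c \<in> S" "d \<in> S"
    and "q a \<oplus> q d \<oplus> h = q c \<oplus> q b \<oplus> h"
  shows "rel `` {(a, b)} = rel `` {(c, d)}"
  by (rule equiv_class_eq [OF rel_equiv]) (use assms in \<open>unfold rel_iff, intro conjI bexI [of _ h]\<close>)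

lemma vplus_congruent: "congruent2 rel rel (\<lambda>x y. rel `` {vplus x y})"
proof (rule congruent2_commuteI [OF rel_equiv])
  fix x y assume *: "x \<in> S \<times> S" "y \<in> S \<times> S"
  then show "rel `` {vplus x y} = rel `` {vplus y x}"
    by (intro equiv_class_eq [OF rel_equiv]) (auto simp: vplus_def a_ac intro!: relI)
next
  fix x y z assume *: "x \<in> S \<times> S" "(y, z) \<in> rel"
  obtain e f a b c d where [simp]: "x = (e, f)" "y = (a, b)" "z = (c, d)"
    by (metis surj_pair)
  obtain h where S: "a \<in> S" "b \<in> S" "c \<in> S" "d \<in> S" "e \<in> S" "f \<in> S" "h \<in> carrier R"
    and h: "q a \<oplus> q d \<oplus> h = q c \<oplus> q b \<oplus> h"
    using * by (auto simp: rel_iff)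
  have "q e \<oplus> q a \<oplus> (q f \<oplus> q d) \<oplus> h = q e \<oplus> q f \<oplus> (q a \<oplus> q d \<oplus> h)"
    using S by (simp add: a_ac)
  also have "\<dots> = q e \<oplus> q c \<oplus> (q f \<oplus> q b) \<oplus> h"
    unfolding h using S by (simp add: a_ac)
  finally show "rel `` {vplus x y} = rel `` {vplus x z}"
    unfolding vplus_def using S by (intro class_eq_stableI [of h]) simp_all
qed

text \<open>Multiplication need not commute, so each argument is varied separately. For the right
  one, the relation multiplied by \<open>q e\<close> is added to its mirror image multiplied by
  \<open>q f\<close>; the terms with \<open>h\<close> form the stabilising summand. The left one is
  symmetric.\<close>

lemma vtimes_congruent: "congruent2 rel rel (\<lambda>x y. rel `` {vtimes x y})"
proof (rule congruent2I [OF rel_equiv rel_equiv])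
  fix x y z assume *: "x \<in> S \<times> S" "(y, z) \<in> rel"
  obtain e f a b c d where [simp]: "x = (e, f)" "y = (a, b)" "z = (c, d)"
    by (metis surj_pair)
  obtain h where S: "a \<in> S" "b \<in> S" "c \<in> S" "d \<in> S" "e \<in> S" "f \<in> S" "h \<in> carrier R"
    and h: "q a \<oplus> q d \<oplus> h = q c \<oplus> q b \<oplus> h"
    using * by (auto simp: rel_iff)
  have "(q e \<otimes> q a \<oplus> q f \<otimes> q b) \<oplus> (q e \<otimes> q d \<oplus> q f \<otimes> q c) \<oplus> (q e \<otimes> h \<oplus> q f \<otimes> h)
      = q e \<otimes> (q a \<oplus> q d \<oplus> h) \<oplus> q f \<otimes> (q c \<oplus> q b \<oplus> h)"
    using S by (simp add: a_ac r_distr)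
  also have "\<dots> = q e \<otimes> (q c \<oplus> q b \<oplus> h) \<oplus> q f \<otimes> (q a \<oplus> q d \<oplus> h)"
    unfolding h ..
  also have "\<dots> = (q e \<otimes> q c \<oplus> q f \<otimes> q d) \<oplus> (q e \<otimes> q b \<oplus> q f \<otimes> q a) \<oplus> (q e \<otimes> h \<oplus> q f \<otimes> h)"
    using S by (simp add: a_ac r_distr)
  finally show "rel `` {vtimes x y} = rel `` {vtimes x z}"
    unfolding vtimes_def using S
    by (intro class_eq_stableI [of "q e \<otimes> h \<oplus> q f \<otimes> h"]) simp_all
  have "(q a \<otimes> q e \<oplus> q b \<otimes> q f) \<oplus> (q c \<otimes> q f \<oplus> q d \<otimes> q e) \<oplus> (h \<otimes> q e \<oplus> h \<otimes> q f)
      = (q a \<oplus> q d \<oplus> h) \<otimes> q e \<oplus> (q c \<oplus> q b \<oplus> h) \<otimes> q f"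
    using S by (simp add: a_ac l_distr)
  also have "\<dots> = (q c \<oplus> q b \<oplus> h) \<otimes> q e \<oplus> (q a \<oplus> q d \<oplus> h) \<otimes> q f"
    unfolding h ..
  also have "\<dots> = (q c \<otimes> q e \<oplus> q d \<otimes> q f) \<oplus> (q a \<otimes> q f \<oplus> q b \<otimes> q e) \<oplus> (h \<otimes> q e \<oplus> h \<otimes> q f)"
    using S by (simp add: a_ac l_distr)
  finally show "rel `` {vtimes y x} = rel `` {vtimes z x}"
    unfolding vtimes_def using S
    by (intro class_eq_stableI [of "h \<otimes> q e \<oplus> h \<otimes> q f"]) simp_all
qed

lemma class_add:
  "x \<in> S \<times> S \<Longrightarrow> y \<in> S \<times> S \<Longrightarrow>
    rel `` {x} \<oplus>\<^bsub>grothendieck_ring\<^esub> rel `` {y} = rel `` {vplus x y}"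
  unfolding grothendieck_ring_def
  by (simp only: ring.simps monoid.simps)
    (rule UN_equiv_class2 [OF rel_equiv rel_equiv vplus_congruent])

lemma class_mult:
  "x \<in> S \<times> S \<Longrightarrow> y \<in> S \<times> S \<Longrightarrow>
    rel `` {x} \<otimes>\<^bsub>grothendieck_ring\<^esub> rel `` {y} = rel `` {vtimes x y}"
  unfolding grothendieck_ring_def
  by (simp only: ring.simps monoid.simps)
    (rule UN_equiv_class2 [OF rel_equiv rel_equiv vtimes_congruent])

lemma class_closed: "x \<in> S \<times> S \<Longrightarrow> rel `` {x} \<in> carrier grothendieck_ring"
  by (simp add: grothendieck_ring_def quotientI)

lemma class_cases:
  assumes "X \<in> carrier grothendieck_ring"
  obtains a b where "a \<in> S" "b \<in> S" "X = rel `` {(a, b)}"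
  using assms by (auto simp: grothendieck_ring_def elim!: quotientE)

lemma class_one: "\<one>\<^bsub>grothendieck_ring\<^esub> = rel `` {(uni, zer)}"
  and class_zero: "\<zero>\<^bsub>grothendieck_ring\<^esub> = rel `` {(zer, zer)}"
  by (simp_all add: grothendieck_ring_def)

text \<open>On classes each equational axiom becomes, by \<open>class_eqI\<close>, an identity in
  the semiring \<open>R\<close>, proved by distributing and sorting. Negation swaps the members of a
  pair.\<close>

lemma grothendieck_ring_is_ring: "ring grothendieck_ring"
proof (rule ringI)
  note simps = class_add class_mult class_closed class_one class_zero vplus_def vtimes_def
    a_ac l_distr r_distr m_assoc l_null r_null
  let ?G = grothendieck_ring
  show "abelian_group ?G"
  proof (rule abelian_groupI)
    show "X \<oplus>\<^bsub>?G\<^esub> Y \<in> carrier ?G" if "X \<in> carrier ?G" "Y \<in> carrier ?G" for X Y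
      using that by (auto elim!: class_cases simp: simps)
    show "\<zero>\<^bsub>?G\<^esub> \<in> carrier ?G" by (simp add: simps)
    show "(X \<oplus>\<^bsub>?G\<^esub> Y) \<oplus>\<^bsub>?G\<^esub> Z = X \<oplus>\<^bsub>?G\<^esub> (Y \<oplus>\<^bsub>?G\<^esub> Z)"
      if "X \<in> carrier ?G" "Y \<in> carrier ?G" "Z \<in> carrier ?G" for X Y Z
      using that by (elim class_cases) (simp add: simps, rule class_eqI, simp_all add: simps)
    show "X \<oplus>\<^bsub>?G\<^esub> Y = Y \<oplus>\<^bsub>?G\<^esub> X" if "X \<in> carrier ?G" "Y \<in> carrier ?G" for X Y
      using that by (elim class_cases) (simp add: simps, rule class_eqI, simp_all add: simps)
    show "\<zero>\<^bsub>?G\<^esub> \<oplus>\<^bsub>?G\<^esub> X = X" if "X \<in> carrier ?G" for X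
      using that by (elim class_cases) (simp add: simps, rule class_eqI, simp_all add: simps)
    show "\<exists>Y\<in>carrier ?G. Y \<oplus>\<^bsub>?G\<^esub> X = \<zero>\<^bsub>?G\<^esub>" if X: "X \<in> carrier ?G" for X
    proof -
      obtain a b where ab: "a \<in> S" "b \<in> S" "X = rel `` {(a, b)}"
        using X by (rule class_cases)
      then have "rel `` {(b, a)} \<oplus>\<^bsub>?G\<^esub> X = \<zero>\<^bsub>?G\<^esub>"
        by (simp add: simps, intro class_eqI, simp_all add: simps)
      with ab show ?thesis by (blast intro: class_closed)
    qed
  qed
  show "monoid ?G"
  proof (rule monoidI)
    show "X \<otimes>\<^bsub>?G\<^esub> Y \<in> carrier ?G" if "X \<in> carrier ?G" "Y \<in> carrier ?G" for X Y
      using that by (auto elim!: class_cases simp: simps)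
    show "\<one>\<^bsub>?G\<^esub> \<in> carrier ?G" by (simp add: simps)
    show "(X \<otimes>\<^bsub>?G\<^esub> Y) \<otimes>\<^bsub>?G\<^esub> Z = X \<otimes>\<^bsub>?G\<^esub> (Y \<otimes>\<^bsub>?G\<^esub> Z)"
      if "X \<in> carrier ?G" "Y \<in> carrier ?G" "Z \<in> carrier ?G" for X Y Z
      using that by (elim class_cases) (simp add: simps, rule class_eqI, simp_all add: simps)
    show "\<one>\<^bsub>?G\<^esub> \<otimes>\<^bsub>?G\<^esub> X = X" if "X \<in> carrier ?G" for X
      using that by (elim class_cases) (simp add: simps, rule class_eqI, simp_all add: simps)
    show "X \<otimes>\<^bsub>?G\<^esub> \<one>\<^bsub>?G\<^esub> = X" if "X \<in> carrier ?G" for X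
      using that by (elim class_cases) (simp add: simps, rule class_eqI, simp_all add: simps)
  qed
  show "(X \<oplus>\<^bsub>?G\<^esub> Y) \<otimes>\<^bsub>?G\<^esub> Z = X \<otimes>\<^bsub>?G\<^esub> Z \<oplus>\<^bsub>?G\<^esub> Y \<otimes>\<^bsub>?G\<^esub> Z"
    if "X \<in> carrier ?G" "Y \<in> carrier ?G" "Z \<in> carrier ?G" for X Y Z
    using that by (elim class_cases) (simp add: simps, rule class_eqI, simp_all add: simps)
  show "Z \<otimes>\<^bsub>?G\<^esub> (X \<oplus>\<^bsub>?G\<^esub> Y) = Z \<otimes>\<^bsub>?G\<^esub> X \<oplus>\<^bsub>?G\<^esub> Z \<otimes>\<^bsub>?G\<^esub> Y"
    if "X \<in> carrier ?G" "Y \<in> carrier ?G" "Z \<in> carrier ?G" for X Y Z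
    using that by (elim class_cases) (simp add: simps, rule class_eqI, simp_all add: simps)
qed

end

text \<open>For bundles \<open>r\<close> is isomorphism, and each law below amounts to one coherence
  isomorphism.\<close>

locale congruence_semiring =
  fixes S :: "'s set" and r :: "'s rel"
    and plus times :: "'s \<Rightarrow> 's \<Rightarrow> 's" and zer uni :: 's
  assumes equiv: "equiv S r"
    and plus_cong: "(x, x') \<in> r \<Longrightarrow> (y, y') \<in> r \<Longrightarrow> (plus x y, plus x' y') \<in> r"
    and times_cong: "(x, x') \<in> r \<Longrightarrow> (y, y') \<in> r \<Longrightarrow> (times x y, times x' y') \<in> r"
    and zer_mem: "zer \<in> S" and uni_mem: "uni \<in> S"
    and plus_assoc: "x \<in> S \<Longrightarrow> y \<in> S \<Longrightarrow> z \<in> S \<Longrightarrow> (plus (plus x y) z, plus x (plus y z)) \<in> r"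
    and plus_comm: "x \<in> S \<Longrightarrow> y \<in> S \<Longrightarrow> (plus x y, plus y x) \<in> r"
    and zer_plus: "x \<in> S \<Longrightarrow> (plus zer x, x) \<in> r"
    and times_assoc: "x \<in> S \<Longrightarrow> y \<in> S \<Longrightarrow> z \<in> S \<Longrightarrow> (times (times x y) z, times x (times y z)) \<in> r"
    and uni_times: "x \<in> S \<Longrightarrow> (times uni x, x) \<in> r"
    and times_uni: "x \<in> S \<Longrightarrow> (times x uni, x) \<in> r"
    and times_plus_left: "x \<in> S \<Longrightarrow> y \<in> S \<Longrightarrow> z \<in> S \<Longrightarrow>
      (times (plus x y) z, plus (times x z) (times y z)) \<in> r"
    and times_plus_right: "x \<in> S \<Longrightarrow> y \<in> S \<Longrightarrow> z \<in> S \<Longrightarrow>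
      (times z (plus x y), plus (times z x) (times z y)) \<in> r"
    and zer_times: "x \<in> S \<Longrightarrow> (times zer x, zer) \<in> r"
    and times_zer: "x \<in> S \<Longrightarrow> (times x zer, zer) \<in> r"
begin

definition quotient_semiring :: "'s set ring" where
  "quotient_semiring = \<lparr>
     carrier = S // r,
     mult = (\<lambda>X Y. \<Union>x\<in>X. \<Union>y\<in>Y. r `` {times x y}),
     one = r `` {uni},
     zero = r `` {zer},
     add = (\<lambda>X Y. \<Union>x\<in>X. \<Union>y\<in>Y. r `` {plus x y})\<rparr>"

lemma r_refl: "x \<in> S \<Longrightarrow> (x, x) \<in> r"
  using equiv by (auto simp: equiv_def refl_on_def)

lemma r_mem: "(x, y) \<in> r \<Longrightarrow> x \<in> S \<and> y \<in> S"
  using equiv by (auto simp: equiv_def)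

text \<open>\<open>r\<close> relates only elements of \<open>S\<close>, so congruence applied to two
  reflexive pairs already yields closure.\<close>

lemma plus_mem: "x \<in> S \<Longrightarrow> y \<in> S \<Longrightarrow> plus x y \<in> S"
  using plus_cong [OF r_refl r_refl] r_mem by blast

lemma times_mem: "x \<in> S \<Longrightarrow> y \<in> S \<Longrightarrow> times x y \<in> S"
  using times_cong [OF r_refl r_refl] r_mem by blast

lemma r_class_eq: "(x, y) \<in> r \<Longrightarrow> r `` {x} = r `` {y}"
  by (rule equiv_class_eq [OF equiv])

lemma quotient_add:
  assumes "x \<in> S" "y \<in> S"
  shows "r `` {x} \<oplus>\<^bsub>quotient_semiring\<^esub> r `` {y} = r `` {plus x y}"
proof -
  have "congruent2 r r (\<lambda>x y. r `` {plus x y})"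
    by (intro congruent2I' r_class_eq plus_cong)
  from UN_equiv_class2 [OF equiv equiv this assms] show ?thesis
    by (simp add: quotient_semiring_def)
qed

lemma quotient_mult:
  assumes "x \<in> S" "y \<in> S"
  shows "r `` {x} \<otimes>\<^bsub>quotient_semiring\<^esub> r `` {y} = r `` {times x y}"
proof -
  have "congruent2 r r (\<lambda>x y. r `` {times x y})"
    by (intro congruent2I' r_class_eq times_cong)
  from UN_equiv_class2 [OF equiv equiv this assms] show ?thesis
    by (simp add: quotient_semiring_def)
qed

lemma quotient_cases:
  assumes "X \<in> carrier quotient_semiring"
  obtains x where "x \<in> S" "X = r `` {x}"
  using assms by (auto simp: quotient_semiring_def elim!: quotientE)

lemma quotient_closed: "x \<in> S \<Longrightarrow> r `` {x} \<in> carrier quotient_semiring"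
  by (simp add: quotient_semiring_def quotientI)

lemma quotient_semiring: "semiring quotient_semiring"
proof -
  let ?Q = quotient_semiring
  have zero: "\<zero>\<^bsub>?Q\<^esub> = r `` {zer}" and one: "\<one>\<^bsub>?Q\<^esub> = r `` {uni}"
    by (simp_all add: quotient_semiring_def)
  note simps = quotient_add quotient_mult quotient_closed zero one plus_mem times_mem zer_mem uni_mem
  interpret abelian_monoid ?Q
  proof (rule abelian_monoidI)
    show "X \<oplus>\<^bsub>?Q\<^esub> Y \<in> carrier ?Q" if "X \<in> carrier ?Q" "Y \<in> carrier ?Q" for X Y
      using that by (elim quotient_cases) (simp add: simps)
    show "\<zero>\<^bsub>?Q\<^esub> \<in> carrier ?Q" by (simp add: simps)
    show "(X \<oplus>\<^bsub>?Q\<^esub> Y) \<oplus>\<^bsub>?Q\<^esub> Z = X \<oplus>\<^bsub>?Q\<^esub> (Y \<oplus>\<^bsub>?Q\<^esub> Z)"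
      if "X \<in> carrier ?Q" "Y \<in> carrier ?Q" "Z \<in> carrier ?Q" for X Y Z
      using that by (elim quotient_cases) (simp add: simps, intro r_class_eq plus_assoc)
    show "\<zero>\<^bsub>?Q\<^esub> \<oplus>\<^bsub>?Q\<^esub> X = X" if "X \<in> carrier ?Q" for X
      using that by (elim quotient_cases) (simp add: simps, intro r_class_eq zer_plus)
    show "X \<oplus>\<^bsub>?Q\<^esub> Y = Y \<oplus>\<^bsub>?Q\<^esub> X" if "X \<in> carrier ?Q" "Y \<in> carrier ?Q" for X Y
      using that by (elim quotient_cases) (simp add: simps, intro r_class_eq plus_comm)
  qed
  interpret monoid ?Q
  proof (rule monoidI)
    show "X \<otimes>\<^bsub>?Q\<^esub> Y \<in> carrier ?Q" if "X \<in> carrier ?Q" "Y \<in> carrier ?Q" for X Y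
      using that by (elim quotient_cases) (simp add: simps)
    show "\<one>\<^bsub>?Q\<^esub> \<in> carrier ?Q" by (simp add: simps)
    show "(X \<otimes>\<^bsub>?Q\<^esub> Y) \<otimes>\<^bsub>?Q\<^esub> Z = X \<otimes>\<^bsub>?Q\<^esub> (Y \<otimes>\<^bsub>?Q\<^esub> Z)"
      if "X \<in> carrier ?Q" "Y \<in> carrier ?Q" "Z \<in> carrier ?Q" for X Y Z
      using that by (elim quotient_cases) (simp add: simps, intro r_class_eq times_assoc)
    show "\<one>\<^bsub>?Q\<^esub> \<otimes>\<^bsub>?Q\<^esub> X = X" if "X \<in> carrier ?Q" for X
      using that by (elim quotient_cases) (simp add: simps, intro r_class_eq uni_times)
    show "X \<otimes>\<^bsub>?Q\<^esub> \<one>\<^bsub>?Q\<^esub> = X" if "X \<in> carrier ?Q" for X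
      using that by (elim quotient_cases) (simp add: simps, intro r_class_eq times_uni)
  qed
  show ?thesis
  proof
    show "(X \<oplus>\<^bsub>?Q\<^esub> Y) \<otimes>\<^bsub>?Q\<^esub> Z = X \<otimes>\<^bsub>?Q\<^esub> Z \<oplus>\<^bsub>?Q\<^esub> Y \<otimes>\<^bsub>?Q\<^esub> Z"
      if "X \<in> carrier ?Q" "Y \<in> carrier ?Q" "Z \<in> carrier ?Q" for X Y Z
      using that by (elim quotient_cases) (simp add: simps, intro r_class_eq times_plus_left)
    show "Z \<otimes>\<^bsub>?Q\<^esub> (X \<oplus>\<^bsub>?Q\<^esub> Y) = Z \<otimes>\<^bsub>?Q\<^esub> X \<oplus>\<^bsub>?Q\<^esub> Z \<otimes>\<^bsub>?Q\<^esub> Y"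
      if "X \<in> carrier ?Q" "Y \<in> carrier ?Q" "Z \<in> carrier ?Q" for X Y Z
      using that by (elim quotient_cases) (simp add: simps, intro r_class_eq times_plus_right)
    show "\<zero>\<^bsub>?Q\<^esub> \<otimes>\<^bsub>?Q\<^esub> X = \<zero>\<^bsub>?Q\<^esub>" if "X \<in> carrier ?Q" for X
      using that by (elim quotient_cases) (simp add: simps, intro r_class_eq zer_times)
    show "X \<otimes>\<^bsub>?Q\<^esub> \<zero>\<^bsub>?Q\<^esub> = \<zero>\<^bsub>?Q\<^esub>" if "X \<in> carrier ?Q" for X
      using that by (elim quotient_cases) (simp add: simps, intro r_class_eq times_zer)
  qed
qed

lemma quotient_presentation:
  "semiring_presentation quotient_semiring S (\<lambda>x. r `` {x}) plus times zer uni"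
proof -
  have "(\<lambda>x. r `` {x}) ` S = carrier quotient_semiring"
    by (auto simp: quotient_semiring_def quotient_def)
  then show ?thesis
    by (intro semiring_presentation.intro quotient_semiring semiring_presentation_axioms.intro)
      (simp_all add: plus_mem times_mem zer_mem uni_mem quotient_add quotient_mult,
       simp_all add: quotient_semiring_def)
qed

end

text \<open>\<open>T\<close> acts on representatives like a functor. The laws about it are stated
  after applying \<open>q'\<close>, because such a map preserves the operations only up to
  isomorphism.\<close>

locale presentation_morphism =
  A: semiring_presentation R S q plus times zer uni +
  B: semiring_presentation R' S' q' plus' times' zer' uni'
  for R :: "('r, 'c) ring_scheme" and S :: "'s set" and q plus times zer uni
    and R' :: "('u, 'd) ring_scheme" and S' :: "'t set" and q' plus' times' zer' uni' +
  fixes T :: "'s \<Rightarrow> 't"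
  assumes T_closed: "x \<in> S \<Longrightarrow> T x \<in> S'"
    and T_cong: "x \<in> S \<Longrightarrow> y \<in> S \<Longrightarrow> q x = q y \<Longrightarrow> q' (T x) = q' (T y)"
    and T_plus: "x \<in> S \<Longrightarrow> y \<in> S \<Longrightarrow> q' (T (plus x y)) = q' (T x) \<oplus>\<^bsub>R'\<^esub> q' (T y)"
    and T_times: "x \<in> S \<Longrightarrow> y \<in> S \<Longrightarrow> q' (T (times x y)) = q' (T x) \<otimes>\<^bsub>R'\<^esub> q' (T y)"
    and T_zer: "q' (T zer) = \<zero>\<^bsub>R'\<^esub>" and T_uni: "q' (T uni) = \<one>\<^bsub>R'\<^esub>"
begin

definition induced :: "('s \<times> 's) set \<Rightarrow> ('t \<times> 't) set" where
  "induced X = (\<Union>x\<in>X. B.rel `` {map_prod T T x})"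

text \<open>\<open>T_cong\<close> is applied to the stabilised equation as a whole, and
  \<open>T_plus\<close> splits it afterwards; the image of the old stabilising summand is the new
  one.\<close>

lemma T_rel:
  assumes "((a, b), (c, d)) \<in> A.rel"
  shows "((T a, T b), (T c, T d)) \<in> B.rel"
proof -
  obtain h where S: "a \<in> S" "b \<in> S" "c \<in> S" "d \<in> S" "h \<in> S"
    and h: "q (plus (plus a d) h) = q (plus (plus c b) h)"
    using assms by (auto simp: A.rel_def)
  have "q' (T (plus (plus a d) h)) = q' (T (plus (plus c b) h))"
    using S h by (intro T_cong A.plus_closed)
  with S show ?thesis
    unfolding B.rel_iff
    by (auto simp: T_plus T_closed simp del: A.q_plus intro!: bexI [of _ "q' (T h)"])
qed

lemma induced_class:
  assumes "x \<in> S \<times> S"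
  shows "induced (A.rel `` {x}) = B.rel `` {map_prod T T x}"
  unfolding induced_def
proof (rule UN_equiv_class [OF A.rel_equiv _ assms])
  show "(\<lambda>x. B.rel `` {map_prod T T x}) respects A.rel"
    by (rule congruentI, rule equiv_class_eq [OF B.rel_equiv]) (auto simp: T_rel)
qed

lemma induced_hom: "induced \<in> ring_hom A.grothendieck_ring B.grothendieck_ring"
proof (rule ring_hom_memI)
  let ?A = A.grothendieck_ring and ?B = B.grothendieck_ring
  note simps = induced_class A.class_add A.class_mult A.class_one B.class_add B.class_mult
    B.class_one A.vplus_def B.vplus_def A.vtimes_def B.vtimes_def T_closed T_plus T_times T_uni T_zer
    B.class_closed
  show "induced X \<in> carrier ?B" if "X \<in> carrier ?A" for X
    using that by (auto elim!: A.class_cases simp: simps)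
  show "induced (X \<otimes>\<^bsub>?A\<^esub> Y) = induced X \<otimes>\<^bsub>?B\<^esub> induced Y"
    if "X \<in> carrier ?A" "Y \<in> carrier ?A" for X Y
    using that by (elim A.class_cases) (simp add: simps B.a_ac, rule B.class_eqI, simp_all add: simps B.a_ac)
  show "induced (X \<oplus>\<^bsub>?A\<^esub> Y) = induced X \<oplus>\<^bsub>?B\<^esub> induced Y"
    if "X \<in> carrier ?A" "Y \<in> carrier ?A" for X Y
    using that by (elim A.class_cases) (simp add: simps B.a_ac, rule B.class_eqI, simp_all add: simps B.a_ac)
  show "induced \<one>\<^bsub>?A\<^esub> = \<one>\<^bsub>?B\<^esub>"
    by (simp add: simps, rule B.class_eqI, simp_all add: simps)
qed

end

text \<open>The maps are inverse only after \<open>q\<close> and \<open>q'\<close>, that is, up to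
  isomorphism of representatives; the induced maps on classes of pairs are then inverse on the
  nose.\<close>

lemma presentation_inverse_imp_ring_iso:
  fixes plus times :: "'s \<Rightarrow> 's \<Rightarrow> 's" and plus' times' :: "'t \<Rightarrow> 't \<Rightarrow> 't"
  assumes "presentation_morphism R S q plus times zer uni R' S' q' plus' times' zer' uni' T"
    and "presentation_morphism R' S' q' plus' times' zer' uni' R S q plus times zer uni T'"
    and inv: "\<And>x. x \<in> S \<Longrightarrow> q (T' (T x)) = q x" "\<And>y. y \<in> S' \<Longrightarrow> q' (T (T' y)) = q' y"
  shows "semiring_presentation.grothendieck_ring S q plus times zer uni \<simeq>
    semiring_presentation.grothendieck_ring S' q' plus' times' zer' uni'"
proof -
  interpret T: presentation_morphism R S q plus times zer uni R' S' q' plus' times' zer' uni' T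
    by fact
  interpret T': presentation_morphism R' S' q' plus' times' zer' uni' R S q plus times zer uni T'
    by fact
  have "bij_betw T.induced (carrier T.A.grothendieck_ring) (carrier T.B.grothendieck_ring)"
  proof (rule bij_betw_byWitness [where f' = T'.induced])
    note simps = T.induced_class T'.induced_class T.T_closed T'.T_closed inv
    show "\<forall>X\<in>carrier T.A.grothendieck_ring. T'.induced (T.induced X) = X"
      by (intro ballI, elim T.A.class_cases)
        (simp add: simps, rule T.A.class_eqI, simp_all add: simps)
    show "\<forall>X\<in>carrier T.B.grothendieck_ring. T.induced (T'.induced X) = X"
      by (intro ballI, elim T.B.class_cases)
        (simp add: simps, rule T.B.class_eqI, simp_all add: simps)
    show "T.induced ` carrier T.A.grothendieck_ring \<subseteq> carrier T.B.grothendieck_ring"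
      using ring_hom_closed [OF T.induced_hom] by blast
    show "T'.induced ` carrier T.B.grothendieck_ring \<subseteq> carrier T.A.grothendieck_ring"
      using ring_hom_closed [OF T'.induced_hom] by blast
  qed
  then show ?thesis
    using T.induced_hom unfolding is_ring_iso_def ring_iso_def by blast
qed

section \<open>Cochains and the cohomology group\<close>

lemma cochain_norm: "F \<in> cochains G K p q \<Longrightarrow> norm (F gs ks) = 1"
  by (simp add: cochains_def)

lemma cochain_nonzero: "F \<in> cochains G K p q \<Longrightarrow> F gs ks \<noteq> 0"
  using cochain_norm [of F G K p q gs ks] by auto

lemma cochain_outside:
  "F \<in> cochains G K p q \<Longrightarrow>
    \<not> (gs \<in> lists (carrier G) \<and> length gs = p \<and> ks \<in> lists (carrier K) \<and> length ks = q) \<Longrightarrow>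
    F gs ks = 1"
  unfolding cochains_def by blast

lemma cochain_normalised:
  "F \<in> cochains G K p q \<Longrightarrow> \<one>\<^bsub>G\<^esub> \<in> set gs \<or> \<one>\<^bsub>K\<^esub> \<in> set ks \<Longrightarrow> F gs ks = 1"
  unfolding cochains_def by blast

lemma trivial_cochain_mem [simp]: "trivial_cochain \<in> cochains G K p q"
  by (simp add: cochains_def trivial_cochain_def)

lemma cochain_mult:
  "F \<in> cochains G K p q \<Longrightarrow> F' \<in> cochains G K p q \<Longrightarrow> (\<lambda>gs ks. F gs ks * F' gs ks) \<in> cochains G K p q"
  by (simp add: cochains_def norm_mult)

lemma cochain_inverse:
  "F \<in> cochains G K p q \<Longrightarrow> (\<lambda>gs ks. inverse (F gs ks)) \<in> cochains G K p q"
  by (simp add: cochains_def norm_inverse)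

lemma delta_G_mult:
  "delta_G G K act (\<lambda>gs ks. F gs ks * F' gs ks) =
    (\<lambda>gs ks. delta_G G K act F gs ks * delta_G G K act F' gs ks)"
  by (intro ext) (simp add: delta_G_def power_int_mult_distrib prod.distrib)

lemma delta_K_mult:
  "delta_K G K (\<lambda>gs ks. F gs ks * F' gs ks) =
    (\<lambda>gs ks. delta_K G K F gs ks * delta_K G K F' gs ks)"
  by (intro ext) (simp add: delta_K_def power_int_mult_distrib prod.distrib)

lemma delta_G_trivial [simp]: "delta_G G K act trivial_cochain = trivial_cochain"
  by (intro ext) (simp add: delta_G_def trivial_cochain_def)

lemma delta_K_trivial [simp]: "delta_K G K trivial_cochain = trivial_cochain"
  by (intro ext) (simp add: delta_K_def trivial_cochain_def)

lemma norm_delta_G: "(\<And>gs ks. norm (F gs ks) = 1) \<Longrightarrow> norm (delta_G G K act F gs ks) = 1"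
  by (simp add: delta_G_def norm_mult norm_power_int flip: prod_norm)

lemma norm_delta_K: "(\<And>gs ks. norm (F gs ks) = 1) \<Longrightarrow> norm (delta_K G K F gs ks) = 1"
  by (simp add: delta_K_def norm_mult norm_power_int flip: prod_norm)

lemma length_merge: "1 \<le> i \<Longrightarrow> i < length xs \<Longrightarrow> length (merge M i xs) = length xs - 1"
  by (simp add: merge_def)

text \<open>Every factor takes \<open>F\<close> at exactly one group element fewer, so a wrong
  bidegree is wrong in all factors at once and each of them defaults to 1.\<close>

lemma delta_G_outside:
  assumes F: "F \<in> cochains G K p q"
    and "\<not> (gs \<in> lists (carrier G) \<and> length gs = Suc p \<and> ks \<in> lists (carrier K) \<and> length ks = q)"
  shows "delta_G G K act F gs ks = 1"
proof (cases "gs \<noteq> [] \<and> gs \<in> lists (carrier G) \<and> ks \<in> lists (carrier K)")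
  case True
  \<comment> \<open>Truncated subtraction is harmless here because \<open>gs\<close> is
    nonempty.\<close>
  then have len: "length gs - 1 \<noteq> p \<or> length ks \<noteq> q"
    using assms(2) by (cases gs) auto
  have "F (tl gs) ks = 1" "F (butlast gs) (map (act (last gs)) ks) = 1"
    using len by (auto intro!: cochain_outside [OF F])
  moreover have "(\<Prod>i = 1..<length gs. F (merge G i gs) ks powi ((- 1) ^ i)) = 1"
    using len by (intro prod.neutral ballI)
      (subst cochain_outside [OF F], auto simp: length_merge)
  ultimately show ?thesis by (simp add: delta_G_def)
qed (auto simp: delta_G_def)

lemma delta_K_outside:
  assumes F: "F \<in> cochains G K p q"
    and "\<not> (gs \<in> lists (carrier G) \<and> length gs = p \<and> ks \<in> lists (carrier K) \<and> length ks = Suc q)"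
  shows "delta_K G K F gs ks = 1"
proof (cases "ks \<noteq> [] \<and> gs \<in> lists (carrier G) \<and> ks \<in> lists (carrier K)")
  case True
  then have len: "length gs \<noteq> p \<or> length ks - 1 \<noteq> q"
    using assms(2) by (cases ks) auto
  have "F gs (tl ks) = 1" "F gs (butlast ks) = 1"
    using len by (auto intro!: cochain_outside [OF F])
  moreover have "(\<Prod>j = 1..<length ks. F gs (merge K j ks) powi ((- 1) ^ j)) = 1"
    using len by (intro prod.neutral ballI)
      (subst cochain_outside [OF F], auto simp: length_merge)
  ultimately show ?thesis by (simp add: delta_K_def)
qed (auto simp: delta_K_def)

section \<open>Explicit formulas for the differentials in low degree\<close>

lemma delta_G_1:
  "g \<in> carrier G \<Longrightarrow> ks \<in> lists (carrier K) \<Longrightarrow>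
    delta_G G K act F [g] ks = F [] ks / F [] (map (act g) ks)"
  by (simp add: delta_G_def field_simps)

lemma delta_G_2:
  "g \<in> carrier G \<Longrightarrow> h \<in> carrier G \<Longrightarrow> ks \<in> lists (carrier K) \<Longrightarrow>
    delta_G G K act F [g, h] ks = F [h] ks * F [g] (map (act h) ks) / F [g \<otimes>\<^bsub>G\<^esub> h] ks"
  by (simp add: delta_G_def merge_def field_simps)

lemma delta_G_3:
  assumes "g \<in> carrier G" "h \<in> carrier G" "k \<in> carrier G" "ks \<in> lists (carrier K)"
  shows "delta_G G K act F [g, h, k] ks =
    F [h, k] ks * F [g, h \<otimes>\<^bsub>G\<^esub> k] ks / (F [g \<otimes>\<^bsub>G\<^esub> h, k] ks * F [g, h] (map (act k) ks))"
proof -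
  have "{1..<Suc (Suc (Suc 0))} = {1, 2}" by auto
  with assms show ?thesis by (simp add: delta_G_def merge_def field_simps numeral_2_eq_2)
qed

lemma delta_K_2:
  "gs \<in> lists (carrier G) \<Longrightarrow> x \<in> carrier K \<Longrightarrow> y \<in> carrier K \<Longrightarrow>
    delta_K G K F gs [x, y] = F gs [y] * F gs [x] / F gs [x \<otimes>\<^bsub>K\<^esub> y]"
  by (simp add: delta_K_def merge_def field_simps)

lemma delta_K_3:
  assumes "gs \<in> lists (carrier G)" "x \<in> carrier K" "y \<in> carrier K" "z \<in> carrier K"
  shows "delta_K G K F gs [x, y, z] =
    F gs [y, z] * F gs [x, y \<otimes>\<^bsub>K\<^esub> z] / (F gs [x \<otimes>\<^bsub>K\<^esub> y, z] * F gs [x, y])"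
proof -
  have "{1..<Suc (Suc (Suc 0))} = {1, 2}" by auto
  with assms show ?thesis by (simp add: delta_K_def merge_def field_simps numeral_2_eq_2)
qed

section \<open>The total complex as a complex of abelian groups\<close>

lemma tot_group_comm_group: "comm_group (tot_group G K r n)"
proof (rule comm_groupI)
  show "\<exists>d\<in>carrier (tot_group G K r n). d \<otimes>\<^bsub>tot_group G K r n\<^esub> c = \<one>\<^bsub>tot_group G K r n\<^esub>"
    if c: "c \<in> carrier (tot_group G K r n)" for c
  proof (intro bexI)
    have "c q gs ks \<noteq> 0" for q gs ks
      using c by (auto simp: tot_group_def trivial_cochain_def split: if_splits
          dest!: spec [of _ q] dest: cochain_nonzero)
    then show "(\<lambda>q gs ks. inverse (c q gs ks)) \<otimes>\<^bsub>tot_group G K r n\<^esub> c = \<one>\<^bsub>tot_group G K r n\<^esub>"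
      by (simp add: tot_group_def trivial_cochain_def)
    show "(\<lambda>q gs ks. inverse (c q gs ks)) \<in> carrier (tot_group G K r n)"
      using c by (auto simp: tot_group_def cochain_inverse) (auto simp: trivial_cochain_def)
  qed
qed (auto simp: tot_group_def cochain_mult mult_ac trivial_cochain_def
    trivial_cochain_mem [unfolded trivial_cochain_def])

text \<open>Multiplication in \<open>tot_group\<close> is pointwise and the same for all row bounds
  and degrees, so the parameters on the two sides are unrelated.\<close>

lemma tot_diff_mult:
  "tot_diff G K act r (c \<otimes>\<^bsub>tot_group G K s n\<^esub> d) =
    tot_diff G K act r c \<otimes>\<^bsub>tot_group G K t m\<^esub> tot_diff G K act r d"
  by (intro ext)
    (simp add: tot_diff_def tot_group_def delta_G_mult delta_K_mult trivial_cochain_def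
      power_int_mult_distrib)

lemma tot_diff_one: "tot_diff G K act r \<one>\<^bsub>tot_group G K s n\<^esub> = \<one>\<^bsub>tot_group G K t m\<^esub>"
  by (intro ext, simp add: tot_diff_def tot_group_def, simp add: trivial_cochain_def)

context equivariant_monoid
begin

lemma act_closed [simp]: "g \<in> carrier G \<Longrightarrow> x \<in> carrier K \<Longrightarrow> act g x \<in> carrier K"
  by (rule element_image) auto

lemma act_mult [simp]:
  "g \<in> carrier G \<Longrightarrow> x \<in> carrier K \<Longrightarrow> y \<in> carrier K \<Longrightarrow>
    act g (x \<otimes>\<^bsub>K\<^esub> y) = act g x \<otimes>\<^bsub>K\<^esub> act g y"
  by (rule hom_mult [OF act_hom])

lemma act_comp [simp]:
  "g \<in> carrier G \<Longrightarrow> h \<in> carrier G \<Longrightarrow> x \<in> carrier K \<Longrightarrow> act (g \<otimes> h) x = act g (act h x)"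
  by (rule composition_rule)

lemma act_id [simp]: "x \<in> carrier K \<Longrightarrow> act \<one> x = x"
  using id_eq_one by (metis restrict_apply')

declare act_one [simp]

text \<open>Norm and support are covered by general facts; normalisation comes from the explicit
  formula. The identity of \<open>G\<close> makes numerator and denominator equal, and a unit entry
  stays a unit because \<open>act\<close> fixes it.\<close>

lemma delta_G_0_2_mem:
  assumes F: "F \<in> cochains G K 0 2"
  shows "delta_G G K act F \<in> cochains G K 1 2"
proof -
  have "delta_G G K act F gs ks = 1"
    if "\<one> \<in> set gs \<or> \<one>\<^bsub>K\<^esub> \<in> set ks" for gs ks
  proof (cases "gs \<in> lists (carrier G) \<and> length gs = Suc 0 \<and> ks \<in> lists (carrier K) \<and> length ks = 2")
    case True
    then obtain g x y where "gs = [g]" "ks = [x, y]" "g \<in> carrier G" "x \<in> carrier K" "y \<in> carrier K"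
      by (auto simp: length_Suc_conv numeral_2_eq_2)
    with that show ?thesis
      by (auto simp: delta_G_1 cochain_nonzero [OF F] cochain_normalised [OF F])
  qed (rule delta_G_outside [OF F])
  then show ?thesis
    using delta_G_outside [OF F, of _ _ act] norm_delta_G [OF cochain_norm [OF F], of G K act]
    unfolding cochains_def by simp
qed

lemma delta_G_1_1_mem:
  assumes F: "F \<in> cochains G K 1 1"
  shows "delta_G G K act F \<in> cochains G K 2 1"
proof -
  have "delta_G G K act F gs ks = 1"
    if "\<one> \<in> set gs \<or> \<one>\<^bsub>K\<^esub> \<in> set ks" for gs ks
  proof (cases "gs \<in> lists (carrier G) \<and> length gs = Suc 1 \<and> ks \<in> lists (carrier K) \<and> length ks = 1")
    case True
    then obtain g h x where "gs = [g, h]" "ks = [x]" "g \<in> carrier G" "h \<in> carrier G" "x \<in> carrier K"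
      by (auto simp: length_Suc_conv)
    with that show ?thesis
      by (auto simp: delta_G_2 cochain_nonzero [OF F] cochain_normalised [OF F])
  qed (rule delta_G_outside [OF F])
  then show ?thesis
    using delta_G_outside [OF F, of _ _ act] norm_delta_G [OF cochain_norm [OF F], of G K act]
    unfolding cochains_def by (simp add: numeral_2_eq_2)
qed

lemma delta_K_1_1_mem:
  assumes F: "F \<in> cochains G K 1 1"
  shows "delta_K G K F \<in> cochains G K 1 2"
proof -
  have "delta_K G K F gs ks = 1"
    if "\<one> \<in> set gs \<or> \<one>\<^bsub>K\<^esub> \<in> set ks" for gs ks
  proof (cases "gs \<in> lists (carrier G) \<and> length gs = 1 \<and> ks \<in> lists (carrier K) \<and> length ks = Suc 1")
    case True
    then obtain g x y where "gs = [g]" "ks = [x, y]" "g \<in> carrier G" "x \<in> carrier K" "y \<in> carrier K"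
      by (auto simp: length_Suc_conv)
    with that show ?thesis
      by (auto simp: delta_K_2 cochain_nonzero [OF F] cochain_normalised [OF F])
  qed (rule delta_K_outside [OF F])
  then show ?thesis
    using delta_K_outside [OF F] norm_delta_K [OF cochain_norm [OF F], of G K]
    unfolding cochains_def by (simp add: numeral_2_eq_2)
qed

text \<open>Only bidegree (3,1) can be nontrivial. There the factors cancel in pairs once
  associativity in \<open>G\<close> identifies the iterated merges and \<open>act_comp\<close> the
  iterated actions.\<close>

lemma delta_G_delta_G:
  assumes F: "F \<in> cochains G K 1 1"
  shows "delta_G G K act (delta_G G K act F) = trivial_cochain"
proof (intro ext)
  fix gs ks
  show "delta_G G K act (delta_G G K act F) gs ks = trivial_cochain gs ks"
  proof (cases "gs \<in> lists (carrier G) \<and> length gs = Suc 2 \<and> ks \<in> lists (carrier K) \<and> length ks = 1")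
    case True
    then obtain g h k x where "gs = [g, h, k]" "ks = [x]"
      "g \<in> carrier G" "h \<in> carrier G" "k \<in> carrier G" "x \<in> carrier K"
      by (auto simp: length_Suc_conv numeral_2_eq_2)
    then show ?thesis
      by (simp add: delta_G_3 delta_G_2 cochain_nonzero [OF F] trivial_cochain_def m_assoc)
  next
    case False
    then show ?thesis
      unfolding trivial_cochain_def by (rule delta_G_outside [OF delta_G_1_1_mem [OF F]])
  qed
qed

section \<open>Cocycles and coboundaries of the two-row complex in degree 3\<close>

lemma tot_group_2_cases:
  assumes "c \<in> carrier (tot_group G K 2 2)"
  shows "c 1 \<in> cochains G K 1 1" "c 2 \<in> cochains G K 0 2" "c 0 = trivial_cochain"
proof -
  have *: "if 1 \<le> q \<and> q \<le> 2 \<and> q \<le> 2 then c q \<in> cochains G K (2 - q) q else c q = trivial_cochain" for q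
    using assms by (simp add: tot_group_def)
  show "c 1 \<in> cochains G K 1 1" "c 2 \<in> cochains G K 0 2" "c 0 = trivial_cochain"
    using * [of 1] * [of 2] * [of 0] by simp_all
qed

text \<open>In degree 2 the sign \<open>(-1)^p\<close> turns \<open>\<delta>_K\<close> of the row-1 component into its inverse.\<close>

lemma tot_diff_2:
  assumes "c \<in> carrier (tot_group G K 2 2)"
  shows "tot_diff G K act 2 c = tot_pair (delta_G G K act (c 1))
    (\<lambda>gs ks. delta_G G K act (c 2) gs ks / delta_K G K (c 1) gs ks)"
proof (intro ext)
  note c = tot_group_2_cases [OF assms]
  fix q :: nat and gs ks
  consider "q = 0" | "q = 1" | "q = 2" | "q > 2" by linarith
  then show "tot_diff G K act 2 c q gs ks = tot_pair (delta_G G K act (c 1))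
    (\<lambda>gs ks. delta_G G K act (c 2) gs ks / delta_K G K (c 1) gs ks) q gs ks"
  proof cases
    case 2
    then show ?thesis by (simp add: tot_diff_def tot_pair_def c) (simp add: trivial_cochain_def)
  next
    case 3
    have "delta_K G K (c 1) gs ks powi ((- 1) ^ length gs) = inverse (delta_K G K (c 1) gs ks)"
    proof (cases "length gs = 1")
      case False
      then have "delta_K G K (c 1) gs ks = 1" by (intro delta_K_outside [OF c(1)]) simp
      then show ?thesis by simp
    qed simp
    with 3 show ?thesis by (simp add: tot_diff_def tot_pair_def divide_inverse)
  qed (simp_all add: tot_diff_def tot_pair_def trivial_cochain_def)
qed

lemma tot_pair_mem:
  assumes "\<alpha> \<in> cochains G K 2 1" "\<beta> \<in> cochains G K 1 2"
  shows "tot_pair \<alpha> \<beta> \<in> carrier (tot_group G K 2 3)"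
proof -
  have "\<And>q. Suc 0 \<le> q \<Longrightarrow> q \<le> 2 \<Longrightarrow> q = 1 \<or> q = 2" by linarith
  then show ?thesis
    using assms by (force simp: tot_group_def tot_pair_def)
qed

text \<open>Row 3, which would contribute \<open>C^{0,3}\<close>, is cut off by the row bound 2, so
  a total 3-cochain has just two components.\<close>

lemma tot_group_3_cases:
  assumes "c \<in> carrier (tot_group G K 2 3)"
  obtains \<alpha> \<beta> where "\<alpha> \<in> cochains G K 2 1" "\<beta> \<in> cochains G K 1 2" "c = tot_pair \<alpha> \<beta>"
proof
  have *: "if 1 \<le> q \<and> q \<le> 2 \<and> q \<le> 3 then c q \<in> cochains G K (3 - q) q else c q = trivial_cochain" for q
    using assms by (simp add: tot_group_def)
  show "c 1 \<in> cochains G K 2 1" "c 2 \<in> cochains G K 1 2"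
    using * [of 1] * [of 2] by simp_all
  show "c = tot_pair (c 1) (c 2)"
  proof
    fix q :: nat
    consider "q = 0" | "q = 1" | "q = 2" | "q > 2" by linarith
    then show "c q = tot_pair (c 1) (c 2) q"
      using * [of q] by cases (auto simp: tot_pair_def)
  qed
qed

lemma tot_diff_tot_pair_eq_one_iff:
  assumes \<alpha>: "\<alpha> \<in> cochains G K 2 1" and \<beta>: "\<beta> \<in> cochains G K 1 2"
  shows "tot_diff G K act 2 (tot_pair \<alpha> \<beta>) = \<one>\<^bsub>tot_group G K 2 m\<^esub> \<longleftrightarrow>
    delta_G G K act \<alpha> = trivial_cochain \<and>
    (\<forall>gs ks. delta_G G K act \<beta> gs ks * delta_K G K \<alpha> gs ks = 1)"
proof -
  \<comment> \<open>Where this value can differ from 1 the sign is \<open>(-1)^2\<close>; elsewhere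
    the exponent is applied to 1.\<close>
  have sgn: "delta_K G K \<alpha> gs ks powi ((- 1) ^ length gs) = delta_K G K \<alpha> gs ks" for gs ks
  proof (cases "length gs = 2")
    case False
    then have "delta_K G K \<alpha> gs ks = 1" by (intro delta_K_outside [OF \<alpha>]) simp
    then show ?thesis by simp
  qed simp
  have row: "tot_diff G K act 2 (tot_pair \<alpha> \<beta>) q =
      (if q = 1 then delta_G G K act \<alpha>
       else if q = 2 then (\<lambda>gs ks. delta_G G K act \<beta> gs ks * delta_K G K \<alpha> gs ks)
       else trivial_cochain)" for q
  proof -
    consider "q = 0" | "q = 1" | "q = 2" | "q > 2" by linarith
    then show ?thesis
    proof cases
      case 2
      then show ?thesis by (simp add: tot_diff_def tot_pair_def) (simp add: trivial_cochain_def)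
    qed (simp_all add: tot_diff_def tot_pair_def sgn)
  qed
  show ?thesis
    unfolding fun_eq_iff [of "tot_diff G K act 2 (tot_pair \<alpha> \<beta>)"] row
    by (auto simp: tot_group_def trivial_cochain_def fun_eq_iff split: if_splits)
qed

lemma tot_pair_inject: "tot_pair \<alpha> \<beta> = tot_pair \<alpha>' \<beta>' \<Longrightarrow> \<alpha> = \<alpha>' \<and> \<beta> = \<beta>'"
  by (auto simp: tot_pair_def dest: fun_cong [of _ _ 1] fun_cong [of _ _ 2])

lemma tot_pair_cocycle_iff:
  "tot_pair \<alpha> \<beta> \<in> carrier (tot_cocycles G K act 2 3) \<longleftrightarrow>
    \<alpha> \<in> cochains G K 2 1 \<and> \<beta> \<in> cochains G K 1 2 \<and> delta_G G K act \<alpha> = trivial_cochain \<and>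
    (\<forall>gs ks. delta_G G K act \<beta> gs ks * delta_K G K \<alpha> gs ks = 1)"
proof -
  have "\<alpha> \<in> cochains G K 2 1 \<and> \<beta> \<in> cochains G K 1 2"
    if "tot_pair \<alpha> \<beta> \<in> carrier (tot_group G K 2 3)"
    using tot_group_3_cases [OF that] tot_pair_inject by metis
  then show ?thesis
    unfolding tot_cocycles_def kernel_def
    by (auto simp: tot_diff_tot_pair_eq_one_iff tot_pair_mem)
qed

lemma multiplicative_structures_iff:
  "(\<alpha>, \<beta>) \<in> multiplicative_structures G K act \<longleftrightarrow>
    tot_pair \<alpha> \<beta> \<in> carrier (tot_cocycles G K act 2 3) \<and> delta_K_class_trivial G K act \<beta>"
  by (auto simp: multiplicative_structures_def tot_pair_cocycle_iff)

text \<open>Row 1 is \<open>delta_G_delta_G\<close>. In row 2 the double \<open>delta_G\<close> of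
  \<open>c 2\<close> is 1, and since the two differentials commute, the inverted
  \<open>delta_K\<close> of \<open>c 1\<close> cancels against \<open>delta_K\<close> of the new row
  1.\<close>

lemma tot_diff_2_cocycle:
  assumes "c \<in> carrier (tot_group G K 2 2)"
  shows "tot_diff G K act 2 c \<in> carrier (tot_cocycles G K act 2 3)"
proof -
  note c = tot_group_2_cases [OF assms]
  let ?a = "c 1" and ?b = "c 2"
  let ?\<beta> = "\<lambda>gs ks. delta_G G K act ?b gs ks / delta_K G K ?a gs ks"
  have \<beta>: "?\<beta> \<in> cochains G K 1 2"
    unfolding divide_inverse
    by (intro cochain_mult cochain_inverse delta_G_0_2_mem delta_K_1_1_mem c)
  note nz = cochain_nonzero [OF c(1), simplified] cochain_nonzero [OF c(2)]
  have "delta_G G K act ?\<beta> gs ks * delta_K G K (delta_G G K act ?a) gs ks = 1" for gs ks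
  proof (cases "gs \<in> lists (carrier G) \<and> length gs = 2 \<and> ks \<in> lists (carrier K) \<and> length ks = 2")
    case True
    then obtain g h x y where "gs = [g, h]" "ks = [x, y]"
      "g \<in> carrier G" "h \<in> carrier G" "x \<in> carrier K" "y \<in> carrier K"
      by (auto simp: length_Suc_conv numeral_2_eq_2)
    then show ?thesis
      by (simp add: delta_G_1 delta_G_2 delta_K_2 nz)
  next
    case False
    then have "delta_G G K act ?\<beta> gs ks = 1" "delta_K G K (delta_G G K act ?a) gs ks = 1"
      by (intro delta_G_outside [OF \<beta>] delta_K_outside [OF delta_G_1_1_mem [OF c(1)]]; auto)+
    then show ?thesis by simp
  qed
  then show ?thesis
    unfolding tot_diff_2 [OF assms] tot_pair_cocycle_iff
    using \<beta> delta_G_1_1_mem [OF c(1)] delta_G_delta_G [OF c(1)] by blast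
qed

lemma tot_cocycles_subgroup:
  "subgroup (carrier (tot_cocycles G K act 2 3)) (tot_group G K 2 3)"
proof -
  interpret T: comm_group "tot_group G K 2 3" by (rule tot_group_comm_group)
  interpret U: comm_group "tot_group G K 2 4" by (rule tot_group_comm_group)
  let ?d = "tot_diff G K act 2"
  have d: "?d (x \<otimes>\<^bsub>tot_group G K 2 3\<^esub> y) = ?d x \<otimes>\<^bsub>tot_group G K 2 4\<^esub> ?d y" for x y
    by (rule tot_diff_mult)
  have d1: "?d \<one>\<^bsub>tot_group G K 2 3\<^esub> = \<one>\<^bsub>tot_group G K 2 4\<^esub>" by (rule tot_diff_one)
  \<comment> \<open>Stated for arbitrary \<open>z\<close>, since below it is applied to the
    differential of an inverse, whose membership in the degree-4 group has not been
    established.\<close>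
  have one_l: "\<one>\<^bsub>tot_group G K 2 4\<^esub> \<otimes>\<^bsub>tot_group G K 2 4\<^esub> z = z" for z
    by (simp add: tot_group_def trivial_cochain_def)
  show ?thesis
  proof (rule T.subgroupI)
    show "inv\<^bsub>tot_group G K 2 3\<^esub> c \<in> carrier (tot_cocycles G K act 2 3)"
      if "c \<in> carrier (tot_cocycles G K act 2 3)" for c
    proof -
      have c: "c \<in> carrier (tot_group G K 2 3)" "?d c = \<one>\<^bsub>tot_group G K 2 4\<^esub>"
        using that by (auto simp: tot_cocycles_def kernel_def)
      have "?d c \<otimes>\<^bsub>tot_group G K 2 4\<^esub> ?d (inv\<^bsub>tot_group G K 2 3\<^esub> c) = \<one>\<^bsub>tot_group G K 2 4\<^esub>"
        using c d [of c "inv\<^bsub>tot_group G K 2 3\<^esub> c"] d1 by simp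
      then show ?thesis
        using c one_l by (simp add: tot_cocycles_def kernel_def)
    qed
  qed (auto simp: tot_cocycles_def kernel_def d d1 intro: exI [of _ "\<one>\<^bsub>tot_group G K 2 3\<^esub>"])
qed

lemma tot_cocycles_comm_group: "comm_group (tot_cocycles G K act 2 3)"
proof -
  interpret T: comm_group "tot_group G K 2 3" by (rule tot_group_comm_group)
  have "tot_cocycles G K act 2 3 =
      (tot_group G K 2 3)\<lparr>carrier := carrier (tot_cocycles G K act 2 3)\<rparr>"
    by (simp add: tot_cocycles_def)
  then have "group (tot_cocycles G K act 2 3)"
    using T.subgroup_imp_group [OF tot_cocycles_subgroup] by simp
  then show ?thesis
    by (rule group.group_comm_groupI) (auto simp: tot_cocycles_def kernel_def T.m_comm)
qed

lemma tot_cocycles_mult: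
  "c \<otimes>\<^bsub>tot_cocycles G K act 2 3\<^esub> d = c \<otimes>\<^bsub>tot_group G K 2 3\<^esub> d"
  by (simp add: tot_cocycles_def)

lemma tot_coboundaries_subgroup:
  "subgroup (tot_coboundaries G K act 2 3) (tot_cocycles G K act 2 3)"
proof -
  interpret S: comm_group "tot_group G K 2 2" by (rule tot_group_comm_group)
  interpret Z: comm_group "tot_cocycles G K act 2 3" by (rule tot_cocycles_comm_group)
  have "tot_diff G K act 2 \<in> hom (tot_group G K 2 2) (tot_cocycles G K act 2 3)"
    by (rule homI) (auto simp: tot_diff_2_cocycle tot_cocycles_mult intro: tot_diff_mult)
  then have "group_hom (tot_group G K 2 2) (tot_cocycles G K act 2 3) (tot_diff G K act 2)"
    by (simp add: group_hom_def group_hom_axioms_def S.group_axioms Z.group_axioms)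
  then show ?thesis
    using group_hom.img_is_subgroup by (fastforce simp: tot_coboundaries_def)
qed

lemma tot_coboundaries_normal:
  "normal (tot_coboundaries G K act 2 3) (tot_cocycles G K act 2 3)"
  by (rule comm_group.subgroup_imp_normal [OF tot_cocycles_comm_group tot_coboundaries_subgroup])

lemma tot_cohomology_group: "group (tot_cohomology G K act 2 3)"
  unfolding tot_cohomology_def by (rule normal.factorgroup_is_group [OF tot_coboundaries_normal])

section \<open>The condition on \<open>delta_K\<close> and the subgroup \<open>MS\<close>\<close>

lemma delta_K_class_trivial_mult:
  assumes "delta_K_class_trivial G K act \<beta>" "delta_K_class_trivial G K act \<beta>'"
  shows "delta_K_class_trivial G K act (\<lambda>gs ks. \<beta> gs ks * \<beta>' gs ks)"
proof -
  obtain \<theta> \<theta>' where \<theta>: "\<theta> \<in> cochains G K 0 3" "delta_K G K \<beta> = delta_G G K act \<theta>"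
    "\<theta>' \<in> cochains G K 0 3" "delta_K G K \<beta>' = delta_G G K act \<theta>'"
    using assms by (auto simp: delta_K_class_trivial_def)
  show ?thesis
    unfolding delta_K_class_trivial_def
    by (rule bexI [OF _ cochain_mult [OF \<theta>(1,3)]]) (simp add: delta_G_mult delta_K_mult \<theta>)
qed

lemma delta_K_class_trivial_inverse:
  assumes "delta_K_class_trivial G K act \<beta>"
  shows "delta_K_class_trivial G K act (\<lambda>gs ks. inverse (\<beta> gs ks))"
proof -
  obtain \<theta> where \<theta>: "\<theta> \<in> cochains G K 0 3" "delta_K G K \<beta> = delta_G G K act \<theta>"
    using assms by (auto simp: delta_K_class_trivial_def)
  have "delta_K G K (\<lambda>gs ks. inverse (\<beta> gs ks)) = (\<lambda>gs ks. inverse (delta_K G K \<beta> gs ks))"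
    by (intro ext) (simp add: delta_K_def power_int_inverse inverse_mult_distrib prod_inversef [unfolded o_def])
  also have "\<dots> = delta_G G K act (\<lambda>gs ks. inverse (\<theta> gs ks))"
    unfolding \<theta>(2)
    by (intro ext) (simp add: delta_G_def power_int_inverse inverse_mult_distrib prod_inversef [unfolded o_def])
  finally show ?thesis
    unfolding delta_K_class_trivial_def using cochain_inverse [OF \<theta>(1)] by blast
qed

lemma inv_tot_pair:
  assumes \<alpha>\<beta>: "tot_pair \<alpha> \<beta> \<in> carrier (tot_cocycles G K act 2 3)"
  shows "inv\<^bsub>tot_cocycles G K act 2 3\<^esub> (tot_pair \<alpha> \<beta>) =
    tot_pair (\<lambda>gs ks. inverse (\<alpha> gs ks)) (\<lambda>gs ks. inverse (\<beta> gs ks))"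
proof -
  interpret T: comm_group "tot_group G K 2 3" by (rule tot_group_comm_group)
  interpret Z: comm_group "tot_cocycles G K act 2 3" by (rule tot_cocycles_comm_group)
  have mem: "\<alpha> \<in> cochains G K 2 1" "\<beta> \<in> cochains G K 1 2"
    using \<alpha>\<beta> by (auto simp: tot_pair_cocycle_iff)
  let ?p = "tot_pair (\<lambda>gs ks. inverse (\<alpha> gs ks)) (\<lambda>gs ks. inverse (\<beta> gs ks))"
  have p: "tot_pair \<alpha> \<beta> \<in> carrier (tot_group G K 2 3)" "?p \<in> carrier (tot_group G K 2 3)"
    by (intro tot_pair_mem cochain_inverse mem)+
  have "?p \<otimes>\<^bsub>tot_group G K 2 3\<^esub> tot_pair \<alpha> \<beta> = \<one>\<^bsub>tot_group G K 2 3\<^esub>"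
    by (auto simp: tot_group_def tot_pair_def trivial_cochain_def fun_eq_iff
        cochain_nonzero [OF mem(1)] cochain_nonzero [OF mem(2)])
  then have "inv\<^bsub>tot_group G K 2 3\<^esub> (tot_pair \<alpha> \<beta>) = ?p"
    using p by (rule T.inv_equality)
  moreover have "inv\<^bsub>tot_cocycles G K act 2 3\<^esub> (tot_pair \<alpha> \<beta>) = inv\<^bsub>tot_group G K 2 3\<^esub> (tot_pair \<alpha> \<beta>)"
    using T.m_inv_consistent [OF tot_cocycles_subgroup \<alpha>\<beta>] by (simp add: tot_cocycles_def)
  ultimately show ?thesis by simp
qed

text \<open>\<open>MS\<close> asks for one suitable representative of each class. The suitable
  cocycles form a subgroup \<open>D\<close>, because the condition is stable under pointwise
  products and inverses, and \<open>MS\<close> is the image of \<open>D\<close> under the quotient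
  homomorphism.\<close>

lemma MS_subgroup: "subgroup (MS G K act) (tot_cohomology G K act 2 3)"
proof -
  let ?Z = "tot_cocycles G K act 2 3" and ?B = "tot_coboundaries G K act 2 3"
  interpret Z: comm_group ?Z by (rule tot_cocycles_comm_group)
  interpret N: normal ?B ?Z by (rule tot_coboundaries_normal)
  define D where "D = {tot_pair \<alpha> \<beta> | \<alpha> \<beta>.
     tot_pair \<alpha> \<beta> \<in> carrier ?Z \<and> delta_K_class_trivial G K act \<beta>}"
  have "subgroup D ?Z"
  proof (rule Z.subgroupI)
    show "D \<subseteq> carrier ?Z" by (auto simp: D_def)
    have "delta_K_class_trivial G K act trivial_cochain"
      unfolding delta_K_class_trivial_def by (rule bexI [of _ trivial_cochain]) simp_all
    moreover have "tot_pair trivial_cochain trivial_cochain \<in> carrier ?Z"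
      unfolding tot_pair_cocycle_iff by simp (simp add: trivial_cochain_def)
    ultimately have "tot_pair trivial_cochain trivial_cochain \<in> D"
      unfolding D_def by blast
    then show "D \<noteq> {}" by blast
    show "inv\<^bsub>?Z\<^esub> c \<in> D" if c: "c \<in> D" for c
    proof -
      obtain \<alpha> \<beta> where ab: "c = tot_pair \<alpha> \<beta>" "tot_pair \<alpha> \<beta> \<in> carrier ?Z"
          "delta_K_class_trivial G K act \<beta>"
        using c by (auto simp: D_def)
      show ?thesis
        using Z.inv_closed [OF ab(2)] delta_K_class_trivial_inverse [OF ab(3)]
        unfolding D_def ab(1) inv_tot_pair [OF ab(2)] by (intro CollectI exI conjI) simp_all
    qed
    show "c \<otimes>\<^bsub>?Z\<^esub> c' \<in> D" if c: "c \<in> D" "c' \<in> D" for c c'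
    proof -
      obtain \<alpha> \<beta> \<alpha>' \<beta>' where ab: "c = tot_pair \<alpha> \<beta>" "tot_pair \<alpha> \<beta> \<in> carrier ?Z"
          "delta_K_class_trivial G K act \<beta>"
        and ab': "c' = tot_pair \<alpha>' \<beta>'" "tot_pair \<alpha>' \<beta>' \<in> carrier ?Z"
          "delta_K_class_trivial G K act \<beta>'"
        using c by (auto simp: D_def)
      have "tot_pair \<alpha> \<beta> \<otimes>\<^bsub>?Z\<^esub> tot_pair \<alpha>' \<beta>' =
          tot_pair (\<lambda>gs ks. \<alpha> gs ks * \<alpha>' gs ks) (\<lambda>gs ks. \<beta> gs ks * \<beta>' gs ks)"
        by (auto simp: tot_cocycles_def tot_group_def tot_pair_def trivial_cochain_def fun_eq_iff)
      then show ?thesis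
        using Z.m_closed [OF ab(2) ab'(2)] delta_K_class_trivial_mult [OF ab(3) ab'(3)]
        unfolding D_def ab(1) ab'(1) by (intro CollectI exI conjI) simp_all
    qed
  qed
  moreover have "group_hom ?Z (?Z Mod ?B) (\<lambda>c. ?B #>\<^bsub>?Z\<^esub> c)"
    using N.r_coset_hom_Mod N.factorgroup_is_group
    by (simp add: group_hom_def group_hom_axioms_def Z.group_axioms)
  ultimately have "subgroup ((\<lambda>c. ?B #>\<^bsub>?Z\<^esub> c) ` D) (?Z Mod ?B)"
    by (rule group_hom.subgroup_img_is_subgroup [rotated])
  moreover have "(\<lambda>c. ?B #>\<^bsub>?Z\<^esub> c) ` D = MS G K act"
    by (auto simp: MS_def D_def cohomology_class_def)
  ultimately show ?thesis by (simp add: tot_cohomology_def)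
qed

end

section \<open>Bundles and isomorphisms as matrices\<close>

definition mat :: "('g, 'k) graded_rep \<Rightarrow> 'g \<Rightarrow> nat \<Rightarrow> nat \<Rightarrow> complex" where
  "mat E g i j = oper E g (basis_vector j) i"

text \<open>The value 0 off \<open>L'\<close> puts every image into the space of vectors supported
  on \<open>L'\<close>, so results are equal as functions on all naturals.\<close>

definition matrix_map ::
  "nat set \<Rightarrow> nat set \<Rightarrow> (nat \<Rightarrow> nat \<Rightarrow> complex) \<Rightarrow> (nat \<Rightarrow> complex) \<Rightarrow> nat \<Rightarrow> complex" where
  "matrix_map L' L M v = (\<lambda>n. if n \<in> L' then \<Sum>j\<in>L. M n j * v j else 0)"

lemma basis_vector_apply: "basis_vector j i = (if i = j then 1 else 0)"
  by (simp add: basis_vector_def)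

lemma total_basis_vector: "j \<in> labels E \<Longrightarrow> basis_vector j \<in> total E"
  by (simp add: total_def basis_vector_def)

lemma fibre_basis_vector: "j \<in> labels E \<Longrightarrow> basis_vector j \<in> fibre E (degr E j)"
  by (simp add: fibre_def total_def basis_vector_def)

lemma fibre_total: "v \<in> fibre E k \<Longrightarrow> v \<in> total E"
  by (simp add: fibre_def)

lemma linear_comb:
  "complex_linear_on V f \<Longrightarrow> u \<in> V \<Longrightarrow> v \<in> V \<Longrightarrow>
    f (\<lambda>i. a * u i + b * v i) = (\<lambda>i. a * f u i + b * f v i)"
  by (simp add: complex_linear_on_def)

lemma linear_zero:
  assumes "complex_linear_on (total E) f"
  shows "f (\<lambda>_. 0) = (\<lambda>_. 0)"
proof -
  have "(\<lambda>_. 0) \<in> total E" by (simp add: total_def)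
  from linear_comb [OF assms this this, of 0 0] show ?thesis by simp
qed

lemma linear_scale:
  assumes "complex_linear_on (total E) f" "v \<in> total E"
  shows "f (\<lambda>i. a * v i) = (\<lambda>i. a * f v i)"
  using linear_comb [OF assms assms(2), of a 0] by simp

text \<open>\<open>complex_linear_on\<close> only knows binary combinations, so the vector is built
  up one coordinate at a time; its truncations remain in \<open>total E\<close>.\<close>

lemma linear_expand:
  assumes fin: "finite (labels E)" and f: "complex_linear_on (total E) f" and v: "v \<in> total E"
  shows "f v n = (\<Sum>j\<in>labels E. f (basis_vector j) n * v j)"
proof -
  have "f (\<lambda>i. if i \<in> S then v i else 0) n = (\<Sum>j\<in>S. f (basis_vector j) n * v j)"
    if "S \<subseteq> labels E" for S
    using finite_subset [OF that fin] that
  proof (induction S rule: finite_induct)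
    case empty
    then show ?case by (simp add: linear_zero [OF f])
  next
    case (insert j S)
    let ?w = "\<lambda>i. if i \<in> S then v i else 0"
    have "?w \<in> total E" using v by (simp add: total_def)
    moreover have "basis_vector j \<in> total E" using insert by (simp add: total_basis_vector)
    ultimately have "f (\<lambda>i. v j * basis_vector j i + 1 * ?w i) =
        (\<lambda>i. v j * f (basis_vector j) i + 1 * f ?w i)"
      by (intro linear_comb [OF f])
    moreover have "(\<lambda>i. if i \<in> insert j S then v i else 0) = (\<lambda>i. v j * basis_vector j i + 1 * ?w i)"
      using insert(2) by (auto simp: basis_vector_def)
    ultimately show ?case using insert by (simp add: mult.commute)
  qed
  from this [of "labels E"] have "f (\<lambda>i. if i \<in> labels E then v i else 0) n =
      (\<Sum>j\<in>labels E. f (basis_vector j) n * v j)" by simp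
  moreover have "(\<lambda>i. if i \<in> labels E then v i else 0) = v"
    using v by (auto simp: total_def)
  ultimately show ?thesis by simp
qed

lemma matrix_map_total: "matrix_map (labels F) L M v \<in> total F"
  by (simp add: matrix_map_def total_def)

lemma matrix_map_linear: "complex_linear_on V (matrix_map L' L M)"
  unfolding complex_linear_on_def
  by (intro ballI allI ext)
    (simp add: matrix_map_def algebra_simps sum.distrib sum_distrib_left)

lemma matrix_map_comp:
  "matrix_map L'' L' M (matrix_map L' L N v) = matrix_map L'' L (\<lambda>i j. \<Sum>k\<in>L'. M i k * N k j) v"
proof
  fix n
  have "(\<Sum>k\<in>L'. M n k * (\<Sum>j\<in>L. N k j * v j)) = (\<Sum>j\<in>L. (\<Sum>k\<in>L'. M n k * N k j) * v j)"
    by (simp add: sum_distrib_left sum_distrib_right mult.assoc) (rule sum.swap)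
  then show "matrix_map L'' L' M (matrix_map L' L N v) n =
      matrix_map L'' L (\<lambda>i j. \<Sum>k\<in>L'. M i k * N k j) v n"
    by (simp add: matrix_map_def)
qed

text \<open>Entries are compared only after multiplication by the coordinate, so they may differ in
  columns where the vector vanishes. This matters for vectors in a single fibre.\<close>

lemma matrix_map_cong:
  "(\<And>i j. i \<in> L' \<Longrightarrow> j \<in> L \<Longrightarrow> M i j * v j = N i j * v j) \<Longrightarrow> matrix_map L' L M v = matrix_map L' L N v"
  by (auto simp: matrix_map_def fun_eq_iff intro: sum.cong)

lemma matrix_map_id:
  assumes "finite (labels E)" "v \<in> total E"
  shows "matrix_map (labels E) (labels E) (\<lambda>i j. if i = j then 1 else 0) v = v"
proof
  fix n
  have "(\<Sum>j\<in>labels E. (if n = j then 1 else 0) * v j) = (\<Sum>j\<in>labels E. if n = j then v j else 0)"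
    by (rule sum.cong) auto
  then show "matrix_map (labels E) (labels E) (\<lambda>i j. if i = j then 1 else 0) v n = v n"
    using assms by (auto simp: matrix_map_def total_def)
qed

lemma linear_matrix_map:
  assumes "finite (labels E)" "complex_linear_on (total E) f" "v \<in> total E"
    and "\<And>j. j \<in> labels E \<Longrightarrow> f (basis_vector j) \<in> total F"
  shows "f v = matrix_map (labels F) (labels E) (\<lambda>i j. f (basis_vector j) i) v"
proof
  fix n
  show "f v n = matrix_map (labels F) (labels E) (\<lambda>i j. f (basis_vector j) i) v n"
    using assms(4) linear_expand [OF assms(1-3), of n]
    by (auto simp: matrix_map_def total_def intro!: sum.neutral)
qed

lemma matrix_map_fibre:
  assumes "v \<in> fibre E k" "\<And>i j. i \<in> labels F \<Longrightarrow> j \<in> labels E \<Longrightarrow> degr E j = k \<Longrightarrow> M i j \<noteq> 0 \<Longrightarrow> degr F i = k'"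
  shows "matrix_map (labels F) (labels E) M v \<in> fibre F k'"
proof -
  have "M i j * v j = 0" if "i \<in> labels F" "j \<in> labels E" "degr F i \<noteq> k'" for i j
    using assms that by (cases "degr E j = k") (auto simp: fibre_def)
  then show ?thesis
    by (auto simp: fibre_def matrix_map_total)
      (auto simp: matrix_map_def intro!: sum.neutral)
qed

text \<open>Records finiteness and linearity but neither grading nor twist, so it serves all
  \<alpha> at once. Operators are constrained on \<open>total E\<close> only, as they are arbitrary
  elsewhere.\<close>

definition matrix_action ::
  "('g, 'a) monoid_scheme \<Rightarrow> ('g, 'k) graded_rep \<Rightarrow> bool" where
  "matrix_action G E \<longleftrightarrow> finite (labels E) \<and> (\<forall>g\<in>carrier G. \<forall>v\<in>total E.
     oper E g v = matrix_map (labels E) (labels E) (mat E g) v)"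

text \<open>The twist is evaluated at the degree of the column label, that of the basis vector acted
  upon.\<close>

definition twisted_matrices ::
  "('g, 'a) monoid_scheme \<Rightarrow> ('k, 'b) monoid_scheme \<Rightarrow> ('g \<Rightarrow> 'k \<Rightarrow> 'k) \<Rightarrow>
   ('g, 'k) cochain \<Rightarrow> nat set \<Rightarrow> (nat \<Rightarrow> 'k) \<Rightarrow> ('g \<Rightarrow> nat \<Rightarrow> nat \<Rightarrow> complex) \<Rightarrow> bool" where
  "twisted_matrices G K act \<alpha> L d M \<longleftrightarrow> d ` L \<subseteq> carrier K \<and>
     (\<forall>g\<in>carrier G. \<forall>i\<in>L. \<forall>j\<in>L. M g i j \<noteq> 0 \<longrightarrow> d i = act g (d j)) \<and>
     (\<forall>i\<in>L. \<forall>j\<in>L. M \<one>\<^bsub>G\<^esub> i j = (if i = j then 1 else 0)) \<and>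
     (\<forall>g\<in>carrier G. \<forall>h\<in>carrier G. \<forall>i\<in>L. \<forall>j\<in>L.
        (\<Sum>k\<in>L. M g i k * M h k j) = \<alpha> [g, h] [d j] * M (g \<otimes>\<^bsub>G\<^esub> h) i j)"

lemma matrix_actionD:
  assumes "matrix_action G E" "g \<in> carrier G"
  shows "finite (labels E)" "complex_linear_on (total E) (oper E g)"
    and "v \<in> total E \<Longrightarrow> oper E g v = matrix_map (labels E) (labels E) (mat E g) v"
proof -
  show fin: "finite (labels E)" using assms by (simp add: matrix_action_def)
  show op: "oper E g v = matrix_map (labels E) (labels E) (mat E g) v" if "v \<in> total E" for v
    using assms that by (simp add: matrix_action_def)
  have "(\<lambda>i. a * u i + b * v i) \<in> total E" if "u \<in> total E" "v \<in> total E" for a b u v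
    using that by (simp add: total_def)
  then show "complex_linear_on (total E) (oper E g)"
    using matrix_map_linear [of "total E"] by (simp add: complex_linear_on_def op)
qed

context equivariant_monoid
begin

text \<open>Basis vectors are homogeneous, so the axioms about fibres can be tested on them. This
  also shows that the operators preserve \<open>total E\<close>, of which the axioms do not speak
  directly.\<close>

lemma twisted_bundle_imp_matrices:
  assumes E: "twisted_bundle G K act \<alpha> E"
  shows "matrix_action G E" "twisted_matrices G K act \<alpha> (labels E) (degr E) (mat E)"
proof -
  have fin: "finite (labels E)" and deg: "degr E ` labels E \<subseteq> carrier K"
    and lin: "\<And>g. g \<in> carrier G \<Longrightarrow> complex_linear_on (total E) (oper E g)"
    and fib: "\<And>g k v. g \<in> carrier G \<Longrightarrow> k \<in> carrier K \<Longrightarrow> v \<in> fibre E k \<Longrightarrow>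
      oper E g v \<in> fibre E (act g k)"
    and one: "\<And>z. z \<in> total E \<Longrightarrow> oper E \<one> z = z"
    and comp: "\<And>g h k z. g \<in> carrier G \<Longrightarrow> h \<in> carrier G \<Longrightarrow> k \<in> carrier K \<Longrightarrow> z \<in> fibre E k \<Longrightarrow>
      oper E g (oper E h z) = (\<lambda>i. \<alpha> [g, h] [k] * oper E (g \<otimes> h) z i)"
    using E unfolding twisted_bundle_def by blast+
  have basis: "oper E g (basis_vector j) \<in> fibre E (act g (degr E j))"
    if "g \<in> carrier G" "j \<in> labels E" for g j
    using that deg by (intro fib fibre_basis_vector) auto
  have op: "oper E g v = matrix_map (labels E) (labels E) (mat E g) v"
    if "g \<in> carrier G" "v \<in> total E" for g v
    using linear_matrix_map [OF fin lin [OF that(1)] that(2)] fibre_total [OF basis [OF that(1)]]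
    unfolding mat_def by blast
  show "matrix_action G E"
    using fin op by (simp add: matrix_action_def)
  show "twisted_matrices G K act \<alpha> (labels E) (degr E) (mat E)"
    unfolding twisted_matrices_def
  proof (intro conjI ballI impI)
    show "degr E ` labels E \<subseteq> carrier K" by fact
    show "degr E i = act g (degr E j)"
      if "g \<in> carrier G" "j \<in> labels E" "mat E g i j \<noteq> 0" for g i j
      using basis [OF that(1,2)] that(3) by (auto simp: fibre_def mat_def)
    show "mat E \<one> i j = (if i = j then 1 else 0)" if "j \<in> labels E" for i j
      using that by (simp add: mat_def one total_basis_vector basis_vector_apply)
    show "(\<Sum>k\<in>labels E. mat E g i k * mat E h k j) = \<alpha> [g, h] [degr E j] * mat E (g \<otimes> h) i j"
      if "g \<in> carrier G" "h \<in> carrier G" "i \<in> labels E" "j \<in> labels E" for g h i j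
    proof -
      have "oper E g (oper E h (basis_vector j)) i = \<alpha> [g, h] [degr E j] * mat E (g \<otimes> h) i j"
        using comp [OF that(1,2) _ fibre_basis_vector [OF that(4)]] deg that by (auto simp: mat_def)
      moreover have "oper E h (basis_vector j) \<in> total E"
        using fibre_total [OF basis [OF that(2,4)]] .
      ultimately show ?thesis
        using that by (simp add: op matrix_map_def) (simp add: mat_def)
    qed
  qed
qed

lemma twisted_bundleI:
  assumes E: "matrix_action G E" and M: "twisted_matrices G K act \<alpha> (labels E) (degr E) (mat E)"
  shows "twisted_bundle G K act \<alpha> E"
proof -
  have fin: "finite (labels E)" using E by (simp add: matrix_action_def)
  note op = matrix_actionD(3) [OF E]
  have deg: "degr E ` labels E \<subseteq> carrier K"
    and Mdeg: "\<And>g i j. g \<in> carrier G \<Longrightarrow> i \<in> labels E \<Longrightarrow> j \<in> labels E \<Longrightarrow> mat E g i j \<noteq> 0 \<Longrightarrow>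
      degr E i = act g (degr E j)"
    and Mone: "\<And>i j. i \<in> labels E \<Longrightarrow> j \<in> labels E \<Longrightarrow> mat E \<one> i j = (if i = j then 1 else 0)"
    and Mcomp: "\<And>g h i j. g \<in> carrier G \<Longrightarrow> h \<in> carrier G \<Longrightarrow> i \<in> labels E \<Longrightarrow> j \<in> labels E \<Longrightarrow>
        (\<Sum>k\<in>labels E. mat E g i k * mat E h k j) = \<alpha> [g, h] [degr E j] * mat E (g \<otimes> h) i j"
    using M unfolding twisted_matrices_def by blast+
  show ?thesis
    unfolding twisted_bundle_def
  proof (intro conjI ballI subsetI)
    show "finite (labels E)" by fact
    show "k \<in> carrier K" if "k \<in> degr E ` labels E" for k using deg that by blast
    show "complex_linear_on (total E) (oper E g)" if "g \<in> carrier G" for g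
      by (rule matrix_actionD(2) [OF E that])
    show "w \<in> fibre E (act g k)"
      if g: "g \<in> carrier G" and w: "w \<in> oper E g ` fibre E k" for g k w
    proof -
      obtain v where v: "v \<in> fibre E k" "w = oper E g v" using w by blast
      have "matrix_map (labels E) (labels E) (mat E g) v \<in> fibre E (act g k)"
        by (rule matrix_map_fibre [OF v(1)]) (use Mdeg [OF g] in blast)
      then show ?thesis using v g by (simp add: op fibre_total)
    qed
    show "oper E \<one> z = z" if "z \<in> total E" for z
    proof -
      have "oper E \<one> z = matrix_map (labels E) (labels E) (mat E \<one>) z" by (rule op) (auto simp: that)
      also have "\<dots> = matrix_map (labels E) (labels E) (\<lambda>i j. if i = j then 1 else 0) z"
        by (rule matrix_map_cong) (simp add: Mone)
      also have "\<dots> = z" by (rule matrix_map_id [OF fin that])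
      finally show ?thesis .
    qed
    show "oper E g (oper E h z) = (\<lambda>i. \<alpha> [g, h] [k] * oper E (g \<otimes> h) z i)"
      if "g \<in> carrier G" "h \<in> carrier G" "k \<in> carrier K" "z \<in> fibre E k" for g h k z
    proof -
      have z: "z \<in> total E" by (rule fibre_total) fact
      have "oper E g (oper E h z) = matrix_map (labels E) (labels E)
          (\<lambda>i j. \<Sum>k\<in>labels E. mat E g i k * mat E h k j) z"
        using that z by (simp add: op matrix_map_total matrix_map_comp)
      also have "\<dots> = matrix_map (labels E) (labels E) (\<lambda>i j. \<alpha> [g, h] [k] * mat E (g \<otimes> h) i j) z"
      \<comment> \<open>In columns of degree other than \<open>k\<close> the coordinate of
        \<open>z\<close> is 0, so the twist may be written with the constant argument
        \<open>k\<close>.\<close>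
      proof (rule matrix_map_cong)
        fix i j assume "i \<in> labels E" "j \<in> labels E"
        then show "(\<Sum>k\<in>labels E. mat E g i k * mat E h k j) * z j = \<alpha> [g, h] [k] * mat E (g \<otimes> h) i j * z j"
          using that by (cases "degr E j = k") (auto simp: Mcomp fibre_def)
      qed
      also have "\<dots> = (\<lambda>i. \<alpha> [g, h] [k] * oper E (g \<otimes> h) z i)"
        using that z by (auto simp: op matrix_map_def sum_distrib_left mult.assoc fun_eq_iff)
      finally show ?thesis .
    qed
  qed
qed

text \<open>\<open>Q\<close> is the inverse matrix. Carrying it along with its degree condition lets
  block and Kronecker constructions produce isomorphisms without any rank argument.\<close>

definition matrix_iso where
  "matrix_iso E F P Q \<longleftrightarrow>
     (\<forall>n\<in>labels F. \<forall>j\<in>labels E. P n j \<noteq> 0 \<longrightarrow> degr F n = degr E j) \<and>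
     (\<forall>j\<in>labels E. \<forall>n\<in>labels F. Q j n \<noteq> 0 \<longrightarrow> degr E j = degr F n) \<and>
     (\<forall>i\<in>labels E. \<forall>j\<in>labels E. (\<Sum>n\<in>labels F. Q i n * P n j) = (if i = j then 1 else (0::complex))) \<and>
     (\<forall>n\<in>labels F. \<forall>m\<in>labels F. (\<Sum>j\<in>labels E. P n j * Q j m) = (if n = m then 1 else 0)) \<and>
     (\<forall>g\<in>carrier G. \<forall>n\<in>labels F. \<forall>j\<in>labels E.
        (\<Sum>i\<in>labels E. P n i * mat E g i j) = (\<Sum>m\<in>labels F. mat F g n m * P m j))"

lemma bundle_isoI:
  assumes E: "matrix_action G E" and F: "matrix_action G F" and PQ: "matrix_iso E F P Q"
  shows "bundle_iso G K E F"
proof -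
  let ?P = "matrix_map (labels F) (labels E) P" and ?Q = "matrix_map (labels E) (labels F) Q"
  have fin: "finite (labels E)" "finite (labels F)"
    using E F by (simp_all add: matrix_action_def)
  have Pdeg: "\<And>n j. n \<in> labels F \<Longrightarrow> j \<in> labels E \<Longrightarrow> P n j \<noteq> 0 \<Longrightarrow> degr F n = degr E j"
    and Qdeg: "\<And>n j. n \<in> labels F \<Longrightarrow> j \<in> labels E \<Longrightarrow> Q j n \<noteq> 0 \<Longrightarrow> degr E j = degr F n"
    and QP: "\<And>i j. i \<in> labels E \<Longrightarrow> j \<in> labels E \<Longrightarrow>
      (\<Sum>n\<in>labels F. Q i n * P n j) = (if i = j then 1 else (0::complex))"
    and PQ': "\<And>n m. n \<in> labels F \<Longrightarrow> m \<in> labels F \<Longrightarrow>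
      (\<Sum>j\<in>labels E. P n j * Q j m) = (if n = m then 1 else 0)"
    and inter: "\<And>g n j. g \<in> carrier G \<Longrightarrow> n \<in> labels F \<Longrightarrow> j \<in> labels E \<Longrightarrow>
      (\<Sum>i\<in>labels E. P n i * mat E g i j) = (\<Sum>m\<in>labels F. mat F g n m * P m j)"
    using PQ unfolding matrix_iso_def by blast+
  have "?Q (?P v) = matrix_map (labels E) (labels E) (\<lambda>i j. if i = j then 1 else 0) v" for v
    unfolding matrix_map_comp by (rule matrix_map_cong) (simp add: QP)
  then have QP_id: "?Q (?P v) = v" if "v \<in> total E" for v
    using that fin by (simp add: matrix_map_id)
  have "?P (?Q v) = matrix_map (labels F) (labels F) (\<lambda>i j. if i = j then 1 else 0) v" for v
    unfolding matrix_map_comp by (rule matrix_map_cong) (simp add: PQ')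
  then have PQ_id: "?P (?Q v) = v" if "v \<in> total F" for v
    using that fin by (simp add: matrix_map_id)
  have "bij_betw ?P (total E) (total F)"
    by (rule bij_betw_byWitness [where f' = ?Q]) (auto simp: QP_id PQ_id matrix_map_total)
  moreover have "?P ` fibre E k = fibre F k" for k
  proof
    show "?P ` fibre E k \<subseteq> fibre F k"
      by (auto intro!: matrix_map_fibre dest: Pdeg)
    have "?Q v \<in> fibre E k" if "v \<in> fibre F k" for v
      using that by (auto intro!: matrix_map_fibre dest: Qdeg)
    then show "fibre F k \<subseteq> ?P ` fibre E k"
      by (auto simp: PQ_id fibre_total intro!: image_eqI [of _ _ "?Q _"])
  qed
  moreover have "?P (oper E g z) = oper F g (?P z)" if "g \<in> carrier G" "z \<in> total E" for g z
    unfolding matrix_actionD(3) [OF E that] matrix_actionD(3) [OF F that(1) matrix_map_total]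
      matrix_map_comp
    by (rule matrix_map_cong) (simp add: inter that)
  ultimately show ?thesis
    unfolding bundle_iso_def using matrix_map_linear [of "total E"] by blast
qed

section \<open>Bundle isomorphism as an equivalence relation\<close>

lemma bundle_iso_refl: "bundle_iso G K E E"
  unfolding bundle_iso_def by (rule exI [of _ id]) (auto simp: complex_linear_on_def)

lemma total_linear_comb:
  "u \<in> total E \<Longrightarrow> v \<in> total E \<Longrightarrow> (\<lambda>i. a * u i + b * v i) \<in> total E"
  by (simp add: total_def)

definition iso_via ::
  "((nat \<Rightarrow> complex) \<Rightarrow> (nat \<Rightarrow> complex)) \<Rightarrow> ('g, 'k) graded_rep \<Rightarrow> ('g, 'k) graded_rep \<Rightarrow> bool" where
  "iso_via \<phi> E F \<longleftrightarrow> complex_linear_on (total E) \<phi> \<and> bij_betw \<phi> (total E) (total F) \<and>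
     (\<forall>k\<in>carrier K. \<phi> ` fibre E k = fibre F k) \<and>
     (\<forall>g\<in>carrier G. \<forall>z\<in>total E. \<phi> (oper E g z) = oper F g (\<phi> z))"

lemma bundle_iso_via: "bundle_iso G K E F \<longleftrightarrow> (\<exists>\<phi>. iso_via \<phi> E F)"
  by (simp add: bundle_iso_def iso_via_def)

lemma iso_viaD:
  assumes "iso_via \<phi> E F"
  shows "complex_linear_on (total E) \<phi>" "bij_betw \<phi> (total E) (total F)"
    and "k \<in> carrier K \<Longrightarrow> \<phi> ` fibre E k = fibre F k"
    and "g \<in> carrier G \<Longrightarrow> z \<in> total E \<Longrightarrow> \<phi> (oper E g z) = oper F g (\<phi> z)"
    and "z \<in> total E \<Longrightarrow> \<phi> z \<in> total F"
    and "k \<in> carrier K \<Longrightarrow> z \<in> fibre E k \<Longrightarrow> \<phi> z \<in> fibre F k"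
  using assms imageI [of z "fibre E k" \<phi>] by (auto simp: iso_via_def bij_betw_def)

lemma iso_via_comp:
  assumes \<phi>: "iso_via \<phi> D E" and \<psi>: "iso_via \<psi> E F"
  shows "iso_via (\<psi> \<circ> \<phi>) D F"
  unfolding iso_via_def
proof (intro conjI ballI)
  show "complex_linear_on (total D) (\<psi> \<circ> \<phi>)"
    unfolding complex_linear_on_def
    by (simp add: linear_comb [OF iso_viaD(1) [OF \<phi>]] linear_comb [OF iso_viaD(1) [OF \<psi>]]
        iso_viaD(5) [OF \<phi>])
  show "bij_betw (\<psi> \<circ> \<phi>) (total D) (total F)"
    by (rule bij_betw_trans [OF iso_viaD(2) [OF \<phi>] iso_viaD(2) [OF \<psi>]])
  show "(\<psi> \<circ> \<phi>) ` fibre D k = fibre F k" if "k \<in> carrier K" for k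
    unfolding image_comp [symmetric] iso_viaD(3) [OF \<phi> that] by (rule iso_viaD(3) [OF \<psi> that])
  show "(\<psi> \<circ> \<phi>) (oper D g z) = oper F g ((\<psi> \<circ> \<phi>) z)"
    if "g \<in> carrier G" "z \<in> total D" for g z
    using that by (simp add: iso_viaD(4) [OF \<phi>] iso_viaD(4) [OF \<psi>] iso_viaD(5) [OF \<phi>])
qed

lemma bundle_iso_trans: "bundle_iso G K D E \<Longrightarrow> bundle_iso G K E F \<Longrightarrow> bundle_iso G K D F"
  unfolding bundle_iso_via using iso_via_comp by blast

text \<open>Equivariance of the inverse follows by applying it to the equivariance of
  \<open>\<phi>\<close>. This requires \<open>oper E g\<close> to stay inside
  \<open>total E\<close>, where the inverse is valid; \<open>matrix_action\<close> guarantees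
  it.\<close>

lemma iso_via_inverse:
  assumes E: "matrix_action G E" and \<phi>: "iso_via \<phi> E F"
  shows "iso_via (inv_into (total E) \<phi>) F E"
proof -
  let ?\<psi> = "inv_into (total E) \<phi>"
  have left: "?\<psi> (\<phi> v) = v" if "v \<in> total E" for v
    using bij_betw_inv_into_left [OF iso_viaD(2) [OF \<phi>] that] .
  have right: "\<phi> (?\<psi> v) = v" if "v \<in> total F" for v
    using bij_betw_inv_into_right [OF iso_viaD(2) [OF \<phi>] that] .
  have bij: "bij_betw ?\<psi> (total F) (total E)"
    by (rule bij_betw_inv_into [OF iso_viaD(2) [OF \<phi>]])
  then have mem: "?\<psi> v \<in> total E" if "v \<in> total F" for v
    using that by (auto simp: bij_betw_def)
  show ?thesis
    unfolding iso_via_def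
  proof (intro conjI ballI)
    show "complex_linear_on (total F) ?\<psi>"
      unfolding complex_linear_on_def
    proof (intro ballI allI)
      fix u v a b assume uv: "u \<in> total F" "v \<in> total F"
      have "\<phi> (\<lambda>i. a * ?\<psi> u i + b * ?\<psi> v i) = (\<lambda>i. a * u i + b * v i)"
        using uv by (simp add: linear_comb [OF iso_viaD(1) [OF \<phi>]] mem right)
      then have "?\<psi> (\<lambda>i. a * u i + b * v i) = ?\<psi> (\<phi> (\<lambda>i. a * ?\<psi> u i + b * ?\<psi> v i))"
        by simp
      also have "\<dots> = (\<lambda>i. a * ?\<psi> u i + b * ?\<psi> v i)"
        using uv by (intro left total_linear_comb mem)
      finally show "?\<psi> (\<lambda>i. a * u i + b * v i) = (\<lambda>i. a * ?\<psi> u i + b * ?\<psi> v i)" .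
    qed
    show "bij_betw ?\<psi> (total F) (total E)" by (rule bij)
    show "?\<psi> ` fibre F k = fibre E k" if "k \<in> carrier K" for k
    proof -
      have "?\<psi> ` \<phi> ` fibre E k = fibre E k"
        by (force simp: image_image left fibre_total)
      then show ?thesis by (simp add: iso_viaD(3) [OF \<phi> that])
    qed
    show "?\<psi> (oper F g z) = oper E g (?\<psi> z)" if g: "g \<in> carrier G" and z: "z \<in> total F" for g z
    proof -
      have "oper E g (?\<psi> z) \<in> total E"
        by (simp add: matrix_actionD(3) [OF E g mem [OF z]] matrix_map_total)
      from left [OF this] show ?thesis
        by (simp add: iso_viaD(4) [OF \<phi> g mem [OF z]] right [OF z])
    qed
  qed
qed

lemma bundle_iso_sym: "matrix_action G E \<Longrightarrow> bundle_iso G K E F \<Longrightarrow> bundle_iso G K F E"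
  unfolding bundle_iso_via using iso_via_inverse by blast

text \<open>\<open>bundle_iso\<close> controls only fibres over \<open>carrier K\<close>; the
  assumption on degrees places every basis vector in such a fibre.\<close>

lemma bundle_iso_matrices:
  assumes E: "matrix_action G E" and F: "matrix_action G F" and iso: "bundle_iso G K E F"
    and deg: "degr E ` labels E \<subseteq> carrier K" "degr F ` labels F \<subseteq> carrier K"
  obtains P Q where "matrix_iso E F P Q"
proof -
  obtain \<phi> where \<phi>': "iso_via \<phi> E F"
    using iso by (auto simp: bundle_iso_via)
  define \<psi> where "\<psi> = inv_into (total E) \<phi>"
  have \<psi>': "iso_via \<psi> F E"
    unfolding \<psi>_def by (rule iso_via_inverse [OF E \<phi>'])
  note lin = iso_viaD(1) [OF \<phi>'] iso_viaD(1) [OF \<psi>']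
  have \<phi>: "\<phi> v \<in> total F \<and> \<psi> (\<phi> v) = v" if "v \<in> total E" for v
    using that bij_betw_inv_into_left [OF iso_viaD(2) [OF \<phi>'] that] iso_viaD(5) [OF \<phi>']
    by (simp add: \<psi>_def)
  have \<psi>: "\<psi> v \<in> total E \<and> \<phi> (\<psi> v) = v" if "v \<in> total F" for v
    using that bij_betw_inv_into_right [OF iso_viaD(2) [OF \<phi>'] that] iso_viaD(5) [OF \<psi>']
    by (simp add: \<psi>_def)
  define P where "P = (\<lambda>n j. \<phi> (basis_vector j) n)"
  define Q where "Q = (\<lambda>n j. \<psi> (basis_vector j) n)"
  have fin: "finite (labels E)" "finite (labels F)"
    using E F by (simp_all add: matrix_action_def)
  note tb = total_basis_vector
  have \<phi>_map: "\<phi> v = matrix_map (labels F) (labels E) P v" if "v \<in> total E" for v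
    unfolding P_def by (rule linear_matrix_map [OF fin(1) lin(1) that]) (simp add: \<phi> tb)
  have \<psi>_map: "\<psi> v = matrix_map (labels E) (labels F) Q v" if "v \<in> total F" for v
    unfolding Q_def by (rule linear_matrix_map [OF fin(2) lin(2) that]) (simp add: \<psi> tb)
  have "matrix_iso E F P Q"
    unfolding matrix_iso_def
  proof (intro conjI ballI impI)
    show "degr F n = degr E j" if "j \<in> labels E" "P n j \<noteq> 0" for n j
    proof -
      have "\<phi> (basis_vector j) \<in> fibre F (degr E j)"
        using deg(1) that(1) by (intro iso_viaD(6) [OF \<phi>'] fibre_basis_vector) auto
      then show ?thesis using that(2) by (auto simp: P_def fibre_def)
    qed
    show "degr E j = degr F n" if "n \<in> labels F" "Q j n \<noteq> 0" for n j
    proof -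
      have "\<psi> (basis_vector n) \<in> fibre E (degr F n)"
        using deg(2) that(1) by (intro iso_viaD(6) [OF \<psi>'] fibre_basis_vector) auto
      then show ?thesis using that(2) by (auto simp: Q_def fibre_def)
    qed
    show "(\<Sum>n\<in>labels F. Q i n * P n j) = (if i = j then 1 else 0)"
      if "i \<in> labels E" "j \<in> labels E" for i j
    proof -
      have "\<psi> (\<phi> (basis_vector j)) i = (\<Sum>n\<in>labels F. Q i n * P n j)"
        using that \<phi> [OF tb [OF that(2)]] by (subst \<psi>_map) (simp_all add: matrix_map_def P_def)
      then show ?thesis using \<phi> [OF tb [OF that(2)]] by (simp add: basis_vector_apply)
    qed
    show "(\<Sum>j\<in>labels E. P n j * Q j m) = (if n = m then 1 else 0)"
      if "n \<in> labels F" "m \<in> labels F" for n m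
    proof -
      have "\<phi> (\<psi> (basis_vector m)) n = (\<Sum>j\<in>labels E. P n j * Q j m)"
        using that \<psi> [OF tb [OF that(2)]] by (subst \<phi>_map) (simp_all add: matrix_map_def Q_def)
      then show ?thesis using \<psi> [OF tb [OF that(2)]] by (simp add: basis_vector_apply)
    qed
    show "(\<Sum>i\<in>labels E. P n i * mat E g i j) = (\<Sum>m\<in>labels F. mat F g n m * P m j)"
      if "g \<in> carrier G" "n \<in> labels F" "j \<in> labels E" for g n j
    proof -
      have "oper E g (basis_vector j) \<in> total E"
        by (simp add: matrix_actionD(3) [OF E that(1) tb [OF that(3)]] matrix_map_total)
      then have "\<phi> (oper E g (basis_vector j)) n = (\<Sum>i\<in>labels E. P n i * mat E g i j)"
        using that by (simp add: \<phi>_map matrix_map_def mat_def)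
      moreover have "oper F g (\<phi> (basis_vector j)) n = (\<Sum>m\<in>labels F. mat F g n m * P m j)"
        using that \<phi> [OF tb [OF that(3)]]
        by (simp add: matrix_actionD(3) [OF F that(1)] matrix_map_def P_def)
      ultimately show ?thesis using iso_viaD(4) [OF \<phi>' that(1) tb [OF that(3)]] by simp
    qed
  qed
  then show thesis by (rule that)
qed

text \<open>All coherence isomorphisms below are given by monomial matrices.\<close>

lemma monomial_iso:
  assumes E: "matrix_action G E" and F: "matrix_action G F"
    and f: "bij_betw f (labels E) (labels F)"
    and deg: "\<And>i. i \<in> labels E \<Longrightarrow> degr F (f i) = degr E i"
    and c: "\<And>i. i \<in> labels E \<Longrightarrow> c i \<noteq> 0"
    and inter: "\<And>g i j. g \<in> carrier G \<Longrightarrow> i \<in> labels E \<Longrightarrow> j \<in> labels E \<Longrightarrow>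
      c i * mat E g i j = c j * mat F g (f i) (f j)"
  shows "bundle_iso G K E F"
proof (rule bundle_isoI [OF E F])
  have fin: "finite (labels E)" "finite (labels F)"
    using E F by (simp_all add: matrix_action_def)
  have inj: "f i = f j \<longleftrightarrow> i = j" if "i \<in> labels E" "j \<in> labels E" for i j
    using f that by (auto simp: bij_betw_def inj_on_def)
  have mem: "f i \<in> labels F" if "i \<in> labels E" for i
    using f that by (auto simp: bij_betw_def)
  have surj: "\<exists>i\<in>labels E. n = f i" if "n \<in> labels F" for n
    using f that by (auto simp: bij_betw_def)
  \<comment> \<open>The basis vector at \<open>i\<close> goes to \<open>c i\<close> times the one at
    \<open>f i\<close>; the second matrix undoes this.\<close>
  show "matrix_iso E F (\<lambda>n i. if n = f i then c i else 0) (\<lambda>i n. if n = f i then 1 / c i else 0)"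
    unfolding matrix_iso_def
  proof (intro conjI ballI impI)
    show "(\<Sum>n\<in>labels F. (if n = f i then 1 / c i else 0) * (if n = f j then c j else 0)) =
        (if i = j then 1 else 0)" if "i \<in> labels E" "j \<in> labels E" for i j
      using fin that c mem inj by (simp add: if_distrib [of "\<lambda>x. x * _"] cong: if_cong)
    show "(\<Sum>j\<in>labels E. (if n = f j then c j else 0) * (if m = f j then 1 / c j else 0)) =
        (if n = m then 1 else 0)" if nm: "n \<in> labels F" "m \<in> labels F" for n m
    proof -
      obtain i k where i: "i \<in> labels E" "n = f i" and k: "k \<in> labels E" "m = f k"
        using surj [OF nm(1)] surj [OF nm(2)] by blast
      have "(\<Sum>j\<in>labels E. (if n = f j then c j else 0) * (if m = f j then 1 / c j else 0)) =
          (\<Sum>j\<in>labels E. if j = i then c j * (if k = j then 1 / c j else 0) else 0)"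
        using i k by (intro sum.cong) (auto simp: inj)
      then show ?thesis using i k fin c inj by simp
    qed
    show "(\<Sum>i\<in>labels E. (if n = f i then c i else 0) * mat E g i j) =
        (\<Sum>m\<in>labels F. mat F g n m * (if m = f j then c j else 0))"
      if gj: "g \<in> carrier G" "n \<in> labels F" "j \<in> labels E" for g n j
    proof -
      obtain i where i: "i \<in> labels E" "n = f i" using surj [OF gj(2)] by blast
      have "(\<Sum>l\<in>labels E. (if n = f l then c l else 0) * mat E g l j) =
          (\<Sum>l\<in>labels E. if l = i then c l * mat E g l j else 0)"
        using i by (intro sum.cong) (auto simp: inj)
      also have "\<dots> = c i * mat E g i j" using i fin by simp
      also have "\<dots> = c j * mat F g n (f j)" unfolding i(2) by (rule inter) (use gj i in auto)
      also have "\<dots> = (\<Sum>m\<in>labels F. mat F g n m * (if m = f j then c j else 0))"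
        using mem gj fin by (simp add: if_distrib [of "\<lambda>x. _ * x"] cong: if_cong)
      finally show ?thesis .
    qed
  qed (auto simp: deg split: if_splits)
qed

end

section \<open>Sums and twisted products\<close>

lemma labels_bundle_sum:
  "labels (bundle_sum E F) = (\<lambda>i. sum_encode (Inl i)) ` labels E \<union> (\<lambda>j. sum_encode (Inr j)) ` labels F"
  by (auto simp: bundle_sum_def Plus_def image_Un image_image)

lemma labels_bundle_star:
  "labels (bundle_star K \<beta> E F) = (\<lambda>(i, j). prod_encode (i, j)) ` (labels E \<times> labels F)"
  by (simp add: bundle_star_def)

lemma degr_bundle_sum [simp]:
  "degr (bundle_sum E F) (sum_encode (Inl i)) = degr E i"
  "degr (bundle_sum E F) (sum_encode (Inr j)) = degr F j"
  by (simp_all add: bundle_sum_def)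

lemma degr_bundle_star [simp]:
  "degr (bundle_star K \<beta> E F) (prod_encode (i, j)) = degr E i \<otimes>\<^bsub>K\<^esub> degr F j"
  by (simp add: bundle_star_def)

lemma sum_encode_eq_iff [simp]: "sum_encode x = sum_encode y \<longleftrightarrow> x = y"
  using inj_sum_encode [of UNIV] by (auto simp: inj_def)

lemma bundle_sum_label_iff [simp]:
  "sum_encode (Inl i) \<in> labels (bundle_sum E F) \<longleftrightarrow> i \<in> labels E"
  "sum_encode (Inr j) \<in> labels (bundle_sum E F) \<longleftrightarrow> j \<in> labels F"
  by (auto simp: labels_bundle_sum)

lemma bundle_star_label_iff [simp]:
  "prod_encode (i, j) \<in> labels (bundle_star K \<beta> E F) \<longleftrightarrow> i \<in> labels E \<and> j \<in> labels F"
  by (auto simp: labels_bundle_star)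

lemma sum_labels_bundle_sum:
  assumes "finite (labels E)" "finite (labels F)"
  shows "(\<Sum>n\<in>labels (bundle_sum E F). f n) =
    (\<Sum>i\<in>labels E. f (sum_encode (Inl i))) + (\<Sum>j\<in>labels F. f (sum_encode (Inr j)))"
  unfolding labels_bundle_sum
  by (subst sum.union_disjoint) (auto simp: assms sum.reindex inj_on_def)

lemma sum_labels_bundle_star:
  "(\<Sum>n\<in>labels (bundle_star K \<beta> E F). f n) = (\<Sum>i\<in>labels E. \<Sum>j\<in>labels F. f (prod_encode (i, j)))"
  unfolding labels_bundle_star
  by (subst sum.reindex) (auto simp: inj_on_def sum.cartesian_product intro: sum.cong)

lemma mat_bundle_sum_same [simp]:
  "mat (bundle_sum E F) g (sum_encode (Inl i)) (sum_encode (Inl i')) = mat E g i i'"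
  "mat (bundle_sum E F) g (sum_encode (Inr j)) (sum_encode (Inr j')) = mat F g j j'"
  by (simp_all add: mat_def bundle_sum_def basis_vector_def)

text \<open>A basis vector of one summand has zero coordinates in the other, whose operator is thus
  applied to the zero vector; linearity gives 0.\<close>

lemma mat_bundle_sum_cross:
  assumes "matrix_action G E" "matrix_action G F" "g \<in> carrier G"
  shows "mat (bundle_sum E F) g (sum_encode (Inl i)) (sum_encode (Inr j)) = 0"
    and "mat (bundle_sum E F) g (sum_encode (Inr j)) (sum_encode (Inl i)) = 0"
  using linear_zero [OF matrix_actionD(2) [OF assms(1,3)]]
    linear_zero [OF matrix_actionD(2) [OF assms(2,3)]]
  by (simp_all add: mat_def bundle_sum_def basis_vector_def)

lemma mat_outside:
  assumes "matrix_action G E" "g \<in> carrier G" "j \<in> labels E" "i \<notin> labels E"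
  shows "mat E g i j = 0"
  using matrix_actionD(3) [OF assms(1,2) total_basis_vector [OF assms(3)]] assms(4)
  by (simp add: mat_def matrix_map_def)

lemma matrix_action_bundle_sum:
  assumes E: "matrix_action G E" and F: "matrix_action G F"
  shows "matrix_action G (bundle_sum E F)"
  unfolding matrix_action_def
proof (intro conjI ballI ext)
  have fin: "finite (labels E)" "finite (labels F)"
    using E F by (simp_all add: matrix_action_def)
  then show "finite (labels (bundle_sum E F))" by (simp add: labels_bundle_sum)
  fix g v n assume g: "g \<in> carrier G" and v: "v \<in> total (bundle_sum E F)"
  have vE: "(\<lambda>i. v (sum_encode (Inl i))) \<in> total E" and vF: "(\<lambda>j. v (sum_encode (Inr j))) \<in> total F"
    using v by (simp_all add: total_def)
  show "oper (bundle_sum E F) g v n =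
      matrix_map (labels (bundle_sum E F)) (labels (bundle_sum E F)) (mat (bundle_sum E F) g) v n"
  proof (cases "sum_decode n")
    case (Inl i)
    then have n: "n = sum_encode (Inl i)" by (metis sum_decode_inverse)
    have "oper (bundle_sum E F) g v n = oper E g (\<lambda>i. v (sum_encode (Inl i))) i"
      by (simp add: n bundle_sum_def)
    then show ?thesis
      unfolding n matrix_actionD(3) [OF E g vE]
      by (auto simp: matrix_map_def sum_labels_bundle_sum [OF fin] mat_bundle_sum_cross [OF E F g])
  next
    case (Inr j)
    then have n: "n = sum_encode (Inr j)" by (metis sum_decode_inverse)
    have "oper (bundle_sum E F) g v n = oper F g (\<lambda>j. v (sum_encode (Inr j))) j"
      by (simp add: n bundle_sum_def)
    then show ?thesis
      unfolding n matrix_actionD(3) [OF F g vF]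
      by (auto simp: matrix_map_def sum_labels_bundle_sum [OF fin] mat_bundle_sum_cross [OF E F g])
  qed
qed

text \<open>The double sum in the operator collapses to the pair \<open>(k, l)\<close>, so \<beta>
  is read at the degrees of the column.\<close>

lemma mat_bundle_star:
  assumes fin: "finite (labels E)" "finite (labels F)" and kl: "k \<in> labels E" "l \<in> labels F"
  shows "mat (bundle_star K \<beta> E F) g (prod_encode (i, j)) (prod_encode (k, l)) =
    \<beta> [g] [degr E k, degr F l] * mat E g i k * mat F g j l"
proof -
  have "mat (bundle_star K \<beta> E F) g (prod_encode (i, j)) (prod_encode (k, l)) =
    (\<Sum>k'\<in>labels E. \<Sum>l'\<in>labels F. if l' = l then if k' = k then
      \<beta> [g] [degr E k, degr F l] * mat E g i k * mat F g j l else 0 else 0)"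
    unfolding mat_def bundle_star_def
    by (simp add: pure_tensor_def) (intro sum.cong refl, auto simp: basis_vector_apply)
  also have "\<dots> = \<beta> [g] [degr E k, degr F l] * mat E g i k * mat F g j l"
    using fin kl by simp
  finally show ?thesis .
qed

lemma matrix_action_bundle_star:
  assumes E: "matrix_action G E" and F: "matrix_action G F"
  shows "matrix_action G (bundle_star K \<beta> E F)"
  unfolding matrix_action_def
proof (intro conjI ballI ext)
  have fin: "finite (labels E)" "finite (labels F)"
    using E F by (simp_all add: matrix_action_def)
  then show "finite (labels (bundle_star K \<beta> E F))" by (simp add: labels_bundle_star)
  fix g v n assume g: "g \<in> carrier G" and v: "v \<in> total (bundle_star K \<beta> E F)"
  obtain p q where n: "n = prod_encode (p, q)" by (metis prod_decode_inverse surj_pair)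
  have "oper (bundle_star K \<beta> E F) g v n =
    (\<Sum>i\<in>labels E. \<Sum>j\<in>labels F.
        v (prod_encode (i, j)) * \<beta> [g] [degr E i, degr F j] * (mat E g p i * mat F g q j))"
    by (simp add: n bundle_star_def pure_tensor_def mat_def)
  \<comment> \<open>If \<open>p\<close> or \<open>q\<close> is not a label, each summand contains an
    entry in a row outside the labels, which is 0 by \<open>mat_outside\<close>.\<close>
  also have "\<dots> = (if p \<in> labels E \<and> q \<in> labels F then (\<Sum>i\<in>labels E. \<Sum>j\<in>labels F.
        \<beta> [g] [degr E i, degr F j] * mat E g p i * mat F g q j * v (prod_encode (i, j))) else 0)"
    by (auto simp: mult_ac mat_outside [OF E g] mat_outside [OF F g] intro!: sum.neutral)
  also have "\<dots> = matrix_map (labels (bundle_star K \<beta> E F)) (labels (bundle_star K \<beta> E F))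
      (mat (bundle_star K \<beta> E F) g) v n"
    by (auto simp: matrix_map_def sum_labels_bundle_star n mat_bundle_star [OF fin] cong: sum.cong)
  finally show "oper (bundle_star K \<beta> E F) g v n = matrix_map (labels (bundle_star K \<beta> E F))
      (labels (bundle_star K \<beta> E F)) (mat (bundle_star K \<beta> E F) g) v n" .
qed

context equivariant_monoid
begin

lemma twisted_bundleD:
  assumes "twisted_bundle G K act \<alpha> E"
  shows "matrix_action G E" "finite (labels E)"
    and "i \<in> labels E \<Longrightarrow> degr E i \<in> carrier K"
    and "g \<in> carrier G \<Longrightarrow> i \<in> labels E \<Longrightarrow> j \<in> labels E \<Longrightarrow> mat E g i j \<noteq> 0 \<Longrightarrow>
      degr E i = act g (degr E j)"
    and "i \<in> labels E \<Longrightarrow> j \<in> labels E \<Longrightarrow> mat E \<one> i j = (if i = j then 1 else 0)"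
    and "g \<in> carrier G \<Longrightarrow> h \<in> carrier G \<Longrightarrow> i \<in> labels E \<Longrightarrow> j \<in> labels E \<Longrightarrow>
        (\<Sum>k\<in>labels E. mat E g i k * mat E h k j) = \<alpha> [g, h] [degr E j] * mat E (g \<otimes> h) i j"
  using twisted_bundle_imp_matrices [OF assms]
  unfolding twisted_matrices_def matrix_action_def by blast+

lemma twisted_bundle_sum:
  assumes E: "twisted_bundle G K act \<alpha> E" and F: "twisted_bundle G K act \<alpha> F"
  shows "twisted_bundle G K act \<alpha> (bundle_sum E F)"
proof (rule twisted_bundleI)
  note D = twisted_bundleD [OF E] twisted_bundleD [OF F]
  note cross = mat_bundle_sum_cross [OF twisted_bundleD(1) [OF E] twisted_bundleD(1) [OF F]]
  show "matrix_action G (bundle_sum E F)"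
    by (intro matrix_action_bundle_sum D)
  show "twisted_matrices G K act \<alpha> (labels (bundle_sum E F)) (degr (bundle_sum E F)) (mat (bundle_sum E F))"
    unfolding twisted_matrices_def
  proof (intro conjI ballI impI)
    show "degr (bundle_sum E F) ` labels (bundle_sum E F) \<subseteq> carrier K"
      using D by (auto simp: labels_bundle_sum)
    show "degr (bundle_sum E F) i = act g (degr (bundle_sum E F) j)"
      if "g \<in> carrier G" "i \<in> labels (bundle_sum E F)" "j \<in> labels (bundle_sum E F)"
        "mat (bundle_sum E F) g i j \<noteq> 0" for g i j
      using that by (auto simp: labels_bundle_sum cross D)
    show "mat (bundle_sum E F) \<one> i j = (if i = j then 1 else 0)"
      if "i \<in> labels (bundle_sum E F)" "j \<in> labels (bundle_sum E F)" for i j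
      using that by (auto simp: labels_bundle_sum cross D)
    show "(\<Sum>k\<in>labels (bundle_sum E F). mat (bundle_sum E F) g i k * mat (bundle_sum E F) h k j) =
        \<alpha> [g, h] [degr (bundle_sum E F) j] * mat (bundle_sum E F) (g \<otimes> h) i j"
      if "g \<in> carrier G" "h \<in> carrier G" "i \<in> labels (bundle_sum E F)" "j \<in> labels (bundle_sum E F)"
      for g h i j
      using that unfolding sum_labels_bundle_sum [OF twisted_bundleD(2) [OF E] twisted_bundleD(2) [OF F]]
      by (auto simp: labels_bundle_sum cross D)
  qed
qed

lemma twisted_bundle_zero: "twisted_bundle G K act \<alpha> (bundle_zero K)"
  by (rule twisted_bundleI)
    (auto simp: matrix_action_def twisted_matrices_def bundle_zero_def total_def matrix_map_def)

lemma bundle_isoE_matrices: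
  assumes E: "twisted_bundle G K act \<alpha> E" and F: "twisted_bundle G K act \<alpha>' F"
    and iso: "bundle_iso G K E F"
  obtains P Q where "matrix_iso E F P Q"
proof (rule bundle_iso_matrices [OF twisted_bundleD(1) [OF E] twisted_bundleD(1) [OF F] iso])
  show "degr E ` labels E \<subseteq> carrier K" "degr F ` labels F \<subseteq> carrier K"
    using twisted_bundleD(3) [OF E] twisted_bundleD(3) [OF F] by auto
qed

lemma matrix_isoD:
  assumes "matrix_iso E F P Q"
  shows "n \<in> labels F \<Longrightarrow> j \<in> labels E \<Longrightarrow> P n j \<noteq> 0 \<Longrightarrow> degr F n = degr E j"
    and "j \<in> labels E \<Longrightarrow> n \<in> labels F \<Longrightarrow> Q j n \<noteq> 0 \<Longrightarrow> degr E j = degr F n"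
    and "i \<in> labels E \<Longrightarrow> j \<in> labels E \<Longrightarrow> (\<Sum>n\<in>labels F. Q i n * P n j) = (if i = j then 1 else (0::complex))"
    and "n \<in> labels F \<Longrightarrow> m \<in> labels F \<Longrightarrow> (\<Sum>j\<in>labels E. P n j * Q j m) = (if n = m then 1 else 0)"
    and "g \<in> carrier G \<Longrightarrow> n \<in> labels F \<Longrightarrow> j \<in> labels E \<Longrightarrow>
        (\<Sum>i\<in>labels E. P n i * mat E g i j) = (\<Sum>m\<in>labels F. mat F g n m * P m j)"
  using assms unfolding matrix_iso_def by blast+

text \<open>The isomorphism is block diagonal, and so is its inverse.\<close>

lemma bundle_iso_sum_cong:
  assumes E: "twisted_bundle G K act \<alpha> E" "twisted_bundle G K act \<alpha> E'" "bundle_iso G K E E'"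
    and F: "twisted_bundle G K act \<alpha> F" "twisted_bundle G K act \<alpha> F'" "bundle_iso G K F F'"
  shows "bundle_iso G K (bundle_sum E F) (bundle_sum E' F')"
proof -
  note act = twisted_bundleD(1) [OF E(1)] twisted_bundleD(1) [OF E(2)]
    twisted_bundleD(1) [OF F(1)] twisted_bundleD(1) [OF F(2)]
  note sums = sum_labels_bundle_sum [OF twisted_bundleD(2) [OF E(1)] twisted_bundleD(2) [OF F(1)]]
    sum_labels_bundle_sum [OF twisted_bundleD(2) [OF E(2)] twisted_bundleD(2) [OF F(2)]]
  note cross = mat_bundle_sum_cross [OF act(1,3)] mat_bundle_sum_cross [OF act(2,4)]
  obtain P Q where PQ: "matrix_iso E E' P Q" by (rule bundle_isoE_matrices [OF E])
  obtain P' Q' where PQ': "matrix_iso F F' P' Q'" by (rule bundle_isoE_matrices [OF F])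
  define block where "block = (\<lambda>(A :: nat \<Rightarrow> nat \<Rightarrow> complex) B n m. case sum_decode n of
      Inl i \<Rightarrow> (case sum_decode m of Inl j \<Rightarrow> A i j | Inr j \<Rightarrow> 0)
    | Inr i \<Rightarrow> (case sum_decode m of Inl j \<Rightarrow> 0 | Inr j \<Rightarrow> B i j))"
  have block: "block A B (sum_encode (Inl i)) (sum_encode (Inl j)) = A i j"
    "block A B (sum_encode (Inr i)) (sum_encode (Inr j)) = B i j"
    "block A B (sum_encode (Inl i)) (sum_encode (Inr j)) = 0"
    "block A B (sum_encode (Inr i)) (sum_encode (Inl j)) = 0" for A B i j
    by (simp_all add: block_def)
  have "matrix_iso (bundle_sum E F) (bundle_sum E' F') (block P P') (block Q Q')"
    unfolding matrix_iso_def sums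
    by (intro conjI ballI impI)
      (auto simp: labels_bundle_sum block cross matrix_isoD(3-5) [OF PQ] matrix_isoD(3-5) [OF PQ']
        dest: matrix_isoD(1,2) [OF PQ] matrix_isoD(1,2) [OF PQ'])
  then show ?thesis
    by (intro bundle_isoI matrix_action_bundle_sum act)
qed

text \<open>Kronecker products of the given matrices work for every \<beta>: isomorphisms preserve
  degrees, so the scalar \<beta> is the same before and after applying them.\<close>

lemma bundle_iso_star_cong:
  assumes E: "twisted_bundle G K act \<alpha> E" "twisted_bundle G K act \<alpha> E'" "bundle_iso G K E E'"
    and F: "twisted_bundle G K act \<alpha> F" "twisted_bundle G K act \<alpha> F'" "bundle_iso G K F F'"
  shows "bundle_iso G K (bundle_star K \<beta> E F) (bundle_star K \<beta> E' F')"
proof -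
  note act = twisted_bundleD(1) [OF E(1)] twisted_bundleD(1) [OF E(2)]
    twisted_bundleD(1) [OF F(1)] twisted_bundleD(1) [OF F(2)]
  note star = mat_bundle_star [OF twisted_bundleD(2) [OF E(1)] twisted_bundleD(2) [OF F(1)]]
    mat_bundle_star [OF twisted_bundleD(2) [OF E(2)] twisted_bundleD(2) [OF F(2)]]
  obtain P Q where PQ: "matrix_iso E E' P Q" by (rule bundle_isoE_matrices [OF E])
  obtain P' Q' where PQ': "matrix_iso F F' P' Q'" by (rule bundle_isoE_matrices [OF F])
  define kron where "kron = (\<lambda>(A :: nat \<Rightarrow> nat \<Rightarrow> complex) B n m.
    A (fst (prod_decode n)) (fst (prod_decode m)) * B (snd (prod_decode n)) (snd (prod_decode m)))"
  have kron: "kron A B (prod_encode (i, j)) (prod_encode (k, l)) = A i k * B j l" for A B i j k l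
    by (simp add: kron_def)
  have prod: "(\<Sum>i\<in>I. \<Sum>j\<in>J. (a i * b j) * (c i * d j)) = (\<Sum>i\<in>I. a i * c i) * (\<Sum>j\<in>J. b j * d j)"
    for I J and a b c d :: "nat \<Rightarrow> complex"
    by (simp add: sum_product mult_ac)
  have inter: "(\<Sum>i\<in>labels E. \<Sum>j\<in>labels F. (P n i * P' m j) *
        (\<beta> [g] [degr E k, degr F l] * mat E g i k * mat F g j l)) =
      (\<Sum>i\<in>labels E'. \<Sum>j\<in>labels F'. (\<beta> [g] [degr E' i, degr F' j] * mat E' g n i * mat F' g m j) *
        (P i k * P' j l))" (is "?L = ?R")
    if "g \<in> carrier G" "n \<in> labels E'" "m \<in> labels F'" "k \<in> labels E" "l \<in> labels F" for g n m k l
  proof -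
    have "?L = \<beta> [g] [degr E k, degr F l] *
        ((\<Sum>i\<in>labels E. P n i * mat E g i k) * (\<Sum>j\<in>labels F. P' m j * mat F g j l))"
      by (simp add: sum_product sum_distrib_left mult_ac)
    also have "\<dots> = \<beta> [g] [degr E k, degr F l] *
        ((\<Sum>i\<in>labels E'. mat E' g n i * P i k) * (\<Sum>j\<in>labels F'. mat F' g m j * P' j l))"
      using that by (simp add: matrix_isoD(5) [OF PQ] matrix_isoD(5) [OF PQ'])
    also have "\<dots> = (\<Sum>i\<in>labels E'. \<Sum>j\<in>labels F'. \<beta> [g] [degr E k, degr F l] *
        (mat E' g n i * P i k * (mat F' g m j * P' j l)))"
      by (simp only: sum_product) (simp only: sum_distrib_left)
    also have "\<dots> = ?R"
    \<comment> \<open>Unless a factor vanishes, \<open>i\<close> and \<open>k\<close> have equal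
      degree, and so do \<open>j\<close> and \<open>l\<close>; hence the two values of \<beta>
      agree.\<close>
    proof (intro sum.cong refl)
      fix i j assume "i \<in> labels E'" "j \<in> labels F'"
      then show "\<beta> [g] [degr E k, degr F l] * (mat E' g n i * P i k * (mat F' g m j * P' j l)) =
          (\<beta> [g] [degr E' i, degr F' j] * mat E' g n i * mat F' g m j) * (P i k * P' j l)"
        using that matrix_isoD(1) [OF PQ, of i k] matrix_isoD(1) [OF PQ', of j l]
        by (cases "P i k = 0"; cases "P' j l = 0") simp_all
    qed
    finally show ?thesis .
  qed
  have "matrix_iso (bundle_star K \<beta> E F) (bundle_star K \<beta> E' F') (kron P P') (kron Q Q')"
    unfolding matrix_iso_def sum_labels_bundle_star
  proof (intro conjI ballI impI)
    show "degr (bundle_star K \<beta> E' F') n = degr (bundle_star K \<beta> E F) j"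
      if "n \<in> labels (bundle_star K \<beta> E' F')" "j \<in> labels (bundle_star K \<beta> E F)" "kron P P' n j \<noteq> 0" for n j
      using that by (auto simp: labels_bundle_star kron
          intro!: arg_cong2 [of _ _ _ _ "mult K"] intro: matrix_isoD(1) [OF PQ] matrix_isoD(1) [OF PQ'])
    show "degr (bundle_star K \<beta> E F) j = degr (bundle_star K \<beta> E' F') n"
      if "j \<in> labels (bundle_star K \<beta> E F)" "n \<in> labels (bundle_star K \<beta> E' F')" "kron Q Q' j n \<noteq> 0" for n j
      using that by (auto simp: labels_bundle_star kron
          intro!: arg_cong2 [of _ _ _ _ "mult K"] intro: matrix_isoD(2) [OF PQ] matrix_isoD(2) [OF PQ'])
    show "(\<Sum>k\<in>labels E'. \<Sum>l\<in>labels F'. kron Q Q' i (prod_encode (k, l)) * kron P P' (prod_encode (k, l)) j) =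
        (if i = j then 1 else 0)"
      if "i \<in> labels (bundle_star K \<beta> E F)" "j \<in> labels (bundle_star K \<beta> E F)" for i j
      using that by (auto simp: labels_bundle_star kron prod matrix_isoD(3) [OF PQ] matrix_isoD(3) [OF PQ'])
    show "(\<Sum>k\<in>labels E. \<Sum>l\<in>labels F. kron P P' i (prod_encode (k, l)) * kron Q Q' (prod_encode (k, l)) j) =
        (if i = j then 1 else 0)"
      if "i \<in> labels (bundle_star K \<beta> E' F')" "j \<in> labels (bundle_star K \<beta> E' F')" for i j
      using that by (auto simp: labels_bundle_star kron prod matrix_isoD(4) [OF PQ] matrix_isoD(4) [OF PQ'])
    show "(\<Sum>k\<in>labels E. \<Sum>l\<in>labels F. kron P P' n (prod_encode (k, l)) *
          mat (bundle_star K \<beta> E F) g (prod_encode (k, l)) j) =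
        (\<Sum>k\<in>labels E'. \<Sum>l\<in>labels F'. mat (bundle_star K \<beta> E' F') g n (prod_encode (k, l)) *
          kron P P' (prod_encode (k, l)) j)"
      if "g \<in> carrier G" "n \<in> labels (bundle_star K \<beta> E' F')" "j \<in> labels (bundle_star K \<beta> E F)" for g n j
      using that by (auto simp: labels_bundle_star kron star inter cong: sum.cong)
  qed
  then show ?thesis
    by (intro bundle_isoI matrix_action_bundle_star act)
qed

end

section \<open>The ring of a multiplicative structure\<close>

lemma bundle_sum_labelE:
  assumes "n \<in> labels (bundle_sum E F)"
  obtains i where "n = sum_encode (Inl i)" "i \<in> labels E"
    | j where "n = sum_encode (Inr j)" "j \<in> labels F"
  using assms by (auto simp: labels_bundle_sum)

lemma bundle_star_labelE:
  assumes "n \<in> labels (bundle_star K \<beta> E F)"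
  obtains i j where "n = prod_encode (i, j)" "i \<in> labels E" "j \<in> labels F"
  using assms by (auto simp: labels_bundle_star)

definition iso_rel ::
  "('g, 'a) monoid_scheme \<Rightarrow> ('k, 'b) monoid_scheme \<Rightarrow> ('g \<Rightarrow> 'k \<Rightarrow> 'k) \<Rightarrow>
   ('g, 'k) cochain \<Rightarrow> ('g, 'k) graded_rep rel" where
  "iso_rel G K act \<alpha> =
     {(E, F). twisted_bundle G K act \<alpha> E \<and> twisted_bundle G K act \<alpha> F \<and> bundle_iso G K E F}"

lemma labels_bundle_unit [simp]: "labels (bundle_unit K) = {0}"
  and degr_bundle_unit [simp]: "degr (bundle_unit K) i = \<one>\<^bsub>K\<^esub>"
  and oper_bundle_unit [simp]: "oper (bundle_unit K) g v = v"
  by (simp_all add: bundle_unit_def)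

lemma mat_bundle_unit [simp]: "mat (bundle_unit K) g i j = (if i = j then 1 else 0)"
  by (simp add: mat_def basis_vector_def)

context equivariant_monoid
begin

lemma iso_rel_equiv: "equiv (Collect (twisted_bundle G K act \<alpha>)) (iso_rel G K act \<alpha>)"
proof (rule equivI)
  show "refl_on (Collect (twisted_bundle G K act \<alpha>)) (iso_rel G K act \<alpha>)"
    by (auto simp: refl_on_def iso_rel_def bundle_iso_refl)
  show "sym (iso_rel G K act \<alpha>)"
    by (auto simp: sym_def iso_rel_def intro: bundle_iso_sym twisted_bundleD(1))
  show "trans (iso_rel G K act \<alpha>)"
    unfolding trans_def iso_rel_def using bundle_iso_trans by blast
qed (auto simp: iso_rel_def)

lemma iso_relI:
  "twisted_bundle G K act \<alpha> E \<Longrightarrow> twisted_bundle G K act \<alpha> F \<Longrightarrow> bundle_iso G K E F \<Longrightarrow>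
    (E, F) \<in> iso_rel G K act \<alpha>"
  by (simp add: iso_rel_def)

section \<open>Coherence isomorphisms that only relabel the basis\<close>

lemma bundle_sum_assoc_iso:
  assumes "matrix_action G D" "matrix_action G E" "matrix_action G F"
  shows "bundle_iso G K (bundle_sum (bundle_sum D E) F) (bundle_sum D (bundle_sum E F))"
proof (rule monomial_iso [where c = "\<lambda>_. 1"])
  let ?f = "\<lambda>n. case sum_decode n of
      Inl p \<Rightarrow> (case sum_decode p of Inl i \<Rightarrow> sum_encode (Inl i) | Inr j \<Rightarrow> sum_encode (Inr (sum_encode (Inl j))))
    | Inr k \<Rightarrow> sum_encode (Inr (sum_encode (Inr k)))"
  let ?f' = "\<lambda>n. case sum_decode n of
      Inl i \<Rightarrow> sum_encode (Inl (sum_encode (Inl i)))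
    | Inr p \<Rightarrow> (case sum_decode p of Inl j \<Rightarrow> sum_encode (Inl (sum_encode (Inr j))) | Inr k \<Rightarrow> sum_encode (Inr k))"
  show "bij_betw ?f (labels (bundle_sum (bundle_sum D E) F)) (labels (bundle_sum D (bundle_sum E F)))"
    by (rule bij_betw_byWitness [where f' = ?f']) (auto elim!: bundle_sum_labelE)
  show "degr (bundle_sum D (bundle_sum E F)) (?f i) = degr (bundle_sum (bundle_sum D E) F) i"
    if "i \<in> labels (bundle_sum (bundle_sum D E) F)" for i
    using that by (auto elim!: bundle_sum_labelE)
  show "1 * mat (bundle_sum (bundle_sum D E) F) g i j = 1 * mat (bundle_sum D (bundle_sum E F)) g (?f i) (?f j)"
    if g: "g \<in> carrier G" and ij: "i \<in> labels (bundle_sum (bundle_sum D E) F)"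
      "j \<in> labels (bundle_sum (bundle_sum D E) F)" for g i j
    using ij by (auto elim!: bundle_sum_labelE
        simp: mat_bundle_sum_cross [OF _ _ g] assms matrix_action_bundle_sum)
qed (auto intro!: matrix_action_bundle_sum assms)

lemma bundle_sum_comm_iso:
  assumes "matrix_action G E" "matrix_action G F"
  shows "bundle_iso G K (bundle_sum E F) (bundle_sum F E)"
proof (rule monomial_iso [where c = "\<lambda>_. 1"])
  let ?f = "\<lambda>n. case sum_decode n of Inl i \<Rightarrow> sum_encode (Inr i) | Inr j \<Rightarrow> sum_encode (Inl j)"
  show "bij_betw ?f (labels (bundle_sum E F)) (labels (bundle_sum F E))"
    by (rule bij_betw_byWitness [where f' = ?f]) (auto elim!: bundle_sum_labelE)
  show "degr (bundle_sum F E) (?f i) = degr (bundle_sum E F) i"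
    if "i \<in> labels (bundle_sum E F)" for i
    using that by (auto elim!: bundle_sum_labelE)
  show "1 * mat (bundle_sum E F) g i j = 1 * mat (bundle_sum F E) g (?f i) (?f j)"
    if g: "g \<in> carrier G" and ij: "i \<in> labels (bundle_sum E F)" "j \<in> labels (bundle_sum E F)" for g i j
    using ij by (auto elim!: bundle_sum_labelE simp: mat_bundle_sum_cross [OF _ _ g] assms)
qed (auto intro!: matrix_action_bundle_sum assms)

lemma matrix_action_zero: "matrix_action G (bundle_zero K)"
  \<comment> \<open>The zero bundle is twisted for every cochain, so any instance will do.\<close>
  using twisted_bundle_zero [of trivial_cochain] by (rule twisted_bundleD(1))

lemma labels_bundle_zero [simp]: "labels (bundle_zero K) = {}"
  by (simp add: bundle_zero_def)

lemma bundle_zero_sum_iso: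
  assumes "matrix_action G E"
  shows "bundle_iso G K (bundle_sum (bundle_zero K) E) E"
proof (rule monomial_iso [where c = "\<lambda>_. 1"])
  \<comment> \<open>The \<open>Inl\<close> branch is never reached on labels, as the zero bundle has
    none.\<close>
  let ?f = "\<lambda>n. case sum_decode n of Inl i \<Rightarrow> i | Inr j \<Rightarrow> j"
  show "bij_betw ?f (labels (bundle_sum (bundle_zero K) E)) (labels E)"
    by (rule bij_betw_byWitness [where f' = "\<lambda>j. sum_encode (Inr j)"])
      (auto elim!: bundle_sum_labelE)
qed (auto intro!: matrix_action_bundle_sum assms matrix_action_zero elim!: bundle_sum_labelE)

lemma bundle_iso_empty:
  assumes "matrix_action G E" "matrix_action G F" "labels E = {}" "labels F = {}"
  shows "bundle_iso G K E F"
  by (rule monomial_iso [OF assms(1,2), where f = id and c = "\<lambda>_. 1"]) (simp_all add: assms(3,4))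

text \<open>\<beta> depends only on degrees, which relabelling keeps, so all coefficients can be
  1.\<close>

lemma bundle_star_sum_left_iso:
  assumes D: "twisted_bundle G K act \<alpha> D" and E: "twisted_bundle G K act \<alpha> E"
    and F: "twisted_bundle G K act \<alpha> F"
  shows "bundle_iso G K (bundle_star K \<beta> (bundle_sum D E) F)
    (bundle_sum (bundle_star K \<beta> D F) (bundle_star K \<beta> E F))"
proof (rule monomial_iso [where c = "\<lambda>_. 1"])
  note act = twisted_bundleD(1) [OF D] twisted_bundleD(1) [OF E] twisted_bundleD(1) [OF F]
  note fin = twisted_bundleD(2) [OF D] twisted_bundleD(2) [OF E] twisted_bundleD(2) [OF F]
    twisted_bundleD(2) [OF twisted_bundle_sum [OF D E]]
  let ?f = "\<lambda>n. case prod_decode n of (p, k) \<Rightarrow> (case sum_decode p of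
      Inl i \<Rightarrow> sum_encode (Inl (prod_encode (i, k))) | Inr j \<Rightarrow> sum_encode (Inr (prod_encode (j, k))))"
  let ?f' = "\<lambda>n. case sum_decode n of
      Inl p \<Rightarrow> (case prod_decode p of (i, k) \<Rightarrow> prod_encode (sum_encode (Inl i), k))
    | Inr p \<Rightarrow> (case prod_decode p of (i, k) \<Rightarrow> prod_encode (sum_encode (Inr i), k))"
  let ?L = "bundle_star K \<beta> (bundle_sum D E) F"
  let ?R = "bundle_sum (bundle_star K \<beta> D F) (bundle_star K \<beta> E F)"
  show "bij_betw ?f (labels ?L) (labels ?R)"
    by (rule bij_betw_byWitness [where f' = ?f']) (auto elim!: bundle_sum_labelE bundle_star_labelE)
  show "degr ?R (?f i) = degr ?L i" if "i \<in> labels ?L" for i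
    using that by (auto elim!: bundle_sum_labelE bundle_star_labelE)
  show "1 * mat ?L g i j = 1 * mat ?R g (?f i) (?f j)"
    if g: "g \<in> carrier G" and ij: "i \<in> labels ?L" "j \<in> labels ?L" for g i j
    using ij by (auto elim!: bundle_sum_labelE bundle_star_labelE
        simp: mat_bundle_sum_cross [OF _ _ g] act matrix_action_bundle_star mat_bundle_star fin)
  show "matrix_action G ?L" "matrix_action G ?R"
    by (intro matrix_action_bundle_sum matrix_action_bundle_star act)+
qed simp

lemma bundle_star_sum_right_iso:
  assumes D: "twisted_bundle G K act \<alpha> D" and E: "twisted_bundle G K act \<alpha> E"
    and F: "twisted_bundle G K act \<alpha> F"
  shows "bundle_iso G K (bundle_star K \<beta> F (bundle_sum D E))
    (bundle_sum (bundle_star K \<beta> F D) (bundle_star K \<beta> F E))"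
proof (rule monomial_iso [where c = "\<lambda>_. 1"])
  note act = twisted_bundleD(1) [OF D] twisted_bundleD(1) [OF E] twisted_bundleD(1) [OF F]
  note fin = twisted_bundleD(2) [OF D] twisted_bundleD(2) [OF E] twisted_bundleD(2) [OF F]
    twisted_bundleD(2) [OF twisted_bundle_sum [OF D E]]
  let ?f = "\<lambda>n. case prod_decode n of (k, p) \<Rightarrow> (case sum_decode p of
      Inl i \<Rightarrow> sum_encode (Inl (prod_encode (k, i))) | Inr j \<Rightarrow> sum_encode (Inr (prod_encode (k, j))))"
  let ?f' = "\<lambda>n. case sum_decode n of
      Inl p \<Rightarrow> (case prod_decode p of (k, i) \<Rightarrow> prod_encode (k, sum_encode (Inl i)))
    | Inr p \<Rightarrow> (case prod_decode p of (k, i) \<Rightarrow> prod_encode (k, sum_encode (Inr i)))"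
  let ?L = "bundle_star K \<beta> F (bundle_sum D E)"
  let ?R = "bundle_sum (bundle_star K \<beta> F D) (bundle_star K \<beta> F E)"
  show "bij_betw ?f (labels ?L) (labels ?R)"
    by (rule bij_betw_byWitness [where f' = ?f']) (auto elim!: bundle_sum_labelE bundle_star_labelE)
  show "degr ?R (?f i) = degr ?L i" if "i \<in> labels ?L" for i
    using that by (auto elim!: bundle_sum_labelE bundle_star_labelE)
  show "1 * mat ?L g i j = 1 * mat ?R g (?f i) (?f j)"
    if g: "g \<in> carrier G" and ij: "i \<in> labels ?L" "j \<in> labels ?L" for g i j
    using ij by (auto elim!: bundle_sum_labelE bundle_star_labelE
        simp: mat_bundle_sum_cross [OF _ _ g] act matrix_action_bundle_star mat_bundle_star fin)
  show "matrix_action G ?L" "matrix_action G ?R"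
    by (intro matrix_action_bundle_sum matrix_action_bundle_star act)+
qed simp

end

section \<open>The product and the ring attached to a multiplicative structure\<close>

locale multiplicative_structure =
  equivariant_monoid G K act
  for G :: "('g, 'a) monoid_scheme" (structure)
    and K :: "('k, 'b) monoid_scheme"
    and act :: "'g \<Rightarrow> 'k \<Rightarrow> 'k" +
  fixes \<alpha> \<beta> :: "('g, 'k) cochain"
  assumes multiplicative: "(\<alpha>, \<beta>) \<in> multiplicative_structures G K act"
begin

abbreviation "bundles \<equiv> Collect (twisted_bundle G K act \<alpha>)"

lemma \<alpha>_mem: "\<alpha> \<in> cochains G K 2 1" and \<beta>_mem: "\<beta> \<in> cochains G K 1 2"
  using multiplicative by (simp_all add: multiplicative_structures_def)

lemma \<alpha>_one [simp]: "\<alpha> [g, h] [\<one>\<^bsub>K\<^esub>] = 1"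
  by (rule cochain_normalised [OF \<alpha>_mem]) simp

lemma \<beta>_one [simp]: "\<beta> [g] [\<one>\<^bsub>K\<^esub>, x] = 1" "\<beta> [g] [x, \<one>\<^bsub>K\<^esub>] = 1" "\<beta> [\<one>] ks = 1"
  by (auto intro!: cochain_normalised [OF \<beta>_mem])

text \<open>This is \<open>\<delta>_G \<beta> \<cdot> \<delta>_K \<alpha> = 1\<close> at
  \<open>[g, h]\<close> and \<open>[x, y]\<close> with denominators cleared. The left side is the
  scalar met when \<open>g\<close> is applied after \<open>h\<close> to a tensor of degrees
  \<open>x\<close> and \<open>y\<close>.\<close>

lemma \<alpha>_\<beta>_cocycle:
  assumes "g \<in> carrier G" "h \<in> carrier G" "x \<in> carrier K" "y \<in> carrier K"
  shows "\<beta> [g] [act h x, act h y] * \<beta> [h] [x, y] * (\<alpha> [g, h] [x] * \<alpha> [g, h] [y]) =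
    \<alpha> [g, h] [x \<otimes>\<^bsub>K\<^esub> y] * \<beta> [g \<otimes> h] [x, y]"
proof -
  have "delta_G G K act \<beta> [g, h] [x, y] * delta_K G K \<alpha> [g, h] [x, y] = 1"
    using multiplicative unfolding multiplicative_structures_def by blast
  then show ?thesis
    using assms
    by (simp add: delta_G_2 delta_K_2 cochain_nonzero [OF \<alpha>_mem] cochain_nonzero [OF \<beta>_mem] field_simps)
qed

text \<open>Evaluates \<open>\<delta>_K \<beta> = \<delta>_G \<theta>\<close> at one group element
  with denominators cleared. The two pairs of \<beta> are the scalars of the two bracketings of a
  triple product.\<close>

lemma associator_exists:
  obtains \<theta> where "\<And>x y z. \<theta> x y z \<noteq> 0"
    "\<And>g x y z. g \<in> carrier G \<Longrightarrow> x \<in> carrier K \<Longrightarrow> y \<in> carrier K \<Longrightarrow> z \<in> carrier K \<Longrightarrow>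
      \<theta> x y z * (\<beta> [g] [x \<otimes>\<^bsub>K\<^esub> y, z] * \<beta> [g] [x, y]) =
      \<theta> (act g x) (act g y) (act g z) * (\<beta> [g] [x, y \<otimes>\<^bsub>K\<^esub> z] * \<beta> [g] [y, z])"
proof -
  obtain \<theta> where \<theta>: "\<theta> \<in> cochains G K 0 3" "delta_K G K \<beta> = delta_G G K act \<theta>"
    using multiplicative by (auto simp: multiplicative_structures_def delta_K_class_trivial_def)
  show thesis
  proof (rule that [of "\<lambda>x y z. \<theta> [] [x, y, z]"])
    show "\<theta> [] [x, y, z] \<noteq> 0" for x y z by (rule cochain_nonzero [OF \<theta>(1)])
    fix g x y z assume *: "g \<in> carrier G" "x \<in> carrier K" "y \<in> carrier K" "z \<in> carrier K"
    have "delta_K G K \<beta> [g] [x, y, z] = delta_G G K act \<theta> [g] [x, y, z]" by (simp add: \<theta>)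
    with * show "\<theta> [] [x, y, z] * (\<beta> [g] [x \<otimes>\<^bsub>K\<^esub> y, z] * \<beta> [g] [x, y]) =
        \<theta> [] [act g x, act g y, act g z] * (\<beta> [g] [x, y \<otimes>\<^bsub>K\<^esub> z] * \<beta> [g] [y, z])"
      by (simp add: delta_K_3 delta_G_1 cochain_nonzero [OF \<theta>(1)] cochain_nonzero [OF \<beta>_mem] field_simps)
  qed
qed

text \<open>Once \<beta> has left the sum over middle labels, the sum factors into one matrix
  product for \<open>E\<close> and one for \<open>F\<close>. Each contributes its own \<alpha>, and
  \<open>\<alpha>_\<beta>_cocycle\<close> combines the scalars into the twist in the product
  degree.\<close>

lemma twisted_bundle_star:
  assumes E: "twisted_bundle G K act \<alpha> E" and F: "twisted_bundle G K act \<alpha> F"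
  shows "twisted_bundle G K act \<alpha> (bundle_star K \<beta> E F)"
proof (rule twisted_bundleI)
  note DE = twisted_bundleD [OF E] and DF = twisted_bundleD [OF F]
  note star = mat_bundle_star [OF DE(2) DF(2)]
  let ?S = "bundle_star K \<beta> E F"
  show "matrix_action G ?S" by (intro matrix_action_bundle_star DE DF)
  show "twisted_matrices G K act \<alpha> (labels ?S) (degr ?S) (mat ?S)"
    unfolding twisted_matrices_def
  proof (intro conjI ballI impI)
    show "degr ?S ` labels ?S \<subseteq> carrier K"
      using DE(3) DF(3) by (auto elim!: bundle_star_labelE)
    show "degr ?S i = act g (degr ?S j)"
      if g: "g \<in> carrier G" and ij: "i \<in> labels ?S" "j \<in> labels ?S" "mat ?S g i j \<noteq> 0" for g i j
    proof -
      obtain i1 i2 j1 j2 where *: "i = prod_encode (i1, i2)" "j = prod_encode (j1, j2)"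
        "i1 \<in> labels E" "i2 \<in> labels F" "j1 \<in> labels E" "j2 \<in> labels F"
        using ij by (elim bundle_star_labelE)
      then have "mat E g i1 j1 \<noteq> 0" "mat F g i2 j2 \<noteq> 0"
        using ij(3) by (simp_all add: star)
      then show ?thesis
        using * g DE(3) DF(3) DE(4) [of g i1 j1] DF(4) [of g i2 j2] by simp
    qed
    show "mat ?S \<one> i j = (if i = j then 1 else 0)" if "i \<in> labels ?S" "j \<in> labels ?S" for i j
      using that by (auto elim!: bundle_star_labelE simp: star DE(5) DF(5))
    show "(\<Sum>k\<in>labels ?S. mat ?S g i k * mat ?S h k j) = \<alpha> [g, h] [degr ?S j] * mat ?S (g \<otimes> h) i j"
      if g: "g \<in> carrier G" and h: "h \<in> carrier G" and ij: "i \<in> labels ?S" "j \<in> labels ?S" for g h i j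
    proof -
      obtain i1 i2 j1 j2 where i: "i = prod_encode (i1, i2)" and j: "j = prod_encode (j1, j2)"
        and mem: "i1 \<in> labels E" "i2 \<in> labels F" "j1 \<in> labels E" "j2 \<in> labels F"
        using ij by (elim bundle_star_labelE)
      let ?x = "degr E j1" and ?y = "degr F j2"
      have xy: "?x \<in> carrier K" "?y \<in> carrier K" using DE(3) DF(3) mem by auto
      have "(\<Sum>k\<in>labels ?S. mat ?S g i k * mat ?S h k j) =
        (\<Sum>k\<in>labels E. \<Sum>l\<in>labels F. (\<beta> [g] [degr E k, degr F l] * mat E g i1 k * mat F g i2 l) *
           (\<beta> [h] [?x, ?y] * mat E h k j1 * mat F h l j2))"
        unfolding sum_labels_bundle_star i j by (simp add: star mem cong: sum.cong)
      also have "\<dots> = (\<Sum>k\<in>labels E. \<Sum>l\<in>labels F. \<beta> [g] [act h ?x, act h ?y] * \<beta> [h] [?x, ?y] *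
           ((mat E g i1 k * mat E h k j1) * (mat F g i2 l * mat F h l j2)))"
      \<comment> \<open>Middle labels contribute only if their degrees are \<open>act h ?x\<close>
        and \<open>act h ?y\<close>, which makes the first \<beta> independent of the
        summation.\<close>
      proof (intro sum.cong refl)
        fix k l assume "k \<in> labels E" "l \<in> labels F"
        then show "(\<beta> [g] [degr E k, degr F l] * mat E g i1 k * mat F g i2 l) *
            (\<beta> [h] [?x, ?y] * mat E h k j1 * mat F h l j2) =
            \<beta> [g] [act h ?x, act h ?y] * \<beta> [h] [?x, ?y] *
            ((mat E g i1 k * mat E h k j1) * (mat F g i2 l * mat F h l j2))"
          using DE(4) [OF h, of k j1] DF(4) [OF h, of l j2] mem
          by (cases "mat E h k j1 = 0"; cases "mat F h l j2 = 0") simp_all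
      qed
      also have "\<dots> = \<beta> [g] [act h ?x, act h ?y] * \<beta> [h] [?x, ?y] *
          ((\<Sum>k\<in>labels E. mat E g i1 k * mat E h k j1) * (\<Sum>l\<in>labels F. mat F g i2 l * mat F h l j2))"
        by (simp only: sum_product) (simp only: sum_distrib_left)
      also have "\<dots> = \<beta> [g] [act h ?x, act h ?y] * \<beta> [h] [?x, ?y] * (\<alpha> [g, h] [?x] * \<alpha> [g, h] [?y]) *
          (mat E (g \<otimes> h) i1 j1 * mat F (g \<otimes> h) i2 j2)"
        by (simp add: DE(6) [OF g h] DF(6) [OF g h] mem)
      also have "\<dots> = \<alpha> [g, h] [degr ?S j] * mat ?S (g \<otimes> h) i j"
        unfolding \<alpha>_\<beta>_cocycle [OF g h xy] by (simp add: i j star mem)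
      finally show ?thesis .
    qed
  qed
qed

text \<open>Trivial operators obey the twisted law because the only degree is the unit of
  \<open>K\<close>, where \<alpha> is normalised to 1.\<close>

lemma twisted_bundle_unit: "twisted_bundle G K act \<alpha> (bundle_unit K)"
  by (rule twisted_bundleI)
    (auto simp: matrix_action_def matrix_map_def total_def twisted_matrices_def fun_eq_iff)

lemma bundle_star_assoc_iso:
  assumes D: "twisted_bundle G K act \<alpha> D" and E: "twisted_bundle G K act \<alpha> E"
    and F: "twisted_bundle G K act \<alpha> F"
  shows "bundle_iso G K (bundle_star K \<beta> (bundle_star K \<beta> D E) F)
    (bundle_star K \<beta> D (bundle_star K \<beta> E F))"
proof -
  obtain \<theta> where \<theta>: "\<And>x y z. \<theta> x y z \<noteq> 0"
    "\<And>g x y z. g \<in> carrier G \<Longrightarrow> x \<in> carrier K \<Longrightarrow> y \<in> carrier K \<Longrightarrow> z \<in> carrier K \<Longrightarrow>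
      \<theta> x y z * (\<beta> [g] [x \<otimes>\<^bsub>K\<^esub> y, z] * \<beta> [g] [x, y]) =
      \<theta> (act g x) (act g y) (act g z) * (\<beta> [g] [x, y \<otimes>\<^bsub>K\<^esub> z] * \<beta> [g] [y, z])"
    using associator_exists by blast
  note act = twisted_bundleD(1) [OF D] twisted_bundleD(1) [OF E] twisted_bundleD(1) [OF F]
  note fin = twisted_bundleD(2) [OF D] twisted_bundleD(2) [OF E] twisted_bundleD(2) [OF F]
    twisted_bundleD(2) [OF twisted_bundle_star [OF D E]] twisted_bundleD(2) [OF twisted_bundle_star [OF E F]]
  let ?L = "bundle_star K \<beta> (bundle_star K \<beta> D E) F"
  let ?R = "bundle_star K \<beta> D (bundle_star K \<beta> E F)"
  let ?f = "\<lambda>n. case prod_decode n of (p, k) \<Rightarrow> (case prod_decode p of (i, j) \<Rightarrow>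
      prod_encode (i, prod_encode (j, k)))"
  let ?f' = "\<lambda>n. case prod_decode n of (i, p) \<Rightarrow> (case prod_decode p of (j, k) \<Rightarrow>
      prod_encode (prod_encode (i, j), k))"
  \<comment> \<open>Reciprocals of \<theta>: \<open>monomial_iso\<close> puts the coefficient of the
    row, of degrees moved by \<open>g\<close>, on the left-bracketed side, whereas the identity for
    \<theta> has the unmoved value there.\<close>
  let ?c = "\<lambda>n. case prod_decode n of (p, k) \<Rightarrow> (case prod_decode p of (i, j) \<Rightarrow>
      1 / \<theta> (degr D i) (degr E j) (degr F k))"
  show ?thesis
  proof (rule monomial_iso [where f = ?f and c = ?c])
    show "bij_betw ?f (labels ?L) (labels ?R)"
      by (rule bij_betw_byWitness [where f' = ?f']) (auto elim!: bundle_star_labelE)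
    show "degr ?R (?f i) = degr ?L i" if "i \<in> labels ?L" for i
      using that twisted_bundleD(3) [OF D] twisted_bundleD(3) [OF E] twisted_bundleD(3) [OF F]
      by (auto elim!: bundle_star_labelE simp: K.m_assoc)
    show "?c i \<noteq> 0" if "i \<in> labels ?L" for i
      using that by (auto elim!: bundle_star_labelE simp: \<theta>(1))
    show "?c i * mat ?L g i j = ?c j * mat ?R g (?f i) (?f j)"
      if g: "g \<in> carrier G" and ij: "i \<in> labels ?L" "j \<in> labels ?L" for g i j
    proof -
      obtain i1 i2 i3 j1 j2 j3 where i: "i = prod_encode (prod_encode (i1, i2), i3)"
        and j: "j = prod_encode (prod_encode (j1, j2), j3)"
        and mem: "i1 \<in> labels D" "i2 \<in> labels E" "i3 \<in> labels F" "j1 \<in> labels D" "j2 \<in> labels E" "j3 \<in> labels F"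
        using ij by (auto elim!: bundle_star_labelE)
      show ?thesis
      \<comment> \<open>The row degrees are known to be the moved column degrees only if all three
        entries are nonzero; otherwise both sides vanish.\<close>
      proof (cases "mat D g i1 j1 = 0 \<or> mat E g i2 j2 = 0 \<or> mat F g i3 j3 = 0")
        case True
        then show ?thesis by (auto simp: i j mem mat_bundle_star fin)
      next
        case False
        let ?x = "degr D j1" and ?y = "degr E j2" and ?z = "degr F j3"
        have deg: "degr D i1 = act g ?x" "degr E i2 = act g ?y" "degr F i3 = act g ?z"
          using False g mem twisted_bundleD(4) [OF D] twisted_bundleD(4) [OF E] twisted_bundleD(4) [OF F]
          by blast+
        have "?x \<in> carrier K" "?y \<in> carrier K" "?z \<in> carrier K"
          using mem twisted_bundleD(3) [OF D] twisted_bundleD(3) [OF E] twisted_bundleD(3) [OF F] by blast+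
        from \<theta>(2) [OF g this] show ?thesis
          using \<theta>(1) [of ?x ?y ?z] \<theta>(1) [of "act g ?x" "act g ?y" "act g ?z"]
          by (simp add: i j mem mat_bundle_star fin deg divide_simps) (simp add: mult_ac)
      qed
    qed
    show "matrix_action G ?L" "matrix_action G ?R"
      by (intro matrix_action_bundle_star act)+
  qed
qed

text \<open>Coefficient 1 is equivariant because \<beta> is 1 when one of its monoid arguments is
  the unit.\<close>

lemma bundle_unit_star_iso:
  assumes E: "twisted_bundle G K act \<alpha> E"
  shows "bundle_iso G K (bundle_star K \<beta> (bundle_unit K) E) E"
proof (rule monomial_iso [where c = "\<lambda>_. 1"])
  show "bij_betw (\<lambda>n. snd (prod_decode n)) (labels (bundle_star K \<beta> (bundle_unit K) E)) (labels E)"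
    by (rule bij_betw_byWitness [where f' = "\<lambda>j. prod_encode (0, j)"])
      (auto elim!: bundle_star_labelE)
qed (auto intro!: matrix_action_bundle_star twisted_bundleD(1) [OF E]
    twisted_bundleD(1) [OF twisted_bundle_unit] elim!: bundle_star_labelE
    simp: mat_bundle_star twisted_bundleD(2,3) [OF E])

lemma bundle_star_unit_iso:
  assumes E: "twisted_bundle G K act \<alpha> E"
  shows "bundle_iso G K (bundle_star K \<beta> E (bundle_unit K)) E"
proof (rule monomial_iso [where c = "\<lambda>_. 1"])
  show "bij_betw (\<lambda>n. fst (prod_decode n)) (labels (bundle_star K \<beta> E (bundle_unit K))) (labels E)"
    by (rule bij_betw_byWitness [where f' = "\<lambda>j. prod_encode (j, 0)"])
      (auto elim!: bundle_star_labelE)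
qed (auto intro!: matrix_action_bundle_star twisted_bundleD(1) [OF E]
    twisted_bundleD(1) [OF twisted_bundle_unit] elim!: bundle_star_labelE
    simp: mat_bundle_star twisted_bundleD(2,3) [OF E])

lemma congruence_semiring:
  "congruence_semiring bundles (iso_rel G K act \<alpha>) bundle_sum (bundle_star K \<beta>)
    (bundle_zero K) (bundle_unit K)"
proof
  note closed = twisted_bundle_sum twisted_bundle_star twisted_bundle_zero twisted_bundle_unit
  show "equiv bundles (iso_rel G K act \<alpha>)" by (rule iso_rel_equiv)
  show "(bundle_sum E F, bundle_sum E' F') \<in> iso_rel G K act \<alpha>"
    if "(E, E') \<in> iso_rel G K act \<alpha>" "(F, F') \<in> iso_rel G K act \<alpha>" for E E' F F'
    using that by (auto simp: iso_rel_def closed intro: bundle_iso_sum_cong)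
  show "(bundle_star K \<beta> E F, bundle_star K \<beta> E' F') \<in> iso_rel G K act \<alpha>"
    if "(E, E') \<in> iso_rel G K act \<alpha>" "(F, F') \<in> iso_rel G K act \<alpha>" for E E' F F'
    using that by (auto simp: iso_rel_def closed intro: bundle_iso_star_cong)
  have empty: "labels (bundle_star K \<beta> E (bundle_zero K)) = {}"
    "labels (bundle_star K \<beta> (bundle_zero K) E) = {}" for E :: "('g, 'k) graded_rep"
    by (simp_all add: labels_bundle_star)
  fix D assume D: "D \<in> bundles"
  show "(bundle_star K \<beta> (bundle_zero K) D, bundle_zero K) \<in> iso_rel G K act \<alpha>"
    "(bundle_star K \<beta> D (bundle_zero K), bundle_zero K) \<in> iso_rel G K act \<alpha>"
    using D by (auto intro!: iso_relI bundle_iso_empty closed empty dest: twisted_bundleD(1)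
        intro: twisted_bundleD(1) [OF twisted_bundle_star] matrix_action_zero)
  show "(bundle_sum (bundle_zero K) D, D) \<in> iso_rel G K act \<alpha>"
    using D by (auto intro!: iso_relI closed bundle_zero_sum_iso twisted_bundleD(1))
  show "(bundle_star K \<beta> (bundle_unit K) D, D) \<in> iso_rel G K act \<alpha>"
    using D by (auto intro!: iso_relI closed bundle_unit_star_iso)
  show "(bundle_star K \<beta> D (bundle_unit K), D) \<in> iso_rel G K act \<alpha>"
    using D by (auto intro!: iso_relI closed bundle_star_unit_iso)
  fix E assume E: "E \<in> bundles"
  show "(bundle_sum D E, bundle_sum E D) \<in> iso_rel G K act \<alpha>"
    using D E by (auto intro!: iso_relI closed bundle_sum_comm_iso twisted_bundleD(1))
  fix F assume F: "F \<in> bundles"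
  note DEF = D E F
  show "(bundle_sum (bundle_sum D E) F, bundle_sum D (bundle_sum E F)) \<in> iso_rel G K act \<alpha>"
    using DEF by (auto intro!: iso_relI closed bundle_sum_assoc_iso twisted_bundleD(1))
  show "(bundle_star K \<beta> (bundle_star K \<beta> D E) F, bundle_star K \<beta> D (bundle_star K \<beta> E F)) \<in> iso_rel G K act \<alpha>"
    using DEF by (auto intro!: iso_relI closed bundle_star_assoc_iso)
  show "(bundle_star K \<beta> (bundle_sum D E) F, bundle_sum (bundle_star K \<beta> D F) (bundle_star K \<beta> E F))
      \<in> iso_rel G K act \<alpha>"
    using DEF by (auto intro!: iso_relI closed bundle_star_sum_left_iso)
  show "(bundle_star K \<beta> F (bundle_sum D E), bundle_sum (bundle_star K \<beta> F D) (bundle_star K \<beta> F E))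
      \<in> iso_rel G K act \<alpha>"
    using DEF by (auto intro!: iso_relI closed bundle_star_sum_right_iso)
qed (auto simp: twisted_bundle_zero twisted_bundle_unit)

abbreviation "iso_class E \<equiv> iso_rel G K act \<alpha> `` {E}"

abbreviation "iso_semiring \<equiv>
  congruence_semiring.quotient_semiring bundles (iso_rel G K act \<alpha>) bundle_sum (bundle_star K \<beta>)
    (bundle_zero K) (bundle_unit K)"

lemma presentation:
  "semiring_presentation iso_semiring bundles iso_class bundle_sum (bundle_star K \<beta>)
    (bundle_zero K) (bundle_unit K)"
  by (rule congruence_semiring.quotient_presentation [OF congruence_semiring])

lemma iso_class_eq_iff:
  assumes "twisted_bundle G K act \<alpha> E" "twisted_bundle G K act \<alpha> F"
  shows "iso_class E = iso_class F \<longleftrightarrow> bundle_iso G K E F"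
  using eq_equiv_class_iff [OF iso_rel_equiv, of E \<alpha> F] assms by (simp add: iso_rel_def)

lemma KU_eq:
  "KU G K act \<alpha> \<beta> = semiring_presentation.grothendieck_ring bundles iso_class
    bundle_sum (bundle_star K \<beta>) (bundle_zero K) (bundle_unit K)"
proof -
  interpret P: semiring_presentation iso_semiring bundles iso_class bundle_sum "bundle_star K \<beta>"
    "bundle_zero K" "bundle_unit K" by (rule presentation)
  \<comment> \<open>Equality of the classes of two sums is read as an isomorphism by
    \<open>iso_class_eq_iff\<close>; \<open>q_plus\<close> is switched off since it would break the
    classes of sums apart first.\<close>
  have "P.rel = grothendieck_rel G K act \<alpha>"
    unfolding P.rel_def grothendieck_rel_def virtual_bundles_def
    by (auto simp: iso_class_eq_iff twisted_bundle_sum simp del: P.q_plus cong: conj_cong)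
  then show ?thesis
    by (simp add: P.grothendieck_ring_def KU_def virtual_bundles_def P.vplus_def [abs_def]
        P.vtimes_def [abs_def] virtual_sum_def virtual_star_def)
qed

lemma KU_ring: "ring (KU G K act \<alpha> \<beta>)"
  unfolding KU_eq by (rule semiring_presentation.grothendieck_ring_is_ring [OF presentation])

end

section \<open>Change of multiplicative structure by a coboundary\<close>

text \<open>The functor along which a coboundary identifies the two categories of twisted bundles.\<close>

definition rescale :: "('g \<Rightarrow> 'k \<Rightarrow> complex) \<Rightarrow> ('g, 'k) graded_rep \<Rightarrow> ('g, 'k) graded_rep" where
  "rescale a E = E\<lparr>oper := \<lambda>g v. oper E g (\<lambda>i. a g (degr E i) * v i)\<rparr>"

lemma rescale_simps [simp]:
  "labels (rescale a E) = labels E" "degr (rescale a E) = degr E"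
  "oper (rescale a E) g v = oper E g (\<lambda>i. a g (degr E i) * v i)"
  by (simp_all add: rescale_def)

lemma mat_rescale:
  assumes E: "matrix_action G E" and g: "g \<in> carrier G" and j: "j \<in> labels E"
  shows "mat (rescale a E) g i j = a g (degr E j) * mat E g i j"
proof -
  have "(\<lambda>i. a g (degr E i) * basis_vector j i) = (\<lambda>i. a g (degr E j) * basis_vector j i)"
    by (auto simp: basis_vector_def)
  then show ?thesis
    using linear_scale [OF matrix_actionD(2) [OF E g] total_basis_vector [OF j]]
    by (simp add: mat_def)
qed

lemma matrix_action_rescale:
  assumes E: "matrix_action G E"
  shows "matrix_action G (rescale a E)"
  unfolding matrix_action_def
proof (intro conjI ballI)
  show "finite (labels (rescale a E))" using E by (simp add: matrix_action_def)
  fix g v assume g: "g \<in> carrier G" and v: "v \<in> total (rescale a E)"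
  have v': "(\<lambda>i. a g (degr E i) * v i) \<in> total E" using v by (simp add: total_def)
  show "oper (rescale a E) g v =
      matrix_map (labels (rescale a E)) (labels (rescale a E)) (mat (rescale a E) g) v"
    unfolding rescale_simps matrix_actionD(3) [OF E g v']
    by (auto simp: matrix_map_def mat_rescale [OF E g] intro!: sum.cong ext)
qed

text \<open>In multiplied-out form: \<alpha>' is \<alpha> times \<open>\<delta>_G a\<close>, and
  \<beta>' is \<beta> divided by \<open>\<delta>_G b\<close> and \<open>\<delta>_K a\<close>. In
  both equations the twist of the target stands on the left.\<close>

locale gauge =
  M: multiplicative_structure G K act \<alpha> \<beta> + M': multiplicative_structure G K act \<alpha>' \<beta>'
  for G :: "('g, 'a) monoid_scheme" (structure)
    and K :: "('k, 'b) monoid_scheme"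
    and act :: "'g \<Rightarrow> 'k \<Rightarrow> 'k"
    and \<alpha> \<beta> \<alpha>' \<beta>' +
  fixes a :: "'g \<Rightarrow> 'k \<Rightarrow> complex" and b :: "'k \<Rightarrow> 'k \<Rightarrow> complex"
  assumes a_nonzero: "a g x \<noteq> 0" and b_nonzero: "b x y \<noteq> 0"
    and a_one: "a \<one> x = 1" "a g \<one>\<^bsub>K\<^esub> = 1"
    and a_cocycle: "g \<in> carrier G \<Longrightarrow> h \<in> carrier G \<Longrightarrow> x \<in> carrier K \<Longrightarrow>
      \<alpha>' [g, h] [x] * a (g \<otimes> h) x = a g (act h x) * a h x * \<alpha> [g, h] [x]"
    and b_cocycle: "g \<in> carrier G \<Longrightarrow> x \<in> carrier K \<Longrightarrow> y \<in> carrier K \<Longrightarrow>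
      \<beta>' [g] [x, y] * (a g x * a g y) * b x y =
      b (act g x) (act g y) * a g (x \<otimes>\<^bsub>K\<^esub> y) * \<beta> [g] [x, y]"
begin

text \<open>Reciprocals turn the gauge around, so every construction below is made in one direction
  only and used in both.\<close>

lemma gauge_inverse: "gauge G K act \<alpha>' \<beta>' \<alpha> \<beta> (\<lambda>g x. 1 / a g x) (\<lambda>x y. 1 / b x y)"
proof
  show "\<alpha> [g, h] [x] * (1 / a (g \<otimes> h) x) = 1 / a g (act h x) * (1 / a h x) * \<alpha>' [g, h] [x]"
    if "g \<in> carrier G" "h \<in> carrier G" "x \<in> carrier K" for g h x
    using a_cocycle [OF that] by (simp add: a_nonzero field_simps)
  show "\<beta> [g] [x, y] * (1 / a g x * (1 / a g y)) * (1 / b x y) =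
      1 / b (act g x) (act g y) * (1 / a g (x \<otimes>\<^bsub>K\<^esub> y)) * \<beta>' [g] [x, y]"
    if "g \<in> carrier G" "x \<in> carrier K" "y \<in> carrier K" for g x y
    using b_cocycle [OF that] by (simp add: a_nonzero b_nonzero field_simps)
qed (simp_all add: a_nonzero b_nonzero a_one)

text \<open>Composing operators collects \<open>a g (act h x) * a h x\<close>, while the operator of
  the product carries \<open>a (g \<otimes> h) x\<close>; by \<open>a_cocycle\<close> the
  discrepancy is exactly the change from \<alpha> to \<alpha>'.\<close>

lemma twisted_rescale:
  assumes E: "twisted_bundle G K act \<alpha> E"
  shows "twisted_bundle G K act \<alpha>' (rescale a E)"
proof (rule M.twisted_bundleI)
  note D = M.twisted_bundleD [OF E]
  note mat = mat_rescale [OF D(1)]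
  show "matrix_action G (rescale a E)" by (rule matrix_action_rescale [OF D(1)])
  show "twisted_matrices G K act \<alpha>' (labels (rescale a E)) (degr (rescale a E)) (mat (rescale a E))"
    unfolding twisted_matrices_def rescale_simps
  proof (intro conjI ballI impI)
    show "degr E ` labels E \<subseteq> carrier K" using D(3) by auto
    show "degr E i = act g (degr E j)"
      if "g \<in> carrier G" "i \<in> labels E" "j \<in> labels E" "mat (rescale a E) g i j \<noteq> 0" for g i j
      using that D(4) by (simp add: mat)
    show "mat (rescale a E) \<one> i j = (if i = j then 1 else 0)" if "i \<in> labels E" "j \<in> labels E" for i j
      using that by (simp add: mat D(5) a_one)
    show "(\<Sum>k\<in>labels E. mat (rescale a E) g i k * mat (rescale a E) h k j) =
        \<alpha>' [g, h] [degr E j] * mat (rescale a E) (g \<otimes> h) i j"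
      if g: "g \<in> carrier G" and h: "h \<in> carrier G" and i: "i \<in> labels E" and j: "j \<in> labels E" for g h i j
    proof -
      let ?x = "degr E j"
      have "(\<Sum>k\<in>labels E. mat (rescale a E) g i k * mat (rescale a E) h k j) =
          (\<Sum>k\<in>labels E. (a g (act h ?x) * a h ?x) * (mat E g i k * mat E h k j))"
      proof (rule sum.cong [OF refl])
        fix k assume "k \<in> labels E"
        then show "mat (rescale a E) g i k * mat (rescale a E) h k j =
            (a g (act h ?x) * a h ?x) * (mat E g i k * mat E h k j)"
          using D(4) [OF h, of k j] j by (cases "mat E h k j = 0") (simp_all add: mat g h)
      qed
      also have "\<dots> = (a g (act h ?x) * a h ?x * \<alpha> [g, h] [?x]) * mat E (g \<otimes> h) i j"
        by (simp add: D(6) [OF g h i j] flip: sum_distrib_left)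
      also have "\<dots> = \<alpha>' [g, h] [?x] * mat (rescale a E) (g \<otimes> h) i j"
        unfolding a_cocycle [OF g h D(3) [OF j], symmetric] using g h j by (simp add: mat)
      finally show ?thesis .
    qed
  qed
qed

text \<open>The same matrices \<open>P\<close> and \<open>Q\<close> serve, since \<open>P\<close>
  preserves degrees and therefore commutes with the scalars \<open>a\<close>.\<close>

lemma rescale_cong:
  assumes E: "twisted_bundle G K act \<alpha> E" and F: "twisted_bundle G K act \<alpha> F"
    and iso: "bundle_iso G K E F"
  shows "bundle_iso G K (rescale a E) (rescale a F)"
proof -
  note act = M.twisted_bundleD(1) [OF E] M.twisted_bundleD(1) [OF F]
  obtain P Q where PQ: "M.matrix_iso E F P Q"
    by (rule M.bundle_isoE_matrices [OF E F iso])
  have "M.matrix_iso (rescale a E) (rescale a F) P Q"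
    unfolding M.matrix_iso_def rescale_simps
  proof (intro conjI ballI impI)
    show "(\<Sum>i\<in>labels E. P n i * mat (rescale a E) g i j) =
        (\<Sum>m\<in>labels F. mat (rescale a F) g n m * P m j)"
      if g: "g \<in> carrier G" and n: "n \<in> labels F" and j: "j \<in> labels E" for g n j
    proof -
      have "(\<Sum>i\<in>labels E. P n i * mat (rescale a E) g i j) =
          a g (degr E j) * (\<Sum>i\<in>labels E. P n i * mat E g i j)"
        by (simp add: mat_rescale [OF act(1) g j] sum_distrib_left mult_ac)
      also have "\<dots> = (\<Sum>m\<in>labels F. a g (degr E j) * (mat F g n m * P m j))"
        by (simp add: M.matrix_isoD(5) [OF PQ g n j] sum_distrib_left)
      also have "\<dots> = (\<Sum>m\<in>labels F. mat (rescale a F) g n m * P m j)"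
      proof (rule sum.cong [OF refl])
        fix m assume "m \<in> labels F"
        then show "a g (degr E j) * (mat F g n m * P m j) = mat (rescale a F) g n m * P m j"
          using M.matrix_isoD(1) [OF PQ, of m j] j
          by (cases "P m j = 0") (simp_all add: mat_rescale [OF act(2) g])
      qed
      finally show ?thesis .
    qed
  qed (use M.matrix_isoD(1-4) [OF PQ] in blast)+
  then show ?thesis by (intro M.bundle_isoI matrix_action_rescale act)
qed

lemma rescale_sum_iso:
  assumes E: "twisted_bundle G K act \<alpha> E" and F: "twisted_bundle G K act \<alpha> F"
  shows "bundle_iso G K (rescale a (bundle_sum E F)) (bundle_sum (rescale a E) (rescale a F))"
proof (rule M.monomial_iso [where f = id and c = "\<lambda>_. 1"])
  note act = M.twisted_bundleD(1) [OF E] M.twisted_bundleD(1) [OF F]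
  have labels: "labels (bundle_sum (rescale a E) (rescale a F)) = labels (bundle_sum E F)"
    by (simp add: labels_bundle_sum)
  show "bij_betw id (labels (rescale a (bundle_sum E F))) (labels (bundle_sum (rescale a E) (rescale a F)))"
    by (simp add: labels)
  show "degr (bundle_sum (rescale a E) (rescale a F)) (id i) = degr (rescale a (bundle_sum E F)) i"
    if "i \<in> labels (rescale a (bundle_sum E F))" for i
    using that by (auto elim!: bundle_sum_labelE)
  show "1 * mat (rescale a (bundle_sum E F)) g i j =
      1 * mat (bundle_sum (rescale a E) (rescale a F)) g (id i) (id j)"
    if g: "g \<in> carrier G" and ij: "i \<in> labels (rescale a (bundle_sum E F))"
      "j \<in> labels (rescale a (bundle_sum E F))" for g i j
    using ij by (auto elim!: bundle_sum_labelE
        simp: mat_rescale [OF _ g] mat_bundle_sum_cross [OF _ _ g] act matrix_action_rescale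
          matrix_action_bundle_sum)
qed (auto intro!: matrix_action_bundle_sum matrix_action_rescale M.twisted_bundleD(1) [OF E]
    M.twisted_bundleD(1) [OF F])

text \<open>The operators differ by \<open>a\<close> in the product degree against \<open>a\<close>
  in both factors, together with \<beta> against \<beta>'. By \<open>b_cocycle\<close> the diagonal
  coefficients \<open>b\<close> compensate for this.\<close>

lemma rescale_star_iso:
  assumes E: "twisted_bundle G K act \<alpha> E" and F: "twisted_bundle G K act \<alpha> F"
  shows "bundle_iso G K (rescale a (bundle_star K \<beta> E F)) (bundle_star K \<beta>' (rescale a E) (rescale a F))"
proof -
  note act = M.twisted_bundleD(1) [OF E] M.twisted_bundleD(1) [OF F]
  note fin = M.twisted_bundleD(2) [OF E] M.twisted_bundleD(2) [OF F]
  let ?c = "\<lambda>n. case prod_decode n of (i, j) \<Rightarrow> b (degr E i) (degr F j)"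
  let ?L = "rescale a (bundle_star K \<beta> E F)" and ?R = "bundle_star K \<beta>' (rescale a E) (rescale a F)"
  show ?thesis
  proof (rule M.monomial_iso [where f = id and c = ?c])
    show "bij_betw id (labels ?L) (labels ?R)" by (simp add: labels_bundle_star)
    show "degr ?R (id i) = degr ?L i" if "i \<in> labels ?L" for i
      using that by (auto elim!: bundle_star_labelE)
    show "?c i \<noteq> 0" if "i \<in> labels ?L" for i
      by (simp add: b_nonzero split: prod.split)
    show "?c i * mat ?L g i j = ?c j * mat ?R g (id i) (id j)"
      if g: "g \<in> carrier G" and ij: "i \<in> labels ?L" "j \<in> labels ?L" for g i j
    proof -
      obtain i1 i2 j1 j2 where i: "i = prod_encode (i1, i2)" and j: "j = prod_encode (j1, j2)"
        and mem: "i1 \<in> labels E" "i2 \<in> labels F" "j1 \<in> labels E" "j2 \<in> labels F"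
        using ij by (auto elim!: bundle_star_labelE)
      let ?x = "degr E j1" and ?y = "degr F j2"
      have xy: "?x \<in> carrier K" "?y \<in> carrier K"
        using mem M.twisted_bundleD(3) [OF E] M.twisted_bundleD(3) [OF F] by blast+
      have L: "mat ?L g i j = a g (?x \<otimes>\<^bsub>K\<^esub> ?y) * (\<beta> [g] [?x, ?y] * mat E g i1 j1 * mat F g i2 j2)"
        using mem by (simp add: i j mat_rescale [OF matrix_action_bundle_star [OF act] g] mat_bundle_star fin)
      have R: "mat ?R g i j = \<beta>' [g] [?x, ?y] * (a g ?x * mat E g i1 j1) * (a g ?y * mat F g i2 j2)"
        using mem by (simp add: i j mat_rescale [OF act(1) g] mat_rescale [OF act(2) g] mat_bundle_star fin)
      show ?thesis
      proof (cases "mat E g i1 j1 = 0 \<or> mat F g i2 j2 = 0")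
        case True
        then show ?thesis by (auto simp: L R)
      next
        case False
        have deg: "degr E i1 = act g ?x" "degr F i2 = act g ?y"
          using False g mem M.twisted_bundleD(4) [OF E] M.twisted_bundleD(4) [OF F] by blast+
        have "?c i * mat ?L g i j =
            (b (act g ?x) (act g ?y) * a g (?x \<otimes>\<^bsub>K\<^esub> ?y) * \<beta> [g] [?x, ?y]) * (mat E g i1 j1 * mat F g i2 j2)"
          unfolding L by (simp add: i deg)
        also have "\<dots> = ?c j * mat ?R g (id i) (id j)"
          unfolding b_cocycle [OF g xy, symmetric] id_apply R by (simp add: j)
        finally show ?thesis .
      qed
    qed
    show "matrix_action G ?L" "matrix_action G ?R"
      by (intro matrix_action_rescale matrix_action_bundle_star act)+
  qed
qed

lemma rescale_rescale_iso:
  assumes E: "twisted_bundle G K act \<alpha> E"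
  shows "bundle_iso G K (rescale (\<lambda>g x. 1 / a g x) (rescale a E)) E"
proof (rule M.monomial_iso [where f = id and c = "\<lambda>_. 1"])
  note act = M.twisted_bundleD(1) [OF E]
  show "1 * mat (rescale (\<lambda>g x. 1 / a g x) (rescale a E)) g i j = 1 * mat E g (id i) (id j)"
    if "g \<in> carrier G" "j \<in> labels (rescale (\<lambda>g x. 1 / a g x) (rescale a E))" for g i j
    using that by (simp add: mat_rescale [OF act] mat_rescale [OF matrix_action_rescale [OF act]] a_nonzero)
qed (simp_all add: matrix_action_rescale M.twisted_bundleD(1) [OF E])

text \<open>All labels have degree the unit of \<open>K\<close>, where \<open>a\<close> is
  1.\<close>

lemma rescale_unit_iso: "bundle_iso G K (rescale a (bundle_unit K)) (bundle_unit K)"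
proof (rule M.monomial_iso [where f = id and c = "\<lambda>_. 1"])
  note act = M.twisted_bundleD(1) [OF M.twisted_bundle_unit]
  show "matrix_action G (bundle_unit K)" "matrix_action G (rescale a (bundle_unit K))"
    by (intro matrix_action_rescale act)+
  show "1 * mat (rescale a (bundle_unit K)) g i j = 1 * mat (bundle_unit K) g (id i) (id j)"
    if "g \<in> carrier G" "j \<in> labels (rescale a (bundle_unit K))" for g i j
    using that mat_rescale [OF act that(1), of j a i] by (simp add: a_one)
qed simp_all

lemma morphism:
  "presentation_morphism M.iso_semiring M.bundles M.iso_class bundle_sum (bundle_star K \<beta>)
    (bundle_zero K) (bundle_unit K)
    M'.iso_semiring M'.bundles M'.iso_class bundle_sum (bundle_star K \<beta>')
    (bundle_zero K) (bundle_unit K) (rescale a)"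
proof -
  interpret P: semiring_presentation M.iso_semiring M.bundles M.iso_class bundle_sum "bundle_star K \<beta>"
    "bundle_zero K" "bundle_unit K" by (rule M.presentation)
  interpret P': semiring_presentation M'.iso_semiring M'.bundles M'.iso_class bundle_sum "bundle_star K \<beta>'"
    "bundle_zero K" "bundle_unit K" by (rule M'.presentation)
  show ?thesis
  proof
    show "rescale a E \<in> M'.bundles" if "E \<in> M.bundles" for E
      using that by (simp add: twisted_rescale)
    show "M'.iso_class (rescale a E) = M'.iso_class (rescale a F)"
      if "E \<in> M.bundles" "F \<in> M.bundles" "M.iso_class E = M.iso_class F" for E F
      using that by (simp add: M.iso_class_eq_iff M'.iso_class_eq_iff twisted_rescale rescale_cong)
    show "M'.iso_class (rescale a (bundle_sum E F)) =
        M'.iso_class (rescale a E) \<oplus>\<^bsub>M'.iso_semiring\<^esub> M'.iso_class (rescale a F)"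
      if "E \<in> M.bundles" "F \<in> M.bundles" for E F
    proof -
      have "M'.iso_class (rescale a (bundle_sum E F)) = M'.iso_class (bundle_sum (rescale a E) (rescale a F))"
        using that by (simp add: M'.iso_class_eq_iff twisted_rescale M.twisted_bundle_sum
            rescale_sum_iso del: P'.q_plus)
      then show ?thesis using that by (simp add: twisted_rescale)
    qed
    show "M'.iso_class (rescale a (bundle_star K \<beta> E F)) =
        M'.iso_class (rescale a E) \<otimes>\<^bsub>M'.iso_semiring\<^esub> M'.iso_class (rescale a F)"
      if "E \<in> M.bundles" "F \<in> M.bundles" for E F
    proof -
      have "M'.iso_class (rescale a (bundle_star K \<beta> E F)) = M'.iso_class (bundle_star K \<beta>' (rescale a E) (rescale a F))"
        using that by (simp add: M'.iso_class_eq_iff twisted_rescale M.twisted_bundle_star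
            M'.twisted_bundle_star rescale_star_iso del: P'.q_times)
      then show ?thesis using that by (simp add: twisted_rescale)
    qed
    have "M'.iso_class (rescale a (bundle_zero K)) = M'.iso_class (bundle_zero K)"
      by (simp add: M'.iso_class_eq_iff twisted_rescale M.twisted_bundle_zero M.bundle_iso_empty
          matrix_action_rescale M.matrix_action_zero del: P'.q_zer)
    then show "M'.iso_class (rescale a (bundle_zero K)) = \<zero>\<^bsub>M'.iso_semiring\<^esub>" by simp
    have "M'.iso_class (rescale a (bundle_unit K)) = M'.iso_class (bundle_unit K)"
      by (simp add: M'.iso_class_eq_iff twisted_rescale M.twisted_bundle_unit M'.twisted_bundle_unit
          rescale_unit_iso del: P'.q_uni)
    then show "M'.iso_class (rescale a (bundle_unit K)) = \<one>\<^bsub>M'.iso_semiring\<^esub>" by simp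
  qed
qed

lemma KU_iso: "KU G K act \<alpha> \<beta> \<simeq> KU G K act \<alpha>' \<beta>'"
proof -
  interpret inv: gauge G K act \<alpha>' \<beta>' \<alpha> \<beta> "\<lambda>g x. 1 / a g x" "\<lambda>x y. 1 / b x y"
    by (rule gauge_inverse)
  show ?thesis
    unfolding M.KU_eq M'.KU_eq
  proof (rule presentation_inverse_imp_ring_iso [OF morphism inv.morphism])
    show "M.iso_class (rescale (\<lambda>g x. 1 / a g x) (rescale a E)) = M.iso_class E" if "E \<in> M.bundles" for E
      using that by (simp add: M.iso_class_eq_iff twisted_rescale inv.twisted_rescale rescale_rescale_iso)
    show "M'.iso_class (rescale a (rescale (\<lambda>g x. 1 / a g x) E)) = M'.iso_class E" if "E \<in> M'.bundles" for E
      \<comment> \<open>The inverse of the inverse gauge has scalars \<open>1 / (1 / a g x)\<close>,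
        which simplify to \<open>a g x\<close>.\<close>
      using that inv.rescale_rescale_iso [of E]
      by (simp add: M'.iso_class_eq_iff twisted_rescale inv.twisted_rescale)
  qed
qed

end

section \<open>Cohomologous structures and the correspondence with classes\<close>

context equivariant_monoid
begin

lemma cohomologous_gauge:
  assumes m: "(\<alpha>, \<beta>) \<in> multiplicative_structures G K act"
    and m': "(\<alpha>', \<beta>') \<in> multiplicative_structures G K act"
    and coh: "cohomologous G K act 2 3 (tot_pair \<alpha>' \<beta>') (tot_pair \<alpha> \<beta>)"
  obtains a b where "gauge G K act \<alpha> \<beta> \<alpha>' \<beta>' a b"
proof -
  obtain c where c: "c \<in> carrier (tot_group G K 2 2)"
    and eq: "tot_pair \<alpha>' \<beta>' = tot_diff G K act 2 c \<otimes>\<^bsub>tot_group G K 2 3\<^esub> tot_pair \<alpha> \<beta>"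
    using coh by (auto simp: cohomologous_def tot_coboundaries_def)
  note mem = tot_group_2_cases [OF c]
  have \<alpha>': "\<alpha>' gs ks = delta_G G K act (c 1) gs ks * \<alpha> gs ks" for gs ks
    using fun_cong [OF fun_cong [OF fun_cong [OF eq, of 1], of gs], of ks]
    unfolding tot_diff_2 [OF c] by (simp add: tot_pair_def tot_group_def)
  have \<beta>': "\<beta>' gs ks = delta_G G K act (c 2) gs ks / delta_K G K (c 1) gs ks * \<beta> gs ks" for gs ks
    using fun_cong [OF fun_cong [OF fun_cong [OF eq, of 2], of gs], of ks]
    unfolding tot_diff_2 [OF c] by (simp add: tot_pair_def tot_group_def)
  note nz = cochain_nonzero [OF mem(1), simplified] cochain_nonzero [OF mem(2)]
  \<comment> \<open>The row-1 component is used as it is, the row-2 component inverted: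
    \<open>b_cocycle\<close> has the moved value of \<open>b\<close> in the numerator, whereas
    \<open>delta_G\<close> has the moved value in the denominator.\<close>
  have "gauge G K act \<alpha> \<beta> \<alpha>' \<beta>' (\<lambda>g x. c 1 [g] [x]) (\<lambda>x y. 1 / c 2 [] [x, y])"
  proof
    show "c 1 [\<one>] [x] = 1" "c 1 [g] [\<one>\<^bsub>K\<^esub>] = 1" for g x
      by (rule cochain_normalised [OF mem(1)], simp)+
    show "\<alpha>' [g, h] [x] * c 1 [g \<otimes> h] [x] = c 1 [g] [act h x] * c 1 [h] [x] * \<alpha> [g, h] [x]"
      if "g \<in> carrier G" "h \<in> carrier G" "x \<in> carrier K" for g h x
      using that nz by (simp add: \<alpha>' delta_G_2)
    show "\<beta>' [g] [x, y] * (c 1 [g] [x] * c 1 [g] [y]) * (1 / c 2 [] [x, y]) =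
        1 / c 2 [] [act g x, act g y] * c 1 [g] [x \<otimes>\<^bsub>K\<^esub> y] * \<beta> [g] [x, y]"
      if "g \<in> carrier G" "x \<in> carrier K" "y \<in> carrier K" for g x y
      using that nz by (simp add: \<beta>' delta_G_1 delta_K_2)
  qed (simp_all add: m m' nz)
  then show thesis by (rule that)
qed

text \<open>Being cohomologous means that \<open>c\<close> lies in the coset of \<open>c'\<close>,
  and two cosets that meet coincide.\<close>

lemma cohomologous_iff_class_eq:
  assumes "c \<in> carrier (tot_cocycles G K act 2 3)" "c' \<in> carrier (tot_cocycles G K act 2 3)"
  shows "cohomologous G K act 2 3 c c' \<longleftrightarrow>
    cohomology_class G K act 2 3 c = cohomology_class G K act 2 3 c'"
proof -
  interpret N: normal "tot_coboundaries G K act 2 3" "tot_cocycles G K act 2 3"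
    by (rule tot_coboundaries_normal)
  have "cohomologous G K act 2 3 c c' \<longleftrightarrow> c \<in> cohomology_class G K act 2 3 c'"
    by (auto simp: cohomologous_def cohomology_class_def r_coset_def tot_cocycles_mult)
  also have "\<dots> \<longleftrightarrow> cohomology_class G K act 2 3 c = cohomology_class G K act 2 3 c'"
    unfolding cohomology_class_def
    using N.repr_independence [OF _ assms(2) N.subgroup_axioms, of c] N.rcos_self [OF assms(1) N.subgroup_axioms]
    by auto
  finally show ?thesis .
qed

text \<open>Exhibits the relation as equality of an invariant, from which the equivalence laws and
  the bijection follow formally.\<close>

lemma ring_structure_rel_iff:
  "((m, R), (m', R')) \<in> ring_structure_rel G K act \<longleftrightarrow>
    (m, R) \<in> ring_structures G K act \<and> (m', R') \<in> ring_structures G K act \<and>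
    cohomology_class G K act 2 3 (tot_pair (fst m) (snd m)) =
    cohomology_class G K act 2 3 (tot_pair (fst m') (snd m'))"
proof -
  have "tot_pair (fst m) (snd m) \<in> carrier (tot_cocycles G K act 2 3)"
    if "(m, R) \<in> ring_structures G K act" for m R
    using that multiplicative_structures_iff [of "fst m" "snd m"]
    by (auto simp: ring_structures_def ring_structure_of_def)
  then show ?thesis
    by (cases m; cases m') (auto simp: ring_structure_rel_def cohomologous_iff_class_eq)
qed

end

text \<open>A bare bijection would only compare cardinalities, so \<open>\<Phi>\<close> is
  prescribed on the class of every multiplicative structure. The other conjuncts certify that the
  objects are what they are called: a subgroup of a cohomology group, actual rings, and an
  equivalence whose classes consist of isomorphic rings.\<close>

theorem proposition5p7:
  fixes G :: "('g, 'a) monoid_scheme"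
    and K :: "('k, 'b) monoid_scheme"
    and act :: "'g \<Rightarrow> 'k \<Rightarrow> 'k"
  assumes "equivariant_monoid G K act"
  shows "group (tot_cohomology G K act 2 3)
    \<and> subgroup (MS G K act) (tot_cohomology G K act 2 3)
    \<and> (\<forall>(m, R) \<in> ring_structures G K act. ring R)
    \<and> equiv (ring_structures G K act) (ring_structure_rel G K act)
    \<and> (\<forall>((m, R), (m', R')) \<in> ring_structure_rel G K act. R \<simeq> R')
    \<and> (\<exists>\<Phi>. bij_betw \<Phi> (MS G K act) (ring_structures G K act // ring_structure_rel G K act)
        \<and> (\<forall>(\<alpha>, \<beta>) \<in> multiplicative_structures G K act.
              \<Phi> (cohomology_class G K act 2 3 (tot_pair \<alpha> \<beta>))
              = ring_structure_rel G K act `` {ring_structure_of G K act (\<alpha>, \<beta>)}))"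
proof -
  interpret equivariant_monoid G K act by fact
  let ?RS = "ring_structures G K act" and ?rel = "ring_structure_rel G K act"
  define cls where "cls m = cohomology_class G K act 2 3 (tot_pair (fst m) (snd m))" for m
  have rel: "((m, R), (m', R')) \<in> ?rel \<longleftrightarrow> (m, R) \<in> ?RS \<and> (m', R') \<in> ?RS \<and> cls m = cls m'" for m R m' R'
    unfolding cls_def by (rule ring_structure_rel_iff)
  have RS_iff: "(m, R) \<in> ?RS \<longleftrightarrow> m \<in> multiplicative_structures G K act \<and> R = KU G K act (fst m) (snd m)" for m R
    by (auto simp: ring_structures_def ring_structure_of_def)
  have MS: "MS G K act = cls ` multiplicative_structures G K act"
    unfolding MS_def cls_def multiplicative_structures_iff [symmetric] by force
  have ring: "ring R" if "(m, R) \<in> ?RS" for m R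
  proof -
    interpret multiplicative_structure G K act "fst m" "snd m"
      using that by unfold_locales (simp add: RS_iff)
    show ?thesis using that KU_ring by (simp add: RS_iff)
  qed
  have equiv: "equiv ?RS ?rel"
  proof (rule equivI)
    show "?rel \<subseteq> ?RS \<times> ?RS" using rel by auto
    show "refl_on ?RS ?rel" by (auto simp: refl_on_def rel)
    show "sym ?rel" by (auto simp: sym_def rel)
    show "trans ?rel" unfolding trans_def split_paired_All rel by simp
  qed
  have iso: "R \<simeq> R'" if mm': "((m, R), (m', R')) \<in> ?rel" for m R m' R'
  proof -
    have m: "m \<in> multiplicative_structures G K act" "R = KU G K act (fst m) (snd m)"
      and m': "m' \<in> multiplicative_structures G K act" "R' = KU G K act (fst m') (snd m')"
      using mm' by (auto simp: rel RS_iff)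
    \<comment> \<open>\<open>cohomologous_gauge\<close> expects the target structure as the first
      argument of \<open>cohomologous\<close>, hence the flip.\<close>
    have "((m', R'), (m, R)) \<in> ?rel" using mm' by (simp add: rel)
    then have "cohomologous G K act 2 3 (tot_pair (fst m') (snd m')) (tot_pair (fst m) (snd m))"
      by (cases m; cases m') (simp add: ring_structure_rel_def)
    then obtain a b where "gauge G K act (fst m) (snd m) (fst m') (snd m') a b"
      using cohomologous_gauge [of "fst m" "snd m" "fst m'" "snd m'"] m(1) m'(1) by auto
    from gauge.KU_iso [OF this] show ?thesis by (simp add: m m')
  qed
  \<comment> \<open>The fibre of \<open>cls\<close> over \<open>X\<close>: no representative is
    chosen, so there is no well-definedness to check.\<close>
  define \<Phi> where "\<Phi> X = {(m, R). (m, R) \<in> ?RS \<and> cls m = X}" for X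
  have \<Phi>_cls: "\<Phi> (cls m) = ?rel `` {ring_structure_of G K act m}"
    if "m \<in> multiplicative_structures G K act" for m
    using that by (auto simp: \<Phi>_def ring_structure_of_def rel RS_iff)
  have "bij_betw \<Phi> (MS G K act) (?RS // ?rel)"
    unfolding bij_betw_def
  proof
    show "inj_on \<Phi> (MS G K act)"
      unfolding MS
    proof (rule inj_onI, elim imageE)
      fix X Y m n assume *: "\<Phi> X = \<Phi> Y" "X = cls m" "m \<in> multiplicative_structures G K act"
      \<comment> \<open>The fibre is nonempty, and each of its members determines the class over
        which it lies.\<close>
      have "ring_structure_of G K act m \<in> \<Phi> X"
        using *(2,3) by (simp add: \<Phi>_def RS_iff ring_structure_of_def)
      then have "ring_structure_of G K act m \<in> \<Phi> Y" unfolding *(1) .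
      then show "X = Y" unfolding *(2) by (simp add: \<Phi>_def ring_structure_of_def)
    qed
    have "\<Phi> ` MS G K act =
        (\<lambda>m. ?rel `` {ring_structure_of G K act m}) ` multiplicative_structures G K act"
      unfolding MS image_image by (rule image_cong [OF refl \<Phi>_cls])
    also have "\<dots> = ?RS // ?rel"
      by (simp add: quotient_def ring_structures_def UNION_singleton_eq_range image_image)
    finally show "\<Phi> ` MS G K act = ?RS // ?rel" .
  qed
  moreover have "\<Phi> (cohomology_class G K act 2 3 (tot_pair \<alpha> \<beta>)) =
      ?rel `` {ring_structure_of G K act (\<alpha>, \<beta>)}"
    if "(\<alpha>, \<beta>) \<in> multiplicative_structures G K act" for \<alpha> \<beta>
    using \<Phi>_cls [OF that] by (simp add: cls_def)
  ultimately have "bij_betw \<Phi> (MS G K act) (?RS // ?rel) \<and>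
      (\<forall>(\<alpha>, \<beta>) \<in> multiplicative_structures G K act.
        \<Phi> (cohomology_class G K act 2 3 (tot_pair \<alpha> \<beta>)) =
        ?rel `` {ring_structure_of G K act (\<alpha>, \<beta>)})"
    by blast
  moreover have "\<forall>(m, R) \<in> ?RS. ring R"
    using ring by blast
  moreover have "\<forall>((m, R), (m', R')) \<in> ?rel. R \<simeq> R'"
    using iso by blast
  ultimately show ?thesis
    using tot_cohomology_group MS_subgroup equiv by blast
qed

end
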